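(* Let $1\le m\le n$ and $\lambda\in[P_{n+l-1}]_{\ge l}$. Then $$\bigcup_{\substack{\mu\in[P_{n+l-1}]_{\ge l}\\ \mu\unlhd\lambda}}G_{l,m,\mu}$$ is a Gröbner basis (with respect to the lexicographic order with $x_1<\cdots<x_n$) of $\sqrt{I_{l,m,\lambda}}=J_{l,m,\mathcal F}$, where $\mathcal F$ is the upper filter $\{\nu\in[P_{n+l-1}]_{\ge l}\mid\nu\not\unlhd\lambda\}$. In particular, $$\sqrt{I_{l,m,\lambda}}=\sum_{\substack{\mu\in[P_{n+l-1}]_{\ge l}\\ \mu\unlhd\lambda}}I_{l,m,\mu}.$$
   Context: $K$ is an infinite field, $n,l\ge 1$ are integers, $S=K[x_1,\ldots,x_n]$. $P_m$ (for any positive integer $m$) is the set of partitions of $m$ (non-increasing sequences of positive integers with sum $m$). The dominance order: for $\lambda=(\lambda_1,\ldots,\lambda_p)$, $\mu=(\mu_1,\ldots,\mu_q)$ partitions of the same integer, $\lambda\unrhd\mu$ (equivalently $\mu\unlhd\lambda$) iff $\lambda_1+\cdots+\lambda_i\ge\mu_1+\cdots+\mu_i$ for $1\le i\le\min\{p,q\}$. $[P_{n+l-1}]_{\ge l}:=\{\lambda\in P_{n+l-1}\mid \lambda_1\ge l\}$. A subset $\mathcal F\subset[P_{n+l-1}]_{\ge l}$ is an upper filter if $\lambda\in\mathcal F$, $\mu\in[P_{n+l-1}]_{\ge l}$ and $\mu\unrhd\lambda$ imply $\mu\in\mathcal F$. For $\lambda\in[P_{n+l-1}]_{\ge l}$,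 $\mathrm{Tab}(l,\lambda)$ is the set of bijective fillings $T$ of the squares of the Young diagram of $\lambda$ by the multiset consisting of $l$ copies of $1$ and one copy of each of $2,\ldots,n$, such that no two copies of $1$ lie in the same column. If $a_1,\ldots,a_r$ are the entries of a column from top to bottom, its difference product is $\prod_{1\le i<j\le r}(x_{a_i}-x_{a_j})$; the Specht polynomial $f_T$ is the product of the difference products of all columns of $T$. Fix an integer $m$ with $1\le m\le n$ and set $\Delta_m:=\prod_{1\le i<j\le m}(x_i-x_j)$. For $T\in\mathrm{Tab}(l,\mu)$ set $f_{m,T}:=\operatorname{lcm}\{f_T,\Delta_m\}\in S$. For $\mu\in[P_{n+l-1}]_{\ge l}$ set $G_{l,m,\mu}:=\{f_{m,T}\mid T\in\mathrm{Tab}(l,\mu)\}$ and let $I_{l,m,\mu}$ be the ideal of $S$ generated by $G_{l,m,\mu}$. For $\mathbf a=(a_1,\ldots,a_n)\in K^n$, $\Lambda_l(\mathbf a)\in[P_{n+l-1}]_{\ge l}$ is the partition of $n+l-1$ whose parts are the multiplicities of the distinct values in the sequence $(a_1,\ldots,a_1,a_2,\ldots,a_n)$ in which $a_1$ is written $l$ times. For an upper filter $\mathcal F$, $J_{l,\mathcal F}$ is the ideal of all $f\in S$ with $f(\mathbf a)=0$ for every $\mathbf a\in K^n$ with $\Lambda_l(\mathbf a)\in\mathcal F$ (so $J_{l,\emptyset}=S$), and $J_{l,m,\mathcal F}:=(\Delta_m)\cap J_{l,\mathcal F}$. *)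

theory Defs
  imports
    "HOL-Library.Poly_Mapping"
    "HOL-Library.Multiset"
    "HOL-Library.FuncSet"
    "HOL-Algebra.Ideal"
    "HOL-Algebra.Divisibility"
begin

section \<open>The polynomial ring in n variables\<close>

text \<open>
  A monomial is a finitely supported exponent function, and a polynomial is a finitely supported
  coefficient function on monomials; the ring operations are those of
  \<^theory>\<open>HOL-Library.Poly_Mapping\<close>. Variables are indexed by all natural numbers, and the ring
  \<open>K[x_1,\<dots>,x_n]\<close> consists of the polynomials in which only \<open>x_1, \<dots>, x_n\<close> occur.
\<close>

type_synonym monom = "nat \<Rightarrow>\<^sub>0 nat"
type_synonym 'k mpoly = "monom \<Rightarrow>\<^sub>0 'k"

definition X :: "nat \<Rightarrow> 'k::field mpoly" where
  "X i = Poly_Mapping.single (Poly_Mapping.single i 1) 1"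

definition poly_ring :: "nat \<Rightarrow> ('k::field mpoly) ring" where
  "poly_ring n =
     \<lparr>carrier = {f. \<forall>t \<in> Poly_Mapping.keys f. Poly_Mapping.keys t \<subseteq> {1..n}},
      monoid.mult = (*), one = 1, ring.zero = 0, ring.add = (+)\<rparr>"

definition eval_poly :: "(nat \<Rightarrow> 'k::field) \<Rightarrow> 'k mpoly \<Rightarrow> 'k" where
  "eval_poly a f =
     (\<Sum>t \<in> Poly_Mapping.keys f.
        Poly_Mapping.lookup f t * (\<Prod>i \<in> Poly_Mapping.keys t. a i ^ Poly_Mapping.lookup t i))"

definition radical :: "('a, 'b) ring_scheme \<Rightarrow> 'a set \<Rightarrow> 'a set" where
  "radical R I = {f \<in> carrier R. \<exists>k::nat. k \<ge> 1 \<and> f [^]\<^bsub>R\<^esub> k \<in> I}"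

text \<open>Meant for a finite index set; \<open>\<Sum>\<close> over an infinite one would be 0.\<close>

definition ideal_sum :: "'i set \<Rightarrow> ('i \<Rightarrow> ('a::comm_monoid_add) set) \<Rightarrow> 'a set" where
  "ideal_sum A I = {(\<Sum>i\<in>A. g i) | g. \<forall>i\<in>A. g i \<in> I i}"


section \<open>Groebner bases for the lexicographic order with smallest variable first\<close>

text \<open>
  As \<open>x_1 < x_2 < \<dots>\<close>, exponents are compared at the largest index where they differ. This is not
  the order instance of \<^theory>\<open>HOL-Library.Poly_Mapping\<close>, which compares at the smallest index.
\<close>

definition lex_less :: "monom \<Rightarrow> monom \<Rightarrow> bool" where
  "lex_less s t \<longleftrightarrow>
     (\<exists>i. Poly_Mapping.lookup s i < Poly_Mapping.lookup t i \<and>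
          (\<forall>j>i. Poly_Mapping.lookup s j = Poly_Mapping.lookup t j))"

definition lead_monom :: "'k::field mpoly \<Rightarrow> monom" where
  "lead_monom f =
     (THE t. t \<in> Poly_Mapping.keys f \<and> (\<forall>s \<in> Poly_Mapping.keys f. s \<noteq> t \<longrightarrow> lex_less s t))"

definition initial_ideal :: "nat \<Rightarrow> 'k::field mpoly set \<Rightarrow> 'k mpoly set" where
  "initial_ideal n F =
     Idl\<^bsub>poly_ring n\<^esub> ((\<lambda>f. Poly_Mapping.single (lead_monom f) 1) ` (F - {0}))"

definition is_groebner_basis :: "nat \<Rightarrow> 'k::field mpoly set \<Rightarrow> 'k mpoly set \<Rightarrow> bool" where
  "is_groebner_basis n G I \<longleftrightarrow>
     ideal I (poly_ring n) \<and> finite G \<and> G \<subseteq> I \<and> initial_ideal n G = initial_ideal n I"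


section \<open>Partitions\<close>

definition partitions :: "nat \<Rightarrow> nat list set" where
  "partitions m = {p. sorted_wrt (\<ge>) p \<and> (\<forall>k \<in> set p. k > 0) \<and> sum_list p = m}"

text \<open>The dominance order, meant for partitions of the same integer.\<close>

definition dominates :: "nat list \<Rightarrow> nat list \<Rightarrow> bool" (infix \<open>\<unrhd>\<close> 50) where
  "p \<unrhd> q \<longleftrightarrow>
     (\<forall>i \<in> {1..min (length p) (length q)}. sum_list (take i p) \<ge> sum_list (take i q))"

abbreviation dominated_by :: "nat list \<Rightarrow> nat list \<Rightarrow> bool" (infix \<open>\<unlhd>\<close> 50) where
  "q \<unlhd> p \<equiv> p \<unrhd> q"

text \<open>The partitions of \<open>n + l - 1\<close> with first part at least \<open>l\<close> (for \<open>n, l \<ge> 1\<close>).\<close>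

definition parts_ge :: "nat \<Rightarrow> nat \<Rightarrow> nat list set" where
  "parts_ge n l = {p \<in> partitions (n + l - 1). hd p \<ge> l}"

definition upper_filter :: "nat \<Rightarrow> nat \<Rightarrow> nat list set \<Rightarrow> bool" where
  "upper_filter n l F \<longleftrightarrow>
     F \<subseteq> parts_ge n l \<and> (\<forall>p \<in> F. \<forall>q \<in> parts_ge n l. q \<unrhd> p \<longrightarrow> q \<in> F)"


section \<open>Tableaux and Specht polynomials\<close>

text \<open>Squares are pairs (row, column), both counted from 0.\<close>

definition diagram :: "nat list \<Rightarrow> (nat \<times> nat) set" where
  "diagram p = {(i, j). i < length p \<and> j < p ! i}"

definition Tab :: "nat \<Rightarrow> nat \<Rightarrow> nat list \<Rightarrow> (nat \<times> nat \<Rightarrow> nat) set" where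
  "Tab n l p =
     {T \<in> extensional (diagram p).
        image_mset T (mset_set (diagram p)) = replicate_mset l 1 + mset_set {2..n} \<and>
        (\<forall>i i' j. (i, j) \<in> diagram p \<and> (i', j) \<in> diagram p \<and> T (i, j) = 1 \<and> T (i', j) = 1
           \<longrightarrow> i = i')}"

definition column :: "nat list \<Rightarrow> (nat \<times> nat \<Rightarrow> nat) \<Rightarrow> nat \<Rightarrow> nat list" where
  "column p T j = [T (i, j). i \<leftarrow> [0..<length p], j < p ! i]"

definition diff_prod :: "nat list \<Rightarrow> 'k::field mpoly" where
  "diff_prod as = (\<Prod>(i, j) \<in> {(i, j). i < j \<and> j < length as}. X (as ! i) - X (as ! j))"

definition specht :: "nat list \<Rightarrow> (nat \<times> nat \<Rightarrow> nat) \<Rightarrow> 'k::field mpoly" where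
  "specht p T = (\<Prod>j < hd p. diff_prod (column p T j))"

definition Delta :: "nat \<Rightarrow> 'k::field mpoly" where
  "Delta m = (\<Prod>(i, j) \<in> {(i, j). 1 \<le> i \<and> i < j \<and> j \<le> m}. X i - X j)"

text \<open>
  The least common multiple is determined only up to a nonzero constant; \<^const>\<open>somelcm\<close> picks an
  arbitrary one for each pair of polynomials.
\<close>

definition f_lcm :: "nat \<Rightarrow> nat \<Rightarrow> nat list \<Rightarrow> (nat \<times> nat \<Rightarrow> nat) \<Rightarrow> 'k::field mpoly" where
  "f_lcm n m p T = somelcm (poly_ring n) (specht p T) (Delta m)"

definition G_set :: "nat \<Rightarrow> nat \<Rightarrow> nat \<Rightarrow> nat list \<Rightarrow> 'k::field mpoly set" where
  "G_set n l m p = {f_lcm n m p T | T. T \<in> Tab n l p}"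

definition I_ideal :: "nat \<Rightarrow> nat \<Rightarrow> nat \<Rightarrow> nat list \<Rightarrow> 'k::field mpoly set" where
  "I_ideal n l m p = Idl\<^bsub>poly_ring n\<^esub> (G_set n l m p)"


section \<open>Vanishing ideals of orbit types\<close>

text \<open>
  A point of \<open>K^n\<close> is given by a function on the natural numbers, of which only the values at
  \<open>1, \<dots>, n\<close> matter.
\<close>

definition orbit_type :: "nat \<Rightarrow> nat \<Rightarrow> (nat \<Rightarrow> 'k) \<Rightarrow> nat list" where
  "orbit_type n l a =
     (let M = replicate_mset l (a 1) + image_mset a (mset_set {2..n})
      in rev (sorted_list_of_multiset (image_mset (count M) (mset_set (set_mset M)))))"

definition J_van :: "nat \<Rightarrow> nat \<Rightarrow> nat list set \<Rightarrow> 'k::field mpoly set" where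
  "J_van n l F =
     {f \<in> carrier (poly_ring n). \<forall>a. orbit_type n l a \<in> F \<longrightarrow> eval_poly a f = 0}"

definition J_ideal :: "nat \<Rightarrow> nat \<Rightarrow> nat \<Rightarrow> nat list set \<Rightarrow> 'k::field mpoly set" where
  "J_ideal n l m F = PIdl\<^bsub>poly_ring n\<^esub> (Delta m) \<inter> J_van n l F"

end

theory Submission
  imports Defs "HOL-Computational_Algebra.Polynomial" "HOL-Combinatorics.Permutations"
begin

text \<open>
  A point \<open>a\<close> colours the entries \<open>1, \<dots>, n\<close> by its coordinates, and its
  orbit type lists the sizes of the colour classes, where \<open>1\<close> counts \<open>l\<close> times. A Specht polynomial
  \<open>f_T\<close> does not vanish at \<open>a\<close> iff in each column of \<open>T\<close> the entries have different colours. For a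
  shape \<open>\<mu>\<close>, this can be achieved by some \<open>T\<close> iff the orbit type is dominated by \<open>\<mu>\<close>: necessity
  is a count of squares in the first \<open>i\<close> rows (\<open>orbit_type_dominated\<close>), sufficiency is the
  Gale--Ryser theorem (\<open>exists_tableau_separating_colours\<close>).

  Over an infinite field, divisibility by a product of distinct differences \<open>x_i - x_j\<close> is a
  vanishing condition (\<open>pair_prod_divides\<close>). So \<open>f_{m,T}\<close> is, up to a unit, the product of the
  differences that occur in \<open>f_T\<close> or in the Vandermonde product \<open>\<Delta>_m\<close>, and \<open>J_{l,m,F}\<close> is the
  vanishing ideal of the points whose orbit type is in \<open>F\<close> or whose first \<open>m\<close> coordinates are not
  distinct. By the above, it contains \<open>f_{m,T}\<close> for all \<open>T\<close> of shape \<open>\<mu> \<unlhd> \<lambda>\<close>.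

  The Groebner property says that the leading monomial of each nonzero \<open>f \<in> J_{l,m,F}\<close> is divisible
  by that of such an \<open>f_{m,T}\<close> (\<open>lead_monom_divisible\<close>). The tableau is built from the exponents of
  the leading monomial, one variable at a time. If \<open>x_n\<close> has exponent \<open>d\<close>, then \<open>n\<close> is put under the
  highest column of height at most \<open>d\<close>, so that it contributes at most \<open>d\<close> to the exponents of the
  product of differences. In parallel one constructs a point at which \<open>f\<close> does not vanish, and whose
  orbit type dominates the shape of \<open>T\<close>: any of the \<open>d + 1\<close> most frequent coordinates, continued by
  new values if there are too few, may be taken as \<open>a_n\<close> without losing dominance (\<open>insert_box_dominance\<close>), and a polynomial of degree \<open>d\<close>
  in \<open>x_n\<close> has at most \<open>d\<close> roots. Since \<open>f \<in> J_{l,m,F}\<close>, the orbit type of this point is dominated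
  by \<open>\<lambda>\<close>, and hence so is the shape. Division then shows that the \<open>f_{m,T}\<close> generate \<open>J_{l,m,F}\<close>,
  which is therefore the sum of the ideals \<open>I_{l,m,\<mu>}\<close>.

  Finally \<open>J_{l,m,F}\<close> is the radical of \<open>I_{l,m,\<lambda>}\<close>. It is radical as a vanishing ideal. Conversely,
  as all generators are products of differences of variables, only the equalities among the
  coordinates of a point matter. A case distinction over these equalities inside the polynomial
  ring (\<open>radical_by_splitting\<close>) takes the place of the Nullstellensatz, and in each case the two
  colouring statements produce a suitable tableau of shape \<open>\<lambda>\<close>
  (\<open>specht_times_complement_in_ideal\<close>).
\<close>

section \<open>Polynomials, ideals and evaluation\<close>

abbreviation polys :: "nat \<Rightarrow> 'k::field mpoly set" where
  "polys n \<equiv> carrier (poly_ring n)"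

lemma polys_iff: "f \<in> polys n \<longleftrightarrow> (\<forall>t\<in>Poly_Mapping.keys f. Poly_Mapping.keys t \<subseteq> {1..n})"
  by (simp add: poly_ring_def)

lemma poly_ring_ops [simp]:
  "\<one>\<^bsub>poly_ring n\<^esub> = 1" "\<zero>\<^bsub>poly_ring n\<^esub> = 0"
  "f \<otimes>\<^bsub>poly_ring n\<^esub> g = f * g" "f \<oplus>\<^bsub>poly_ring n\<^esub> g = f + g"
  by (simp_all add: poly_ring_def)

lemma polys_0 [simp]: "0 \<in> polys n"
  by (simp add: polys_iff)

lemma polys_1 [simp]: "1 \<in> polys n"
  by (simp add: polys_iff)

lemma polys_add [intro]: "f \<in> polys n \<Longrightarrow> g \<in> polys n \<Longrightarrow> f + g \<in> polys n"
  unfolding polys_iff using Poly_Mapping.keys_add[of f g] by blast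

lemma keys_uminus: "Poly_Mapping.keys (- f) = Poly_Mapping.keys (f :: 'k::field mpoly)"
  by (auto simp: in_keys_iff)

lemma polys_uminus [intro]: "f \<in> polys n \<Longrightarrow> - f \<in> polys n"
  unfolding polys_iff by (simp add: keys_uminus)

lemma polys_diff [intro]: "f \<in> polys n \<Longrightarrow> g \<in> polys n \<Longrightarrow> f - g \<in> polys n"
  using polys_add[of f n "- g"] by auto

lemma polys_mult [intro]:
  assumes "f \<in> polys n" "g \<in> polys n"
  shows "f * g \<in> polys n"
  unfolding polys_iff
proof
  fix t assume "t \<in> Poly_Mapping.keys (f * g)"
  then obtain a b where ab: "a \<in> Poly_Mapping.keys f" "b \<in> Poly_Mapping.keys g" "t = a + b"
    using Poly_Mapping.keys_mult[of f g] by blast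
  then have "Poly_Mapping.keys a \<subseteq> {1..n}" "Poly_Mapping.keys b \<subseteq> {1..n}"
    using assms by (auto simp: polys_iff)
  then show "Poly_Mapping.keys t \<subseteq> {1..n}"
    using Poly_Mapping.keys_add[of a b] ab(3) by blast
qed

lemma polys_sum [intro]: "(\<And>i. i \<in> A \<Longrightarrow> f i \<in> polys n) \<Longrightarrow> sum f A \<in> polys n"
  by (induction A rule: infinite_finite_induct) auto

lemma polys_prod [intro]: "(\<And>i. i \<in> A \<Longrightarrow> f i \<in> polys n) \<Longrightarrow> prod f A \<in> polys n"
  by (induction A rule: infinite_finite_induct) auto

lemma polys_power [intro]: "f \<in> polys n \<Longrightarrow> f ^ k \<in> polys n"
  by (induction k) auto

lemma polys_single [intro]: "Poly_Mapping.keys t \<subseteq> {1..n} \<Longrightarrow> Poly_Mapping.single t c \<in> polys n"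
  by (auto simp: polys_iff)

lemma polys_X [intro]: "1 \<le> i \<Longrightarrow> i \<le> n \<Longrightarrow> X i \<in> polys n"
  unfolding X_def by (rule polys_single) auto

lemma cring_poly_ring: "cring (poly_ring n :: ('k::field mpoly) ring)"
proof (rule cringI)
  show "abelian_group (poly_ring n :: ('k mpoly) ring)"
  proof (rule abelian_groupI)
    fix x :: "'k mpoly" assume "x \<in> polys n"
    then show "\<exists>y\<in>polys n. y \<oplus>\<^bsub>poly_ring n\<^esub> x = \<zero>\<^bsub>poly_ring n\<^esub>"
      by (intro bexI[of _ "- x"]) auto
  qed (auto simp: ac_simps)
  show "comm_monoid (poly_ring n :: ('k mpoly) ring)"
    by (rule comm_monoidI) (auto simp: ac_simps)
qed (auto simp: algebra_simps)

lemma nat_pow_poly_ring: "f [^]\<^bsub>poly_ring n\<^esub> (k::nat) = f ^ k"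
  by (induction k) (auto simp: nat_pow_def mult.commute)

lemma a_inv_poly_ring: "f \<in> polys n \<Longrightarrow> \<ominus>\<^bsub>poly_ring n\<^esub> f = - (f :: 'k::field mpoly)"
  using abelian_group.minus_equality[of "poly_ring n" "-f" f] cring.axioms(1)[OF cring_poly_ring]
    ring.is_abelian_group by (metis add.left_inverse poly_ring_ops(2,4) polys_uminus)

lemma ideal_poly_ring_iff:
  fixes I :: "'k::field mpoly set"
  shows "ideal I (poly_ring n) \<longleftrightarrow> I \<subseteq> polys n \<and> 0 \<in> I \<and>
    (\<forall>f\<in>I. \<forall>g\<in>I. f + g \<in> I) \<and> (\<forall>f\<in>I. \<forall>g\<in>polys n. g * f \<in> I)"
    (is "_ \<longleftrightarrow> ?R")
proof
  assume I: "ideal I (poly_ring n)"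
  interpret ideal I "poly_ring n" by fact
  show ?R using a_subset I_l_closed additive_subgroup.zero_closed[OF is_additive_subgroup]
      additive_subgroup.a_closed[OF is_additive_subgroup] by auto
next
  assume R: ?R
  show "ideal I (poly_ring n)"
  proof (rule idealI)
    show "ring (poly_ring n :: ('k mpoly) ring)" by (rule cring.axioms(1)[OF cring_poly_ring])
    show "subgroup I (add_monoid (poly_ring n))"
    proof (rule group.subgroupI)
      show "group (add_monoid (poly_ring n :: ('k mpoly) ring))"
        using abelian_group.a_group cring.axioms(1) cring_poly_ring ring.is_abelian_group by blast
      fix a assume a: "a \<in> I"
      then have "(- 1) * a \<in> I" using R polys_uminus[OF polys_1] by blast
      moreover have "inv\<^bsub>add_monoid (poly_ring n)\<^esub> a = - a"
        using a_inv_poly_ring[of a n] R a by (auto simp: a_inv_def)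
      ultimately show "inv\<^bsub>add_monoid (poly_ring n)\<^esub> a \<in> I" by simp
    qed (use R in auto)
  qed (use R in \<open>auto simp: mult.commute\<close>)
qed

lemma idealD:
  fixes I :: "'k::field mpoly set"
  assumes "ideal I (poly_ring n)"
  shows "I \<subseteq> polys n" "0 \<in> I" "f \<in> I \<Longrightarrow> g \<in> I \<Longrightarrow> f + g \<in> I"
    "f \<in> I \<Longrightarrow> g \<in> polys n \<Longrightarrow> g * f \<in> I" "f \<in> I \<Longrightarrow> - f \<in> I"
    "f \<in> I \<Longrightarrow> g \<in> I \<Longrightarrow> f - g \<in> I"
proof -
  note * = assms[unfolded ideal_poly_ring_iff]
  show "I \<subseteq> polys n" "0 \<in> I" "f \<in> I \<Longrightarrow> g \<in> I \<Longrightarrow> f + g \<in> I"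
    "f \<in> I \<Longrightarrow> g \<in> polys n \<Longrightarrow> g * f \<in> I" for f g using * by auto
  show m: "f \<in> I \<Longrightarrow> - f \<in> I" for f
    using * polys_uminus[OF polys_1, of n] by (metis mult_minus_left mult_1)
  show "f \<in> I \<Longrightarrow> g \<in> I \<Longrightarrow> f - g \<in> I"
    using * m[of g] by (metis diff_conv_add_uminus)
qed

lemma ideal_Idl:
  fixes S :: "'k::field mpoly set"
  assumes "S \<subseteq> polys n"
  shows "ideal (Idl\<^bsub>poly_ring n\<^esub> S) (poly_ring n)" "S \<subseteq> Idl\<^bsub>poly_ring n\<^esub> S"
  using ring.genideal_ideal[OF cring.axioms(1)[OF cring_poly_ring] assms]
    ring.genideal_self[OF cring.axioms(1)[OF cring_poly_ring] assms] by auto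

lemma Idl_minimal:
  fixes S :: "'k::field mpoly set"
  assumes "ideal I (poly_ring n)" "S \<subseteq> I"
  shows "Idl\<^bsub>poly_ring n\<^esub> S \<subseteq> I"
  using ring.genideal_minimal[OF cring.axioms(1)[OF cring_poly_ring] assms] .

lemma mpoly_eq_sum_singles:
  fixes f :: "'k::field mpoly"
  shows "f = (\<Sum>t\<in>Poly_Mapping.keys f. Poly_Mapping.single t (Poly_Mapping.lookup f t))"
proof (rule poly_mapping_eqI)
  fix s
  show "Poly_Mapping.lookup f s =
    Poly_Mapping.lookup (\<Sum>t\<in>Poly_Mapping.keys f. Poly_Mapping.single t (Poly_Mapping.lookup f t)) s"
    by (simp add: lookup_sum lookup_single when_def in_keys_iff sum.delta)
qed

lemma mpoly_induct [case_names zero single add]: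
  fixes f :: "'k::field mpoly"
  assumes "P 0"
    and "\<And>t. t \<in> Poly_Mapping.keys f \<Longrightarrow> P (Poly_Mapping.single t (Poly_Mapping.lookup f t))"
    and "\<And>g h. P g \<Longrightarrow> P h \<Longrightarrow> P (g + h)"
  shows "P f"
proof -
  have "A \<subseteq> Poly_Mapping.keys f \<Longrightarrow>
    P (\<Sum>t\<in>A. Poly_Mapping.single t (Poly_Mapping.lookup f t))" if "finite A" for A
    using that by (induction A) (auto intro: assms)
  from this[of "Poly_Mapping.keys f"] show ?thesis using mpoly_eq_sum_singles[of f] by simp
qed

definition mon_eval :: "(nat \<Rightarrow> 'k::field) \<Rightarrow> monom \<Rightarrow> 'k" where
  "mon_eval a t = (\<Prod>i\<in>Poly_Mapping.keys t. a i ^ Poly_Mapping.lookup t i)"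

lemma mon_eval_superset:
  "finite A \<Longrightarrow> Poly_Mapping.keys t \<subseteq> A \<Longrightarrow> mon_eval a t = (\<Prod>i\<in>A. a i ^ Poly_Mapping.lookup t i)"
  unfolding mon_eval_def by (intro prod.mono_neutral_left) (auto simp: in_keys_iff)

lemma mon_eval_add: "mon_eval a (s + t) = mon_eval a s * mon_eval a t"
proof -
  let ?A = "Poly_Mapping.keys s \<union> Poly_Mapping.keys t"
  have "mon_eval a (s + t) = (\<Prod>i\<in>?A. a i ^ Poly_Mapping.lookup (s + t) i)"
    using Poly_Mapping.keys_add[of s t] by (intro mon_eval_superset) auto
  then show ?thesis
    by (simp add: lookup_add power_add prod.distrib mon_eval_superset[of ?A])
qed

lemma eval_poly_superset:
  "finite A \<Longrightarrow> Poly_Mapping.keys f \<subseteq> A \<Longrightarrow>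
    eval_poly a f = (\<Sum>t\<in>A. Poly_Mapping.lookup f t * mon_eval a t)"
  unfolding eval_poly_def mon_eval_def
  by (intro sum.mono_neutral_left) (auto simp: in_keys_iff)

lemma eval_poly_0 [simp]: "eval_poly a 0 = 0"
  by (simp add: eval_poly_def)

lemma eval_poly_add [simp]: "eval_poly a (f + g) = eval_poly a f + eval_poly a g"
proof -
  let ?A = "Poly_Mapping.keys f \<union> Poly_Mapping.keys g"
  have "eval_poly a (f + g) = (\<Sum>t\<in>?A. Poly_Mapping.lookup (f + g) t * mon_eval a t)"
    using Poly_Mapping.keys_add[of f g] by (intro eval_poly_superset) auto
  then show ?thesis
    by (simp add: lookup_add distrib_right sum.distrib eval_poly_superset[of ?A])
qed

lemma eval_poly_single [simp]: "eval_poly a (Poly_Mapping.single t c) = c * mon_eval a t"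
  by (simp add: eval_poly_def mon_eval_def)

lemma eval_poly_sum [simp]: "eval_poly a (sum f A) = (\<Sum>i\<in>A. eval_poly a (f i))"
  by (induction A rule: infinite_finite_induct) auto

lemma eval_poly_mult [simp]: "eval_poly a (f * g) = eval_poly a f * eval_poly a g"
proof (induction f rule: mpoly_induct)
  case (single s)
  show ?case
  proof (induction g rule: mpoly_induct)
    case (single t)
    show ?case by (simp add: mult_single mon_eval_add)
  qed (auto simp: algebra_simps)
qed (auto simp: algebra_simps)

lemma eval_poly_1 [simp]: "eval_poly a 1 = 1"
  using eval_poly_single[of a 0 1] by (simp add: mon_eval_def del: eval_poly_single)

lemma eval_poly_uminus [simp]: "eval_poly a (- f) = - eval_poly a f"
  using eval_poly_add[of a f "- f"] by (simp add: add_eq_0_iff del: eval_poly_add)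

lemma eval_poly_diff [simp]: "eval_poly a (f - g) = eval_poly a f - eval_poly a g"
  using eval_poly_add[of a f "- g"] by simp

lemma eval_poly_prod [simp]: "eval_poly a (prod f A) = (\<Prod>i\<in>A. eval_poly a (f i))"
  by (induction A rule: infinite_finite_induct) auto

lemma eval_poly_power [simp]: "eval_poly a (f ^ k) = eval_poly a f ^ k"
  by (induction k) auto

lemma eval_poly_X [simp]: "eval_poly a (X i) = a i"
  by (simp add: X_def mon_eval_def)

lemma eval_poly_cong:
  assumes "f \<in> polys n" "\<And>i. 1 \<le> i \<Longrightarrow> i \<le> n \<Longrightarrow> a i = b i"
  shows "eval_poly a f = eval_poly b f"
  unfolding eval_poly_def
proof (rule sum.cong[OF refl])
  fix t assume "t \<in> Poly_Mapping.keys f"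
  then have "Poly_Mapping.keys t \<subseteq> {1..n}" using assms(1) by (auto simp: polys_iff)
  then have "(\<Prod>i\<in>Poly_Mapping.keys t. a i ^ Poly_Mapping.lookup t i) =
     (\<Prod>i\<in>Poly_Mapping.keys t. b i ^ Poly_Mapping.lookup t i)"
    using assms(2) by (intro prod.cong) auto
  then show "Poly_Mapping.lookup f t * (\<Prod>i\<in>Poly_Mapping.keys t. a i ^ Poly_Mapping.lookup t i) =
    Poly_Mapping.lookup f t * (\<Prod>i\<in>Poly_Mapping.keys t. b i ^ Poly_Mapping.lookup t i)" by simp
qed

section \<open>Leading monomials\<close>

lemma lex_less_irrefl: "\<not> lex_less s s"
  by (simp add: lex_less_def)

lemma lex_less_trans: assumes "lex_less s t" "lex_less t u" shows "lex_less s u"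
proof -
  obtain i where i: "Poly_Mapping.lookup s i < Poly_Mapping.lookup t i"
    "\<forall>j>i. Poly_Mapping.lookup s j = Poly_Mapping.lookup t j"
    using assms(1) unfolding lex_less_def by blast
  obtain k where k: "Poly_Mapping.lookup t k < Poly_Mapping.lookup u k"
    "\<forall>j>k. Poly_Mapping.lookup t j = Poly_Mapping.lookup u j"
    using assms(2) unfolding lex_less_def by blast
  show ?thesis
  proof (cases "i \<le> k")
    case True
    then have "Poly_Mapping.lookup s k < Poly_Mapping.lookup u k"
      using i k by (cases "i = k") (auto simp: order.strict_trans)
    then show ?thesis using True i k unfolding lex_less_def by (intro exI[of _ k]) auto
  next
    case False
    then have "Poly_Mapping.lookup s i < Poly_Mapping.lookup u i" using i k by simp
    then show ?thesis using False i k unfolding lex_less_def by (intro exI[of _ i]) auto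
  qed
qed

lemma lex_less_total: assumes "s \<noteq> t" shows "lex_less s t \<or> lex_less t s"
proof -
  let ?D = "{i. Poly_Mapping.lookup s i \<noteq> Poly_Mapping.lookup t i}"
  have "?D \<subseteq> Poly_Mapping.keys s \<union> Poly_Mapping.keys t" by (auto simp: in_keys_iff)
  then have fin: "finite ?D" by (rule finite_subset) auto
  have ne: "?D \<noteq> {}"
  proof
    assume "?D = {}"
    then have "s = t" by (intro poly_mapping_eqI) (simp only: Collect_empty_eq not_not)
    with assms show False ..
  qed
  define i where "i = Max ?D"
  have "i \<in> ?D" using Max_in[OF fin ne] by (simp only: i_def)
  then have neq: "Poly_Mapping.lookup s i < Poly_Mapping.lookup t i \<or>
      Poly_Mapping.lookup t i < Poly_Mapping.lookup s i"
    by (simp only: mem_Collect_eq nat_neq_iff)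
  have eq: "Poly_Mapping.lookup s j = Poly_Mapping.lookup t j" if "j > i" for j
  proof (rule ccontr)
    assume "Poly_Mapping.lookup s j \<noteq> Poly_Mapping.lookup t j"
    then have "j \<in> ?D" by (rule CollectI)
    from Max_ge[OF fin this] that show False by (simp only: i_def)
  qed
  from neq show ?thesis
  proof
    assume "Poly_Mapping.lookup s i < Poly_Mapping.lookup t i"
    with eq have "lex_less s t" unfolding lex_less_def by blast
    then show ?thesis ..
  next
    assume "Poly_Mapping.lookup t i < Poly_Mapping.lookup s i"
    with eq[symmetric] have "lex_less t s" unfolding lex_less_def by blast
    then show ?thesis ..
  qed
qed

lemma lex_less_add: "lex_less s t \<Longrightarrow> lex_less (s + u) (t + u)"
  unfolding lex_less_def by (auto simp: lookup_add)

lemma lex_less_add2: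
  assumes "s = t \<or> lex_less s t" "u = v \<or> lex_less u v" "s \<noteq> t \<or> u \<noteq> v"
  shows "lex_less (s + u) (t + v)"
proof -
  have "s + u = t + u \<or> lex_less (s + u) (t + u)" using assms(1) lex_less_add by blast
  moreover have "t + u = t + v \<or> lex_less (t + u) (t + v)"
    using assms(2) lex_less_add[of u v t] by (auto simp: add.commute)
  moreover have "s + u \<noteq> t + v" if "s = t \<or> u = v" using assms(3) that by auto
  ultimately show ?thesis
    using lex_less_trans[of "s + u" "t + u" "t + v"] assms by (metis add_left_cancel add_right_cancel)
qed

text \<open>
  The description by which \<^const>\<open>lead_monom\<close> is defined. As a predicate it can be verified directly,
  for instance for a product from its factors.
\<close>

definition is_lead :: "'k::field mpoly \<Rightarrow> monom \<Rightarrow> bool" where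
  "is_lead f t \<longleftrightarrow> t \<in> Poly_Mapping.keys f \<and> (\<forall>s\<in>Poly_Mapping.keys f. s \<noteq> t \<longrightarrow> lex_less s t)"

lemma lead_monom_eqI: "is_lead f t \<Longrightarrow> lead_monom f = t"
  unfolding lead_monom_def is_lead_def
  by (rule the_equality) (use lex_less_irrefl lex_less_trans in metis)+

lemma finite_has_lex_max:
  assumes "finite A" "A \<noteq> {}"
  shows "\<exists>t\<in>A. \<forall>s\<in>A. s \<noteq> t \<longrightarrow> lex_less s t"
  using assms
proof (induction A rule: finite_ne_induct)
  case (insert x A)
  then obtain t where t: "t \<in> A" "\<forall>s\<in>A. s \<noteq> t \<longrightarrow> lex_less s t" by auto
  show ?case
  proof (cases "lex_less x t")
    case True
    then show ?thesis using t by auto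
  next
    case False
    then have "lex_less t x" using lex_less_total t insert by metis
    then show ?thesis using t lex_less_trans by (metis insert_iff)
  qed
qed auto

lemma is_lead_lead_monom:
  assumes "f \<noteq> 0" shows "is_lead f (lead_monom f)"
proof -
  have "Poly_Mapping.keys f \<noteq> {}" using assms
    by (metis all_not_in_conv in_keys_iff lookup_zero poly_mapping_eqI)
  then obtain t where "is_lead f t"
    using finite_has_lex_max[of "Poly_Mapping.keys f"] unfolding is_lead_def by auto
  then show ?thesis using lead_monom_eqI by metis
qed

lemma lookup_mult_keys:
  fixes f g :: "'k::field mpoly"
  shows "Poly_Mapping.lookup (f * g) w = (\<Sum>s\<in>Poly_Mapping.keys f. \<Sum>t\<in>Poly_Mapping.keys g.
    (if s + t = w then Poly_Mapping.lookup f s * Poly_Mapping.lookup g t else 0))"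
proof -
  have "f * g = (\<Sum>s\<in>Poly_Mapping.keys f. \<Sum>t\<in>Poly_Mapping.keys g.
    Poly_Mapping.single (s + t) (Poly_Mapping.lookup f s * Poly_Mapping.lookup g t))"
    by (subst mpoly_eq_sum_singles[of f], subst mpoly_eq_sum_singles[of g])
      (simp add: sum_product mult_single)
  then show ?thesis by (simp add: lookup_sum lookup_single when_def)
qed

lemma is_lead_mult:
  fixes f g :: "'k::field mpoly"
  assumes "is_lead f t" "is_lead g u"
  shows "is_lead (f * g) (t + u)"
proof -
  have t: "t \<in> Poly_Mapping.keys f" and u: "u \<in> Poly_Mapping.keys g"
    using assms by (auto simp: is_lead_def)
  have less: "lex_less (s + v) (t + u)"
    if "s \<in> Poly_Mapping.keys f" "v \<in> Poly_Mapping.keys g" "s \<noteq> t \<or> v \<noteq> u" for s v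
    using that assms by (intro lex_less_add2) (auto simp: is_lead_def)
  have "Poly_Mapping.lookup (f * g) (t + u) = (\<Sum>s\<in>Poly_Mapping.keys f. \<Sum>v\<in>Poly_Mapping.keys g.
    (if s = t then if v = u then Poly_Mapping.lookup f t * Poly_Mapping.lookup g u else 0 else 0))"
    unfolding lookup_mult_keys
  proof (intro sum.cong refl)
    fix s v assume sv: "s \<in> Poly_Mapping.keys f" "v \<in> Poly_Mapping.keys g"
    show "(if s + v = t + u then Poly_Mapping.lookup f s * Poly_Mapping.lookup g v else 0) =
      (if s = t then if v = u then Poly_Mapping.lookup f t * Poly_Mapping.lookup g u else 0 else 0)"
      using less[OF sv] lex_less_irrefl by auto
  qed
  also have "\<dots> = Poly_Mapping.lookup f t * Poly_Mapping.lookup g u"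
  proof -
    have "(\<Sum>v\<in>Poly_Mapping.keys g. if s = t then if v = u then Poly_Mapping.lookup f t *
        Poly_Mapping.lookup g u else 0 else 0) =
        (if s = t then Poly_Mapping.lookup f t * Poly_Mapping.lookup g u else 0)" for s
      using u by (cases "s = t") (simp_all add: sum.delta)
    then show ?thesis using t by (simp add: sum.delta)
  qed
  finally have "t + u \<in> Poly_Mapping.keys (f * g)"
    using t u by (simp add: in_keys_iff)
  moreover have "lex_less w (t + u)" if "w \<in> Poly_Mapping.keys (f * g)" "w \<noteq> t + u" for w
    using that Poly_Mapping.keys_mult[of f g] less by auto
  ultimately show ?thesis by (auto simp: is_lead_def)
qed

lemma lead_monom_mult:
  fixes f g :: "'k::field mpoly"
  assumes "f \<noteq> 0" "g \<noteq> 0"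
  shows "lead_monom (f * g) = lead_monom f + lead_monom g"
  using assms by (intro lead_monom_eqI is_lead_mult is_lead_lead_monom)

lemma is_lead_single: "c \<noteq> 0 \<Longrightarrow> is_lead (Poly_Mapping.single t c) t"
  by (auto simp: is_lead_def)

lemma lead_monom_prod:
  fixes f :: "'i \<Rightarrow> 'k::field mpoly"
  assumes "\<And>i. i \<in> A \<Longrightarrow> f i \<noteq> 0"
  shows "lead_monom (prod f A) = (\<Sum>i\<in>A. lead_monom (f i))"
  using assms
proof (induction A rule: infinite_finite_induct)
  case (insert x A)
  then show ?case by (simp add: lead_monom_mult prod_zero_iff)
qed (use lead_monom_eqI[OF is_lead_single[of "1::'k" 0]] in auto)

lemma is_lead_X_diff:
  assumes "i < j" shows "is_lead (X i - X j :: 'k::field mpoly) (Poly_Mapping.single j 1)"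
proof -
  have ne: "Poly_Mapping.single i (1::nat) \<noteq> Poly_Mapping.single j 1"
    using assms by (metis lookup_single_eq lookup_single_not_eq nat_neq_iff zero_neq_one)
  have "Poly_Mapping.keys (X i - X j :: 'k mpoly) \<subseteq> {Poly_Mapping.single i 1, Poly_Mapping.single j 1}"
    unfolding X_def by (auto simp: in_keys_iff lookup_minus lookup_single when_def split: if_splits)
  moreover have "Poly_Mapping.single j 1 \<in> Poly_Mapping.keys (X i - X j :: 'k mpoly)"
    unfolding X_def using ne by (auto simp: in_keys_iff lookup_minus lookup_single when_def)
  moreover have "lex_less (Poly_Mapping.single i 1) (Poly_Mapping.single j 1)"
    unfolding lex_less_def using assms by (intro exI[of _ j]) (auto simp: lookup_single when_def)
  ultimately show ?thesis unfolding is_lead_def by auto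
qed

lemma X_diff_nonzero: "i \<noteq> j \<Longrightarrow> X i - X j \<noteq> (0 :: 'k::field mpoly)"
proof -
  assume "i \<noteq> j"
  have "eval_poly (\<lambda>k. if k = i then 1 else 0) (X i - X j) = (1::'k)"
    using \<open>i \<noteq> j\<close> by simp
  then show ?thesis by force
qed

section \<open>Expansion in the largest variable\<close>

lemma X_power: "X i ^ k = (Poly_Mapping.single (Poly_Mapping.single i k) 1 :: 'k::field mpoly)"
proof (induction k)
  case (Suc k)
  then show ?case by (simp add: X_def mult_single single_add[symmetric])
qed simp

lemma single_split_variable:
  fixes t :: monom and x :: "'k::field" and i :: nat
  obtains s k where "Poly_Mapping.single t x = Poly_Mapping.single s x * X i ^ k"
    "Poly_Mapping.keys s = Poly_Mapping.keys t - {i}"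
proof -
  define k where "k = Poly_Mapping.lookup t i"
  define s where "s = t - Poly_Mapping.single i k"
  have "s + Poly_Mapping.single i k = t"
    by (rule poly_mapping_eqI) (auto simp: s_def k_def lookup_add lookup_minus lookup_single when_def)
  then have "Poly_Mapping.single t x = Poly_Mapping.single s x * X i ^ k"
    by (simp add: X_power mult_single)
  moreover have "Poly_Mapping.keys s = Poly_Mapping.keys t - {i}"
    by (auto simp: s_def k_def in_keys_iff lookup_minus lookup_single when_def split: if_splits)
  ultimately show ?thesis using that by blast
qed

lemma last_variable_expansion:
  fixes f :: "'k::field mpoly"
  assumes "f \<in> polys (Suc n)"
  shows "\<exists>c d. (\<forall>k. c k \<in> polys n) \<and> (\<forall>k>d. c k = 0) \<and> f = (\<Sum>k\<le>d. c k * X (Suc n) ^ k)"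
proof (induction f rule: mpoly_induct)
  case zero
  show ?case by (intro exI[of _ "\<lambda>_. 0"]) auto
next
  case (single t)
  obtain s k where s: "Poly_Mapping.single t (Poly_Mapping.lookup f t) =
      Poly_Mapping.single s (Poly_Mapping.lookup f t) * X (Suc n) ^ k"
    "Poly_Mapping.keys s = Poly_Mapping.keys t - {Suc n}"
    by (rule single_split_variable)
  have "Poly_Mapping.keys t \<subseteq> {1..Suc n}" using assms single by (auto simp: polys_iff)
  then have "Poly_Mapping.keys s \<subseteq> {1..n}" unfolding s(2)
    by (auto simp: le_Suc_eq subset_iff)
  then have *: "Poly_Mapping.single s (Poly_Mapping.lookup f t) \<in> polys n" by (rule polys_single)
  define c where "c = (\<lambda>i. if i = k then Poly_Mapping.single s (Poly_Mapping.lookup f t) else 0)"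
  have "(\<Sum>i\<le>k. c i * X (Suc n) ^ i) =
    (\<Sum>i\<le>k. if i = k then Poly_Mapping.single s (Poly_Mapping.lookup f t) * X (Suc n) ^ k else 0)"
    by (intro sum.cong) (auto simp: c_def)
  also have "\<dots> = Poly_Mapping.single t (Poly_Mapping.lookup f t)" by (simp add: s(1))
  finally show ?case using * by (intro exI[of _ c] exI[of _ k]) (auto simp: c_def)
next
  case (add g h)
  obtain c d where c: "\<And>k. c k \<in> polys n" "\<And>k. k > d \<Longrightarrow> c k = 0" "g = (\<Sum>k\<le>d. c k * X (Suc n) ^ k)"
    using add(1) by blast
  obtain c' d' where c': "\<And>k. c' k \<in> polys n" "\<And>k. k > d' \<Longrightarrow> c' k = 0"
    "h = (\<Sum>k\<le>d'. c' k * X (Suc n) ^ k)"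
    using add(2) by blast
  let ?m = "max d d'"
  have "g = (\<Sum>k\<le>?m. c k * X (Suc n) ^ k)" unfolding c(3)
    by (rule sum.mono_neutral_left) (use c(2) in auto)
  moreover have "h = (\<Sum>k\<le>?m. c' k * X (Suc n) ^ k)" unfolding c'(3)
    by (rule sum.mono_neutral_left) (use c'(2) in auto)
  ultimately have "g + h = (\<Sum>k\<le>?m. (c k + c' k) * X (Suc n) ^ k)"
    by (simp add: sum.distrib distrib_right)
  then show ?case
    using c(1,2) c'(1,2) by (intro exI[of _ "\<lambda>k. c k + c' k"] exI[of _ ?m]) auto
qed

lemma polys_lookup_eq_0:
  "f \<in> polys n \<Longrightarrow> t \<in> Poly_Mapping.keys f \<Longrightarrow> i \<notin> {1..n} \<Longrightarrow> Poly_Mapping.lookup t i = 0"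
  by (metis in_keys_iff polys_iff subsetD)

text \<open>
  As \<open>x_{n+1}\<close> is the largest variable, the lexicographic order first compares its exponents.
  Hence the leading monomial of \<open>f\<close> is that of its top coefficient in \<open>x_{n+1}\<close>, times
  \<open>x_{n+1}^d\<close>. A nonzero top coefficient comes from taking an expansion of least length.
\<close>

lemma last_variable_lead:
  fixes f :: "'k::field mpoly"
  assumes f: "f \<in> polys (Suc n)" "f \<noteq> 0"
  obtains c d where "\<forall>k. c k \<in> polys n" "f = (\<Sum>k\<le>d. c k * X (Suc n) ^ k)" "c d \<noteq> 0"
    "lead_monom f = lead_monom (c d) + Poly_Mapping.single (Suc n) d"
proof -
  let ?P = "\<lambda>d. \<exists>c. (\<forall>k. c k \<in> polys n) \<and> f = (\<Sum>k\<le>d. c k * X (Suc n) ^ k)"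
  have ex: "\<exists>d. ?P d" using last_variable_expansion[OF f(1)] by blast
  define d where "d = (LEAST d. ?P d)"
  have "?P d" unfolding d_def using ex by (rule LeastI_ex)
  then obtain c where c: "\<And>k. c k \<in> polys n" "f = (\<Sum>k\<le>d. c k * X (Suc n) ^ k)" by blast
  have cd: "c d \<noteq> 0"
  proof
    assume 0: "c d = 0"
    show False
    proof (cases d)
      case 0
      then show False using c(2) \<open>c d = 0\<close> f(2) by simp
    next
      case (Suc e)
      have "?P e" using c 0 Suc by (intro exI[of _ c]) simp
      then have "d \<le> e" unfolding d_def by (rule Least_le)
      then show False using Suc by simp
    qed
  qed
  let ?L = "lead_monom (c d) + Poly_Mapping.single (Suc n) d"
  have lead_cd: "is_lead (c d) (lead_monom (c d))" using cd by (rule is_lead_lead_monom)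
  have keysk: "\<exists>u\<in>Poly_Mapping.keys (c k). s = u + Poly_Mapping.single (Suc n) k"
    if "s \<in> Poly_Mapping.keys (c k * X (Suc n) ^ k)" for s k
    using that Poly_Mapping.keys_mult[of "c k" "X (Suc n) ^ k"] unfolding X_power
    by (auto split: if_splits)
  have look: "Poly_Mapping.lookup (u + Poly_Mapping.single (Suc n) k) (Suc n) = k"
    if "u \<in> Poly_Mapping.keys (c j)" for u k j
    using polys_lookup_eq_0[OF c(1) that, of "Suc n"] by (simp add: lookup_add)
  have "is_lead f ?L"
    unfolding is_lead_def
  proof (intro conjI ballI impI)
    have 1: "is_lead (c d * X (Suc n) ^ d) ?L"
      unfolding X_power by (intro is_lead_mult lead_cd is_lead_single) simp
    have "Poly_Mapping.lookup f ?L = (\<Sum>k\<le>d. Poly_Mapping.lookup (c k * X (Suc n) ^ k) ?L)"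
      by (subst c(2)) (simp add: lookup_sum)
    also have "\<dots> = (\<Sum>k\<le>d. if k = d then Poly_Mapping.lookup (c d * X (Suc n) ^ d) ?L else 0)"
    proof (intro sum.cong refl)
      fix k
      show "Poly_Mapping.lookup (c k * X (Suc n) ^ k) ?L =
        (if k = d then Poly_Mapping.lookup (c d * X (Suc n) ^ d) ?L else 0)"
      proof (cases "k = d")
        case False
        have "?L \<notin> Poly_Mapping.keys (c k * X (Suc n) ^ k)"
        proof
          assume "?L \<in> Poly_Mapping.keys (c k * X (Suc n) ^ k)"
          then obtain u where u: "u \<in> Poly_Mapping.keys (c k)" "?L = u + Poly_Mapping.single (Suc n) k"
            using keysk by blast
          have "Poly_Mapping.lookup ?L (Suc n) = k" unfolding u(2) by (rule look[OF u(1)])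
          moreover have "Poly_Mapping.lookup ?L (Suc n) = d"
            using lead_cd by (intro look[of _ d]) (simp add: is_lead_def)
          ultimately show False using False by simp
        qed
        then show ?thesis using False by (simp add: in_keys_iff)
      qed simp
    qed
    also have "\<dots> \<noteq> 0" using 1 by (simp add: is_lead_def in_keys_iff)
    finally show "?L \<in> Poly_Mapping.keys f" by (simp add: in_keys_iff)
  next
    fix s assume s: "s \<in> Poly_Mapping.keys f" "s \<noteq> ?L"
    have "s \<in> (\<Union>k\<in>{..d}. Poly_Mapping.keys (c k * X (Suc n) ^ k))"
      using s(1) Poly_Mapping.keys_sum[of "\<lambda>k. c k * X (Suc n) ^ k" "{..d}"] by (subst (asm) c(2)) auto
    then obtain k u where k: "k \<le> d" "u \<in> Poly_Mapping.keys (c k)"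
        "s = u + Poly_Mapping.single (Suc n) k"
      using keysk by blast
    show "lex_less s ?L"
    proof (cases "k = d")
      case True
      then have "u \<noteq> lead_monom (c d)" using s k by auto
      then have "lex_less u (lead_monom (c d))" using lead_cd k True by (auto simp: is_lead_def)
      then show ?thesis using k True lex_less_add by blast
    next
      case False
      have ld: "lead_monom (c d) \<in> Poly_Mapping.keys (c d)" using lead_cd by (simp add: is_lead_def)
      show ?thesis unfolding lex_less_def
      proof (intro exI[of _ "Suc n"] conjI allI impI)
        show "Poly_Mapping.lookup s (Suc n) < Poly_Mapping.lookup ?L (Suc n)"
          using look[OF k(2), of k] look[OF ld, of d] k False by simp
        fix j assume "Suc n < j"
        then show "Poly_Mapping.lookup s j = Poly_Mapping.lookup ?L j"
          using polys_lookup_eq_0[OF c(1) k(2), of j] polys_lookup_eq_0[OF c(1) ld, of j] k(3)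
          by (simp add: lookup_add lookup_single_not_eq)
      qed
    qed
  qed
  then have "lead_monom f = ?L" by (rule lead_monom_eqI)
  then show ?thesis using that c cd by blast
qed

lemma eval_last_variable:
  assumes "\<And>k. c k \<in> polys n" "f = (\<Sum>k\<le>d. c k * X (Suc n) ^ k)"
  shows "eval_poly (a(Suc n := x)) f = (\<Sum>k\<le>d. eval_poly a (c k) * x ^ k)"
proof -
  have "eval_poly (a(Suc n := x)) (c k) = eval_poly a (c k)" for k
    by (rule eval_poly_cong[OF assms(1)]) auto
  then show ?thesis by (simp add: assms(2))
qed

lemma exists_nonroot:
  fixes b :: "nat \<Rightarrow> 'k::field"
  assumes "b d \<noteq> 0" "card S > d"
  shows "\<exists>x\<in>S. (\<Sum>k\<le>d. b k * x ^ k) \<noteq> 0"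
proof (rule ccontr)
  assume no: "\<not> (\<exists>x\<in>S. (\<Sum>k\<le>d. b k * x ^ k) \<noteq> 0)"
  define p where "p = (\<Sum>k\<le>d. Polynomial.monom (b k) k)"
  have ev: "poly p x = (\<Sum>k\<le>d. b k * x ^ k)" for x by (simp add: p_def poly_sum poly_monom)
  have cf: "Polynomial.coeff p k = (if k \<le> d then b k else 0)" for k
    by (simp add: p_def coeff_sum)
  have "p \<noteq> 0" using cf[of d] assms(1) by auto
  have "Polynomial.degree p \<le> d" by (rule degree_le) (simp add: cf)
  have "S \<subseteq> {x. poly p x = 0}" using no ev by auto
  then have "card S \<le> card {x. poly p x = 0}"
    using poly_roots_finite[OF \<open>p \<noteq> 0\<close>] by (rule card_mono[rotated])
  also have "\<dots> \<le> Polynomial.degree p" using \<open>p \<noteq> 0\<close> by (rule card_poly_roots_bound)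
  finally show False using assms(2) \<open>Polynomial.degree p \<le> d\<close> by simp
qed

text \<open>
  Induction on the number of variables: a nonzero value of the top coefficient leaves a nonzero
  polynomial in the last variable, which has too few roots to vanish on an infinite field.
\<close>

lemma exists_nonzero_value:
  fixes f :: "'k::field mpoly"
  assumes inf: "infinite (UNIV :: 'k set)" and "f \<in> polys n" "f \<noteq> 0"
  shows "\<exists>a. eval_poly a f \<noteq> 0"
  using assms(2,3)
proof (induction n arbitrary: f)
  case 0
  have "Poly_Mapping.keys f \<subseteq> {0}"
    using 0 by (auto simp: polys_iff)
  then have *: "eval_poly a f = Poly_Mapping.lookup f 0" for a
    using eval_poly_superset[of "{0}" f a] by (simp add: mon_eval_def)
  have "is_lead f (lead_monom f)" using 0 by (intro is_lead_lead_monom)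
  then have "lead_monom f \<in> Poly_Mapping.keys f" by (simp add: is_lead_def)
  then have "Poly_Mapping.lookup f 0 \<noteq> 0"
    using \<open>Poly_Mapping.keys f \<subseteq> {0}\<close> by (auto simp: in_keys_iff)
  then show ?case using * by simp
next
  case (Suc n)
  obtain c d where c: "\<forall>k. c k \<in> polys n" "f = (\<Sum>k\<le>d. c k * X (Suc n) ^ k)" "c d \<noteq> 0"
    "lead_monom f = lead_monom (c d) + Poly_Mapping.single (Suc n) d"
    by (rule last_variable_lead[OF Suc.prems])
  obtain a where a: "eval_poly a (c d) \<noteq> 0" using Suc.IH[OF c(1)[rule_format] c(3)] by blast
  obtain S :: "'k set" where S: "finite S" "card S = Suc d"
    using infinite_arbitrarily_large[OF inf] by blast
  obtain x where "(\<Sum>k\<le>d. eval_poly a (c k) * x ^ k) \<noteq> 0"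
    using exists_nonroot[of "\<lambda>k. eval_poly a (c k)" d S] a S by auto
  then show ?case using eval_last_variable[OF c(1)[rule_format] c(2)] by metis
qed

section \<open>Products of distinct differences of variables\<close>

definition pair_prod :: "(nat \<times> nat) set \<Rightarrow> 'k::field mpoly" where
  "pair_prod E = (\<Prod>(i, j)\<in>E. X i - X j)"

definition pairs_upto :: "nat \<Rightarrow> (nat \<times> nat) set" where
  "pairs_upto n = {(i, j). 1 \<le> i \<and> i < j \<and> j \<le> n}"

lemma finite_pairs_upto [simp]: "finite (pairs_upto n)"
  by (rule finite_subset[of _ "{1..n} \<times> {1..n}"]) (auto simp: pairs_upto_def)

lemma Delta_eq: "Delta m = pair_prod (pairs_upto m)"
  by (simp add: Delta_def pair_prod_def pairs_upto_def)

lemma pair_prod_in_polys: "E \<subseteq> pairs_upto n \<Longrightarrow> pair_prod E \<in> polys n"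
  unfolding pair_prod_def
  by (rule polys_prod) (auto simp: pairs_upto_def intro!: polys_diff polys_X)

lemma eval_pair_prod: "eval_poly a (pair_prod E) = (\<Prod>(i, j)\<in>E. a i - a j)"
  by (simp add: pair_prod_def case_prod_unfold)

lemma eval_pair_prod_eq_0_iff:
  "finite E \<Longrightarrow> eval_poly a (pair_prod E) = 0 \<longleftrightarrow> (\<exists>(i, j)\<in>E. a i = a j)"
  unfolding eval_pair_prod prod_zero_iff by (simp only: case_prod_unfold right_minus_eq)

lemma pair_prod_nonzero:
  assumes "E \<subseteq> pairs_upto n" shows "pair_prod E \<noteq> (0 :: 'k::field mpoly)"
proof -
  have "finite E" using assms finite_pairs_upto by (rule finite_subset)
  moreover have "X (fst e) - X (snd e) \<noteq> (0 :: 'k mpoly)" if "e \<in> E" for e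
    using assms that by (intro X_diff_nonzero) (auto simp: pairs_upto_def)
  ultimately show ?thesis unfolding pair_prod_def by (auto simp: prod_zero_iff case_prod_unfold)
qed

text \<open>
  Division by \<open>x_i - x_j\<close> amounts to replacing \<open>x_j\<close> by \<open>x_i\<close>. That the remainder is free of
  \<open>x_j\<close> is expressed by its values, which is the form in which it is used below.
\<close>

lemma remainder_mod_X_diff:
  fixes q :: "'k::field mpoly"
  assumes "q \<in> polys n" and ij: "i \<in> {1..n}" "j \<in> {1..n}" "i \<noteq> j"
  shows "\<exists>r\<in>polys n. \<exists>s\<in>polys n. q = r + (X i - X j) * s \<and>
    (\<forall>a x. eval_poly (a(j := x)) r = eval_poly a r)"
proof (induction q rule: mpoly_induct)
  case zero
  show ?case by (intro bexI[of _ 0]) auto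
next
  case (single t)
  obtain s k where s: "Poly_Mapping.single t (Poly_Mapping.lookup q t) =
      Poly_Mapping.single s (Poly_Mapping.lookup q t) * X j ^ k"
    "Poly_Mapping.keys s = Poly_Mapping.keys t - {j}"
    by (rule single_split_variable)
  let ?m = "Poly_Mapping.single s (Poly_Mapping.lookup q t) :: 'k mpoly"
  have m: "?m \<in> polys n"
    using assms(1) single s(2) by (intro polys_single) (auto simp: polys_iff)
  have Xi: "X i \<in> polys n" and Xj: "X j \<in> polys n" using ij by auto
  have "X i ^ k - X j ^ k = (X i - X j) * (\<Sum>l<k. X j ^ (k - Suc l) * X i ^ l :: 'k mpoly)"
    by (rule power_diff_sumr2)
  then have *: "X j ^ k = X i ^ k + (X i - X j) * (- (\<Sum>l<k. X j ^ (k - Suc l) * X i ^ l :: 'k mpoly))"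
    by (simp add: algebra_simps)
  have "mon_eval (a(j := x)) s = mon_eval a s" for a :: "nat \<Rightarrow> 'k" and x
    unfolding mon_eval_def by (rule prod.cong) (use s(2) in auto)
  then have "eval_poly (a(j := x)) (?m * X i ^ k) = eval_poly a (?m * X i ^ k)" for a x
    using ij(3) by simp
  moreover have "?m * X j ^ k = ?m * X i ^ k +
      (X i - X j) * (?m * - (\<Sum>l<k. X j ^ (k - Suc l) * X i ^ l))"
    by (subst *) (simp add: algebra_simps)
  moreover have "?m * X i ^ k \<in> polys n" "?m * - (\<Sum>l<k. X j ^ (k - Suc l) * X i ^ l) \<in> polys n"
    using m Xi Xj by (auto intro!: polys_mult polys_power polys_uminus polys_sum)
  ultimately show ?case unfolding s(1) by blast
next
  case (add g h)
  then obtain r s r' s' where *: "r \<in> polys n" "s \<in> polys n" "g = r + (X i - X j) * s"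
    "\<forall>a x. eval_poly (a(j := x)) r = eval_poly a r"
    "r' \<in> polys n" "s' \<in> polys n" "h = r' + (X i - X j) * s'"
    "\<forall>a x. eval_poly (a(j := x)) r' = eval_poly a r'"
    by blast
  have "g + h = (r + r') + (X i - X j) * (s + s')" unfolding *(3,7) by (simp add: algebra_simps)
  moreover have "eval_poly (a(j := x)) (r + r') = eval_poly a (r + r')" for a x
    unfolding eval_poly_add using *(4,8) by simp
  moreover have "r + r' \<in> polys n" "s + s' \<in> polys n" using * by auto
  ultimately show ?case by blast
qed

lemma exists_injective_point:
  assumes "infinite (UNIV :: 'k set)"
  obtains a :: "nat \<Rightarrow> 'k" where "inj a"
  using infinite_countable_subset[OF assms] by blast

text \<open>
  Divisibility by a product of distinct differences is a condition on zeros. One factor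
  \<open>x_i - x_j\<close> at a time: if \<open>h = P q\<close> with \<open>P\<close> the product of the other factors, then \<open>P q\<close> vanishes
  on the hyperplane \<open>x_i = x_j\<close>, so the product of the two remainders modulo \<open>x_i - x_j\<close> vanishes
  everywhere. The remainder of \<open>P\<close> is nonzero, because no other difference vanishes on the whole
  hyperplane, and therefore that of \<open>q\<close> is zero.
\<close>

lemma pair_prod_divides:
  fixes h :: "'k::field mpoly"
  assumes inf: "infinite (UNIV :: 'k set)"
    and E: "E \<subseteq> pairs_upto n" and h: "h \<in> polys n"
    and van: "\<And>a i j. (i, j) \<in> E \<Longrightarrow> a i = a j \<Longrightarrow> eval_poly a h = 0"
  shows "\<exists>q\<in>polys n. h = pair_prod E * q"
proof -
  have "finite E" using E finite_pairs_upto by (rule finite_subset)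
  then show ?thesis using E van
  proof (induction E)
    case empty
    show ?case using h by (simp add: pair_prod_def)
  next
    case (insert e E)
    obtain i j where e: "e = (i, j)" by (cases e)
    have ij: "1 \<le> i" "i < j" "j \<le> n" using insert.prems(1) e by (auto simp: pairs_upto_def)
    let ?P = "pair_prod E :: 'k mpoly"
    obtain q where q: "q \<in> polys n" "h = ?P * q"
      using insert.IH insert.prems by blast
    have P: "?P \<in> polys n" using insert.prems(1) by (intro pair_prod_in_polys) auto
    obtain r s where r: "r \<in> polys n" "s \<in> polys n" "q = r + (X i - X j) * s"
        "\<And>a x. eval_poly (a(j := x)) r = eval_poly a r"
      using remainder_mod_X_diff[OF q(1), of i j] ij by auto
    obtain rP sP where rP: "rP \<in> polys n" "sP \<in> polys n" "?P = rP + (X i - X j) * sP"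
        "\<And>a x. eval_poly (a(j := x)) rP = eval_poly a rP"
      using remainder_mod_X_diff[OF P, of i j] ij by auto
    have "eval_poly a (rP * r) = 0" for a
    proof -
      \<comment> \<open>Moving \<open>a\<close> onto the hyperplane \<open>x_i = x_j\<close> does not change the values of the remainders.\<close>
      let ?b = "a(j := a i)"
      have "eval_poly ?b h = 0" by (rule insert.prems(2)[of i j]) (use e ij in auto)
      then have "eval_poly ?b rP * eval_poly ?b r = 0"
        unfolding q(2) r(3) rP(3) using ij by simp
      then show ?thesis by (simp add: r(4) rP(4))
    qed
    then have "rP * r = 0"
      using exists_nonzero_value[OF inf, of "rP * r" n] r(1) rP(1) by blast
    moreover have "rP \<noteq> 0"
    proof
      assume 0: "rP = 0"
      obtain a0 :: "nat \<Rightarrow> 'k" where a0: "inj a0" using exists_injective_point[OF inf] .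
      let ?b = "a0(j := a0 i)"
      have "eval_poly ?b ?P = 0" unfolding rP(3) 0 using ij by simp
      then obtain u v where uv: "(u, v) \<in> E" "?b u = ?b v"
        using eval_pair_prod_eq_0_iff[OF insert.hyps(1)] by blast
      have "u < v" using uv insert.prems(1) by (auto simp: pairs_upto_def)
      then have "u = i \<and> v = j" using uv(2) a0 ij by (auto split: if_splits dest: injD)
      then show False using uv insert.hyps(2) e by simp
    qed
    ultimately have "r = 0" by simp
    then have "h = pair_prod (insert e E) * s"
      using q(2) r(3) insert.hyps by (simp add: pair_prod_def e algebra_simps)
    then show ?case using r(2) by blast
  qed
qed

text \<open>
  Both divisors are products of distinct differences, so common multiples are the polynomials that
  vanish on a union of hyperplanes, and the product over the union of the index sets is one least
  common multiple. Any other one differs from it by a unit.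
\<close>

lemma lcm_pair_prods:
  fixes g :: "'k::field mpoly"
  assumes inf: "infinite (UNIV :: 'k set)"
    and E: "E \<subseteq> pairs_upto n" "E' \<subseteq> pairs_upto n"
    and g: "g = pair_prod E \<or> g = - pair_prod E"
  shows "\<exists>v\<in>polys n. \<exists>v'\<in>polys n. v * v' = 1 \<and>
    somelcm (poly_ring n) g (pair_prod E') = v * pair_prod (E \<union> E')"
proof -
  let ?R = "poly_ring n :: ('k mpoly) ring" and ?L = "pair_prod (E \<union> E') :: 'k mpoly"
  have fin: "finite E" "finite E'" using E finite_pairs_upto by (auto intro: finite_subset)
  have L: "?L \<in> polys n" using E by (intro pair_prod_in_polys) auto
  have gdvd: "g divides\<^bsub>?R\<^esub> y \<longleftrightarrow> pair_prod E divides\<^bsub>?R\<^esub> y" for y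
  proof -
    have "\<exists>c\<in>polys n. y = - h * c" if "\<exists>c\<in>polys n. y = h * c" for h
      using that polys_uminus by (metis minus_mult_minus)
    from this[of "pair_prod E"] this[of "- pair_prod E"]
    have "(\<exists>c\<in>polys n. y = - pair_prod E * c) \<longleftrightarrow> (\<exists>c\<in>polys n. y = pair_prod E * c)"
      by (simp only: minus_minus) iprover
    then show ?thesis using g unfolding factor_def by (elim disjE) simp_all
  qed
  have dvd_van: "eval_poly a y = 0"
    if dvd: "pair_prod D divides\<^bsub>?R\<^esub> y" and "(i, j) \<in> D" "a i = a j" "finite D" for a y i j D
  proof -
    obtain c where "y = pair_prod D * c" using dvd by (auto simp: factor_def)
    moreover have "eval_poly a (pair_prod D) = 0" using that eval_pair_prod_eq_0_iff by blast
    ultimately show ?thesis by simp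
  qed
  have part: "pair_prod D divides\<^bsub>?R\<^esub> ?L" if "D \<subseteq> E \<union> E'" for D
    unfolding factor_def
  proof (intro bexI)
    show "?L = pair_prod D \<otimes>\<^bsub>?R\<^esub> pair_prod (E \<union> E' - D)"
      unfolding pair_prod_def poly_ring_ops using that fin
      by (metis finite_UnI mult.commute prod.subset_diff)
    show "pair_prod (E \<union> E' - D) \<in> polys n" using E by (intro pair_prod_in_polys) auto
  qed
  have "?L lcmof\<^bsub>?R\<^esub> g (pair_prod E')"
    unfolding islcm_def gdvd
  proof (intro conjI ballI impI part)
    fix y :: "'k mpoly"
    assume y: "y \<in> polys n" "pair_prod E divides\<^bsub>?R\<^esub> y \<and> pair_prod E' divides\<^bsub>?R\<^esub> y"
    have "\<exists>q\<in>polys n. y = ?L * q"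
    proof (rule pair_prod_divides[OF inf])
      fix a :: "nat \<Rightarrow> 'k" and i j assume "(i, j) \<in> E \<union> E'" "a i = a j"
      then show "eval_poly a y = 0"
        using y dvd_van[of E y i j a] dvd_van[of E' y i j a] fin by blast
    qed (use E y in auto)
    then show "?L divides\<^bsub>?R\<^esub> y" by (auto simp: factor_def)
  qed auto
  with L have ex: "\<exists>x. x \<in> polys n \<and> x lcmof\<^bsub>?R\<^esub> g (pair_prod E')" by blast
  define M where "M = somelcm ?R g (pair_prod E')"
  have M: "M \<in> polys n" "M lcmof\<^bsub>?R\<^esub> g (pair_prod E')"
    using someI_ex[OF ex] by (simp_all add: M_def somelcm_def)
  have "M divides\<^bsub>?R\<^esub> ?L" "?L divides\<^bsub>?R\<^esub> M"
    using M L \<open>?L lcmof\<^bsub>?R\<^esub> g (pair_prod E')\<close> by (auto simp: islcm_def)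
  then obtain v v' where v: "v \<in> polys n" "v' \<in> polys n" "M = ?L * v" "?L = M * v'"
    unfolding factor_def poly_ring_ops by blast
  have "?L * 1 = ?L * (v * v')" using v(3,4) by (metis mult.assoc mult_1_right)
  moreover have "?L \<noteq> 0" using E by (intro pair_prod_nonzero) auto
  ultimately have "v * v' = 1" by (metis mult_cancel_left)
  then show ?thesis using v(1,2,3) unfolding M_def by (metis mult.commute)
qed

lemma lead_pair_prod:
  assumes "E \<subseteq> pairs_upto n"
  shows "lead_monom (pair_prod E :: 'k::field mpoly) = (\<Sum>(i, j)\<in>E. Poly_Mapping.single j 1)"
proof -
  have "lead_monom (pair_prod E :: 'k mpoly) = (\<Sum>e\<in>E. lead_monom (X (fst e) - X (snd e) :: 'k mpoly))"
    unfolding pair_prod_def case_prod_unfold using assms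
    by (intro lead_monom_prod X_diff_nonzero) (auto simp: pairs_upto_def)
  also have "\<dots> = (\<Sum>e\<in>E. Poly_Mapping.single (snd e) 1)"
    using assms by (intro sum.cong refl lead_monom_eqI is_lead_X_diff) (auto simp: pairs_upto_def)
  also have "\<dots> = (\<Sum>(i, j)\<in>E. Poly_Mapping.single j 1)"
    by (simp only: case_prod_unfold)
  finally show ?thesis .
qed

lemma lookup_lead_pair_prod:
  assumes "E \<subseteq> pairs_upto n"
  shows "Poly_Mapping.lookup (lead_monom (pair_prod E :: 'k::field mpoly)) v = card {u. (u, v) \<in> E}"
proof -
  have fin: "finite E" using assms finite_pairs_upto by (rule finite_subset)
  have "Poly_Mapping.lookup (lead_monom (pair_prod E :: 'k mpoly)) v =
    (\<Sum>e\<in>E. if snd e = v then 1 else 0)"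
    unfolding lead_pair_prod[OF assms] lookup_sum
    by (intro sum.cong refl) (auto simp: lookup_single when_def)
  also have "\<dots> = card {e \<in> E. snd e = v}" using fin by (simp add: sum.If_cases Int_def)
  also have "\<dots> = card {u. (u, v) \<in> E}"
    by (rule bij_betw_same_card[of fst]) (auto simp: bij_betw_def inj_on_def image_iff)
  finally show ?thesis .
qed

text \<open>
  Least common multiples are determined only up to a unit of the ring; leading monomials do not
  see the unit, since leading monomials add up and exponents are nonnegative.
\<close>

lemma lead_monom_unit:
  fixes v v' :: "'k::field mpoly"
  assumes "v * v' = 1"
  shows "lead_monom v = 0"
proof -
  have "v \<noteq> 0" "v' \<noteq> 0" using assms by auto
  then have "lead_monom v + lead_monom v' = lead_monom (1 :: 'k mpoly)"
    using lead_monom_mult assms by metis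
  also have "\<dots> = 0" using lead_monom_eqI[OF is_lead_single[of "1::'k" 0]] by simp
  finally have "Poly_Mapping.lookup (lead_monom v) i + Poly_Mapping.lookup (lead_monom v') i = 0" for i
    by (metis lookup_add lookup_zero)
  then show ?thesis by (intro poly_mapping_eqI) simp
qed

section \<open>Zero-one matrices with given row and column sums\<close>

lemma exists_top_subset:
  fixes h :: "'j \<Rightarrow> nat"
  assumes "finite J" "x \<le> card J"
  shows "\<exists>A\<subseteq>J. card A = x \<and> (\<forall>a\<in>A. \<forall>b\<in>J - A. h b \<le> h a)"
  using assms(2)
proof (induction x)
  case 0
  show ?case by (intro exI[of _ "{}"]) auto
next
  case (Suc x)
  then obtain A where A: "A \<subseteq> J" "card A = x" "\<forall>a\<in>A. \<forall>b\<in>J - A. h b \<le> h a" by auto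
  have fin: "finite (J - A)" and "J - A \<noteq> {}"
    using assms(1) A Suc.prems card_mono[of A J] finite_subset[OF A(1)] by auto
  then obtain c where c: "c \<in> J - A" "\<forall>b\<in>J - A. h b \<le> h c"
  proof -
    have "Max (h ` (J - A)) \<in> h ` (J - A)" using fin \<open>J - A \<noteq> {}\<close> by (intro Max_in) auto
    then obtain c where "c \<in> J - A" "h c = Max (h ` (J - A))" by auto
    moreover have "h b \<le> Max (h ` (J - A))" if "b \<in> J - A" for b
      using fin that by (intro Max_ge) auto
    ultimately show thesis using that by metis
  qed
  have "finite A" using A(1) assms(1) finite_subset by blast
  then show ?case using A c by (intro exI[of _ "insert c A"]) auto
qed

text \<open>
  The sufficiency half of the Gale--Ryser theorem: row \<open>k\<close> of the matrix is the set \<open>A k\<close> of the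
  columns in which it has a one. Greedily, the largest row is placed into the highest columns; the
  reduced column heights again satisfy the hypotheses for the remaining rows.
\<close>

lemma gale_ryser:
  fixes h :: "'j \<Rightarrow> nat"
  assumes fin: "finite J" and "sorted_wrt (\<ge>) nus"
    and "\<And>i. sum_list (take i nus) \<le> (\<Sum>j\<in>J. min i (h j))"
    and "(\<Sum>j\<in>J. h j) = sum_list nus"
  shows "\<exists>A. (\<forall>k<length nus. A k \<subseteq> J \<and> card (A k) = nus ! k) \<and>
    (\<forall>j\<in>J. card {k. k < length nus \<and> j \<in> A k} = h j)"
  using assms(2-4)
proof (induction nus arbitrary: h)
  case Nil
  then show ?case using fin by simp
next
  case (Cons x nus)
  have cnt1: "(\<Sum>j\<in>J. min 1 (h j)) = card {j\<in>J. h j \<ge> 1}"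
  proof -
    have "(\<Sum>j\<in>J. min 1 (h j)) = (\<Sum>j\<in>J. if h j \<ge> 1 then 1 else 0)" by (intro sum.cong) auto
    also have "\<dots> = card {j\<in>J. h j \<ge> 1}" using fin by (simp add: sum.If_cases Int_def)
    finally show ?thesis .
  qed
  then have x: "x \<le> card {j\<in>J. h j \<ge> 1}" using Cons.prems(2)[of 1] by simp
  also have "\<dots> \<le> card J" using fin by (intro card_mono) auto
  finally obtain A where A: "A \<subseteq> J" "card A = x" "\<forall>a\<in>A. \<forall>b\<in>J - A. h b \<le> h a"
    using exists_top_subset[OF fin] by metis
  have finA: "finite A" using A(1) fin finite_subset by blast
  have pos: "h a \<ge> 1" if "a \<in> A" for a
  proof (rule ccontr)
    assume "\<not> h a \<ge> 1"
    have "{j\<in>J. h j \<ge> 1} \<subseteq> A - {a}"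
    proof
      fix j assume j: "j \<in> {j\<in>J. h j \<ge> 1}"
      moreover have "j \<in> A"
      proof (rule ccontr)
        assume "j \<notin> A"
        then have "h j \<le> h a" using A(3) j that by blast
        then show False using j \<open>\<not> h a \<ge> 1\<close> by simp
      qed
      ultimately show "j \<in> A - {a}" using \<open>\<not> h a \<ge> 1\<close> by auto
    qed
    then have "card {j\<in>J. h j \<ge> 1} \<le> card (A - {a})" using finA by (intro card_mono) auto
    also have "\<dots> < card A" using that finA by (intro psubset_card_mono) auto
    finally show False using x A(2) by simp
  qed
  define h' where "h' = (\<lambda>j. if j \<in> A then h j - 1 else h j)"
  have split: "sum f J = sum f A + sum f (J - A)" for f :: "'j \<Rightarrow> nat"
    using fin A(1) by (metis add.commute sum.subset_diff)
  \<comment> \<open>If no remaining column is longer than \<open>i\<close>, the inequality is the given one for \<open>i + 1\<close>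
    minus \<open>x\<close>; otherwise every chosen column keeps at least \<open>i\<close> squares, and each of the first
    \<open>i\<close> parts of \<open>nus\<close> is at most \<open>x\<close>.\<close>
  have "sum_list (take i nus) \<le> (\<Sum>j\<in>J. min i (h' j))" for i
  proof (cases "\<forall>j\<in>J - A. h j \<le> i")
    case True
    have "(\<Sum>j\<in>A. min (Suc i) (h j)) = (\<Sum>j\<in>A. min i (h' j) + 1)"
    proof (intro sum.cong refl)
      fix j assume "j \<in> A"
      then show "min (Suc i) (h j) = min i (h' j) + 1" using pos[of j] by (auto simp: h'_def)
    qed
    also have "\<dots> = (\<Sum>j\<in>A. min i (h' j)) + x" unfolding sum.distrib using A(2) by simp
    finally have "(\<Sum>j\<in>A. min (Suc i) (h j)) = (\<Sum>j\<in>A. min i (h' j)) + x" .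
    moreover have "(\<Sum>j\<in>J - A. min (Suc i) (h j)) = (\<Sum>j\<in>J - A. min i (h' j))"
      using True by (intro sum.cong) (auto simp: h'_def min_absorb2 le_SucI)
    ultimately have "(\<Sum>j\<in>J. min (Suc i) (h j)) = (\<Sum>j\<in>J. min i (h' j)) + x"
      by (simp add: split)
    then show ?thesis using Cons.prems(2)[of "Suc i"] by simp
  next
    case False
    then obtain b where b: "b \<in> J - A" "h b > i" by auto
    have "i \<le> h' a" if "a \<in> A" for a
    proof -
      have "h b \<le> h a" using A(3) b that by blast
      then show ?thesis using b that by (simp add: h'_def)
    qed
    then have "(\<Sum>j\<in>A. min i (h' j)) = (\<Sum>j\<in>A. i)" by (intro sum.cong) auto
    then have *: "(\<Sum>j\<in>J. min i (h' j)) \<ge> x * i" using A(2) by (simp add: split)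
    have "sum_list (take i nus) \<le> x * length (take i nus)"
    proof -
      have "sum_list ys \<le> x * length ys" if "\<forall>y\<in>set ys. y \<le> x" for ys
        using that by (induction ys) auto
      moreover have "\<forall>y\<in>set (take i nus). y \<le> x"
        using Cons.prems(1) by (auto dest: in_set_takeD)
      ultimately show ?thesis by blast
    qed
    also have "\<dots> \<le> x * i" by simp
    finally show ?thesis using * by simp
  qed
  moreover have "(\<Sum>j\<in>J. h' j) = sum_list nus"
  proof -
    have "(\<Sum>j\<in>A. h j) = (\<Sum>j\<in>A. h' j + 1)"
    proof (intro sum.cong refl)
      fix j assume "j \<in> A"
      then show "h j = h' j + 1" using pos[of j] by (auto simp: h'_def)
    qed
    also have "\<dots> = (\<Sum>j\<in>A. h' j) + x" unfolding sum.distrib using A(2) by simp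
    finally have "(\<Sum>j\<in>A. h j) = (\<Sum>j\<in>A. h' j) + x" .
    moreover have "(\<Sum>j\<in>J - A. h j) = (\<Sum>j\<in>J - A. h' j)" by (intro sum.cong) (auto simp: h'_def)
    ultimately show ?thesis using Cons.prems(3) by (simp add: split)
  qed
  ultimately obtain B where B: "\<forall>k<length nus. B k \<subseteq> J \<and> card (B k) = nus ! k"
      "\<forall>j\<in>J. card {k. k < length nus \<and> j \<in> B k} = h' j"
    using Cons.IH[of h'] Cons.prems(1) by auto
  define B' where "B' = (\<lambda>k. case k of 0 \<Rightarrow> A | Suc k \<Rightarrow> B k)"
  show ?case
  proof (intro exI[of _ B'] conjI allI impI ballI)
    fix k assume "k < length (x # nus)"
    then show "B' k \<subseteq> J" "card (B' k) = (x # nus) ! k"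
      using A B(1) by (auto simp: B'_def split: nat.splits)
  next
    fix j assume j: "j \<in> J"
    have eq: "{k. k < length (x # nus) \<and> j \<in> B' k} =
        (if j \<in> A then {0} else {}) \<union> Suc ` {k. k < length nus \<and> j \<in> B k}"
    proof (rule Set.set_eqI)
      fix k
      show "k \<in> {k. k < length (x # nus) \<and> j \<in> B' k} \<longleftrightarrow>
          k \<in> (if j \<in> A then {0} else {}) \<union> Suc ` {k. k < length nus \<and> j \<in> B k}"
        by (cases k) (auto simp: B'_def)
    qed
    have "card {k. k < length (x # nus) \<and> j \<in> B' k} =
        (if j \<in> A then 1 else 0) + card {k. k < length nus \<and> j \<in> B k}"
      unfolding eq by (subst card_Un_disjoint) (auto simp: card_image)
    then show "card {k. k < length (x # nus) \<and> j \<in> B' k} = h j"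
      using B(2) j pos[of j] by (auto simp: h'_def)
  qed
qed

section \<open>Points, their colours and orbit types\<close>

text \<open>
  The multiset of entries, made into a set: the copies of \<open>1\<close> are \<open>(1, 0), \<dots>, (1, l - 1)\<close>, and
  \<open>v \<ge> 2\<close> is \<open>(v, 0)\<close>. Fillings by the multiset become bijections of the diagram with this set.
\<close>

definition slots :: "nat \<Rightarrow> nat \<Rightarrow> (nat \<times> nat) set" where
  "slots n l = {1} \<times> {..<l} \<union> {2..n} \<times> {0}"

lemma finite_slots [simp]: "finite (slots n l)"
  by (simp add: slots_def)

lemma card_slots: "n \<ge> 1 \<Longrightarrow> card (slots n l) = n + l - 1"
  unfolding slots_def by (subst card_Un_disjoint) auto

lemma slots_mset: "image_mset fst (mset_set (slots n l)) = replicate_mset l 1 + mset_set {2..n}"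
proof -
  have "mset_set (slots n l) = mset_set ({1} \<times> {..<l}) + mset_set ({2..n} \<times> {0})"
    unfolding slots_def by (rule mset_set_Union) auto
  moreover have "image_mset fst (mset_set ({1::nat} \<times> {..<l})) = replicate_mset l 1"
  proof -
    have "image_mset fst (mset_set ({1::nat} \<times> {..<l})) = image_mset (\<lambda>_. 1) (mset_set ({1::nat} \<times> {..<l}))"
      by (rule image_mset_cong) auto
    then show ?thesis by (simp add: image_mset_const_eq)
  qed
  moreover have "image_mset fst (mset_set ({2..n} \<times> {0::nat})) = mset_set {2..n}"
  proof -
    have "image_mset fst (mset_set ({2..n} \<times> {0::nat})) = mset_set (fst ` ({2..n} \<times> {0::nat}))"
      by (rule image_mset_mset_set) (auto simp: inj_on_def)
    moreover have "fst ` ({2..n} \<times> {0::nat}) = {2..n}" by force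
    ultimately show ?thesis by simp
  qed
  ultimately show ?thesis by simp
qed

text \<open>
  How many members of the sequence \<open>a_1, \<dots>, a_1, a_2, \<dots>, a_n\<close>, in which \<open>a_1\<close> occurs \<open>l\<close> times,
  lie in \<open>V\<close>. Partial sums of orbit types are weights of sets of values, and dominance is compared
  in this form.
\<close>

definition weight :: "nat \<Rightarrow> nat \<Rightarrow> (nat \<Rightarrow> 'c) \<Rightarrow> 'c set \<Rightarrow> nat" where
  "weight n l a V = card {s \<in> slots n l. a (fst s) \<in> V}"

lemma weight_sum: "finite V \<Longrightarrow> weight n l a V = (\<Sum>c\<in>V. weight n l a {c})"
proof (induction V rule: finite_induct)
  case empty
  show ?case by (simp add: weight_def)
next
  case (insert c V)
  have "{s \<in> slots n l. a (fst s) \<in> insert c V} =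
    {s \<in> slots n l. a (fst s) \<in> {c}} \<union> {s \<in> slots n l. a (fst s) \<in> V}" by auto
  then have "weight n l a (insert c V) = weight n l a {c} + weight n l a V"
    unfolding weight_def using insert.hyps by (simp only:) (subst card_Un_disjoint, auto)
  then show ?case using insert by simp
qed

lemma weight_Suc:
  assumes "n \<ge> 1"
  shows "weight (Suc n) l (a(Suc n := x)) V = weight n l a V + (if x \<in> V then 1 else 0)"
proof -
  have s: "slots (Suc n) l = insert (Suc n, 0) (slots n l)" "(Suc n, 0) \<notin> slots n l"
    "\<And>s. s \<in> slots n l \<Longrightarrow> fst s \<noteq> Suc n"
    using assms by (auto simp: slots_def)
  have "{s \<in> slots (Suc n) l. (a(Suc n := x)) (fst s) \<in> V} =
     {s \<in> slots n l. a (fst s) \<in> V} \<union> (if x \<in> V then {(Suc n, 0)} else {})"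
    unfolding s(1) using s(3) by auto
  then show ?thesis unfolding weight_def using s(2) by simp
qed

definition colours :: "nat \<Rightarrow> nat \<Rightarrow> (nat \<Rightarrow> 'c) \<Rightarrow> 'c set" where
  "colours n l a = (a \<circ> fst) ` slots n l"

lemma finite_colours [simp]: "finite (colours n l a)"
  by (simp add: colours_def)

lemma weight_pos_iff: "weight n l a {c} > 0 \<longleftrightarrow> c \<in> colours n l a"
  unfolding weight_def colours_def card_gt_0_iff by force

lemma weight_colours: "weight n l a (colours n l a) = card (slots n l)"
  unfolding weight_def colours_def by (rule arg_cong[of _ _ card]) auto

lemma orbit_type_colours:
  obtains cs where "distinct cs" "set cs = colours n l a"
    "orbit_type n l a = map (\<lambda>c. weight n l a {c}) cs"
proof -
  define M where "M = replicate_mset l (a 1) + image_mset a (mset_set {2..n})"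
  have "M = image_mset a (image_mset fst (mset_set (slots n l)))"
    by (simp add: M_def slots_mset)
  then have M: "M = image_mset (a \<circ> fst) (mset_set (slots n l))"
    by (simp add: multiset.map_comp)
  have sM: "set_mset M = colours n l a" by (simp add: M colours_def)
  have cM: "count M c = weight n l a {c}" for c
  proof -
    have "count M c = card {s \<in> slots n l. c = (a \<circ> fst) s}"
      unfolding M by (simp add: count_image_mset' card_eq_sum[symmetric])
    also have "{s \<in> slots n l. c = (a \<circ> fst) s} = {s \<in> slots n l. a (fst s) \<in> {c}}" by auto
    finally show ?thesis by (simp add: weight_def)
  qed
  obtain xs where xs: "set xs = set_mset M" "distinct xs"
    using finite_distinct_list[of "set_mset M"] by auto
  let ?cs = "rev (sort_key (count M) xs)"
  have "mset_set (set_mset M) = mset xs" using xs by (metis mset_set_set)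
  then have "orbit_type n l a = rev (sorted_list_of_multiset (mset (map (count M) xs)))"
    unfolding orbit_type_def M_def[symmetric] Let_def by simp
  also have "\<dots> = rev (sort (map (count M) xs))" by (simp only: sorted_list_of_multiset_mset)
  also have "sort (map (count M) xs) = map (count M) (sort_key (count M) xs)"
    by (rule properties_for_sort) auto
  finally have "orbit_type n l a = map (count M) ?cs" by (simp add: rev_map)
  then show ?thesis
    using that[of ?cs] xs sM cM by simp
qed

lemma orbit_type_sorted: "sorted_wrt (\<ge>) (orbit_type n l a)"
  unfolding orbit_type_def Let_def by (simp add: sorted_wrt_rev sorted_sorted_list_of_multiset)

lemma sum_list_take_map_distinct:
  "distinct cs \<Longrightarrow> sum_list (take i (map f cs)) = (\<Sum>c\<in>set (take i cs). f c)"
  by (simp add: take_map sum_list_distinct_conv_sum_set)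

lemma sum_list_orbit_type: "n \<ge> 1 \<Longrightarrow> sum_list (orbit_type n l a) = n + l - 1"
proof -
  assume n: "n \<ge> 1"
  obtain cs where cs: "distinct cs" "set cs = colours n l a"
    "orbit_type n l a = map (\<lambda>c. weight n l a {c}) cs" by (rule orbit_type_colours)
  have "sum_list (orbit_type n l a) = weight n l a (colours n l a)"
    using cs by (simp add: sum_list_distinct_conv_sum_set weight_sum[of "colours n l a"])
  then show ?thesis using n by (simp add: weight_colours card_slots)
qed

text \<open>
  The first \<open>i\<close> parts belong to the \<open>i\<close> most frequent values, and replacing members of \<open>V\<close> by
  these does not decrease the weight: \<open>t\<close>, the multiplicity of the next value, lies between the
  multiplicities that are given up and those that are gained.
\<close>

lemma weight_le_sum_take_orbit_type:
  fixes a :: "nat \<Rightarrow> 'c"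
  assumes "finite V" "card V \<le> i"
  shows "weight n l a V \<le> sum_list (take i (orbit_type n l a))"
proof -
  obtain cs where cs: "distinct cs" "set cs = colours n l a"
    "orbit_type n l a = map (\<lambda>c. weight n l a {c}) cs" by (rule orbit_type_colours)
  let ?w = "\<lambda>c. weight n l a {c}"
  let ?U = "set (take i cs)"
  have U: "sum_list (take i (orbit_type n l a)) = sum ?w ?U"
    unfolding cs(3) by (rule sum_list_take_map_distinct[OF cs(1)])
  have V: "weight n l a V = sum ?w V" by (rule weight_sum[OF assms(1)])
  have "sum ?w (V - ?U) \<le> sum ?w (?U - V)"
  proof (cases "i < length cs")
    case False
    then have "?w c = 0" if "c \<in> V - ?U" for c
      using that cs(2) weight_pos_iff[of n l a c] by auto
    then show ?thesis by simp
  next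
    case True
    have cU: "card ?U = i" using True cs(1) by (simp add: distinct_card)
    define t where "t = ?w (cs ! i)"
    have srt: "?w (cs ! k') \<le> ?w (cs ! k)" if "k \<le> k'" "k' < length cs" for k k'
    proof (cases "k = k'")
      case False
      then show ?thesis using that orbit_type_sorted[of n l a] unfolding cs(3)
        by (simp add: sorted_wrt_iff_nth_less)
    qed simp
    have lo: "?w c \<le> t" if "c \<in> V - ?U" for c
    proof (cases "c \<in> set cs")
      case True
      then obtain k where k: "k < length cs" "cs ! k = c" by (auto simp: in_set_conv_nth)
      have "k \<ge> i"
      proof (rule ccontr)
        assume "\<not> k \<ge> i"
        then have "c \<in> ?U" using k by (auto simp: in_set_conv_nth)
        then show False using that by simp
      qed
      then show ?thesis using srt[of i k] k by (simp add: t_def)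
    next
      case False
      then show ?thesis using cs(2) weight_pos_iff[of n l a c] by auto
    qed
    have hi: "t \<le> ?w c" if c: "c \<in> ?U - V" for c
    proof -
      obtain k where k: "k < i" "cs ! k = c" using c by (auto simp: in_set_conv_nth)
      then show ?thesis using srt[of k i] True by (auto simp: t_def)
    qed
    have "sum ?w (V - ?U) \<le> card (V - ?U) * t"
      using sum_bounded_above[of "V - ?U" ?w t] lo by simp
    also have "card (V - ?U) \<le> card (?U - V)"
    proof -
      have "card V = card (V \<inter> ?U) + card (V - ?U)" using assms(1) by (metis card_Int_Diff)
      moreover have "card ?U = card (?U \<inter> V) + card (?U - V)" by (metis card_Int_Diff List.finite_set)
      moreover have "?U \<inter> V = V \<inter> ?U" by auto
      ultimately show ?thesis using assms(2) cU by simp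
    qed
    then have "card (V - ?U) * t \<le> card (?U - V) * t" by simp
    also have "\<dots> \<le> sum ?w (?U - V)"
      using sum_bounded_below[of "?U - V" t ?w] hi by simp
    finally show ?thesis .
  qed
  moreover have "sum ?w V = sum ?w (V \<inter> ?U) + sum ?w (V - ?U)"
    using assms(1) by (metis sum.Int_Diff)
  moreover have "sum ?w ?U = sum ?w (?U \<inter> V) + sum ?w (?U - V)"
    by (metis sum.Int_Diff List.finite_set)
  ultimately show ?thesis using U V by (simp add: Int_commute)
qed

lemma orbit_type_in_parts_ge:
  assumes "n \<ge> 1" "l \<ge> 1"
  shows "orbit_type n l a \<in> parts_ge n l"
proof -
  obtain cs where cs: "distinct cs" "set cs = colours n l a"
    "orbit_type n l a = map (\<lambda>c. weight n l a {c}) cs" by (rule orbit_type_colours)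
  have pos: "\<forall>k\<in>set (orbit_type n l a). k > 0"
    unfolding cs(3) using cs(2) by (simp add: weight_pos_iff)
  have "(1, 0) \<in> slots n l" using assms by (auto simp: slots_def)
  then have "colours n l a \<noteq> {}" by (auto simp: colours_def)
  then have ne: "orbit_type n l a \<noteq> []" using cs by auto
  have "l = card ({1::nat} \<times> {..<l})" by simp
  also have "\<dots> \<le> weight n l a {a 1}"
    unfolding weight_def by (intro card_mono) (auto simp: slots_def)
  also have "\<dots> \<le> sum_list (take 1 (orbit_type n l a))"
    by (rule weight_le_sum_take_orbit_type) auto
  also have "\<dots> = hd (orbit_type n l a)" using ne by (cases "orbit_type n l a") auto
  finally show ?thesis
    unfolding parts_ge_def partitions_def
    using pos orbit_type_sorted sum_list_orbit_type[OF assms(1)] by auto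
qed

section \<open>Young diagrams and tableaux\<close>

lemma downward_closed_eq_lessThan:
  fixes S :: "nat set"
  assumes "finite S" "\<And>x y. y \<in> S \<Longrightarrow> x \<le> y \<Longrightarrow> x \<in> S"
  shows "S = {..<card S}"
proof -
  obtain m where m: "m \<notin> S" using assms(1) ex_new_if_finite infinite_UNIV_nat by blast
  define k where "k = (LEAST m. m \<notin> S)"
  have "k \<notin> S" unfolding k_def by (rule LeastI[of _ m]) (rule m)
  moreover have "x \<in> S" if "x < k" for x
    using not_less_Least[of x "\<lambda>m. m \<notin> S"] that by (simp add: k_def)
  ultimately have "S = {..<k}" using assms(2) by (metis lessThan_iff linorder_not_less subsetI subset_antisym)
  then show ?thesis by simp
qed

definition column_height :: "nat list \<Rightarrow> nat \<Rightarrow> nat" where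
  "column_height p j = card {r. r < length p \<and> j < p ! r}"

lemma diagram_iff_column_height:
  assumes "sorted_wrt (\<ge>) p"
  shows "(i, j) \<in> diagram p \<longleftrightarrow> i < column_height p j"
proof -
  let ?S = "{r. r < length p \<and> j < p ! r}"
  have "?S = {..<card ?S}"
  proof (rule downward_closed_eq_lessThan)
    fix x y assume y: "y \<in> ?S" "x \<le> y"
    then have "p ! y \<le> p ! x"
      using assms by (cases "x = y") (auto simp: sorted_wrt_iff_nth_less)
    then show "x \<in> ?S" using y by auto
  qed auto
  then have "i \<in> ?S \<longleftrightarrow> i < card ?S" by blast
  then show ?thesis by (simp add: diagram_def column_height_def)
qed

lemma diagram_Sigma: "diagram p = Sigma {..<length p} (\<lambda>i. {..<p ! i})"
  by (auto simp: diagram_def)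

lemma finite_diagram [simp]: "finite (diagram p)"
  by (simp add: diagram_Sigma)

lemma card_diagram_rows: "card {c \<in> diagram p. fst c < i} = sum_list (take i p)"
proof -
  have "{c \<in> diagram p. fst c < i} = Sigma {..<min i (length p)} (\<lambda>i. {..<p ! i})"
    by (auto simp: diagram_def)
  then have "card {c \<in> diagram p. fst c < i} = (\<Sum>r<min i (length p). p ! r)" by simp
  also have "\<dots> = sum_list (take i p)"
    by (simp add: sum_list_sum_nth atLeast0LessThan min.commute)
  finally show ?thesis .
qed

lemma card_by_columns:
  assumes "finite S" "\<And>i j. (i, j) \<in> S \<Longrightarrow> j < (N::nat)"
  shows "card S = (\<Sum>j<N. card {i. (i, j) \<in> S})"
proof -
  have fin: "finite {i. (i, j) \<in> S}" for j
    by (rule finite_subset[of _ "fst ` S"]) (use assms(1) in force)+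
  have "S = prod.swap ` Sigma {..<N} (\<lambda>j. {i. (i, j) \<in> S})" using assms(2) by force
  then have "card S = card (prod.swap ` Sigma {..<N} (\<lambda>j. {i. (i, j) \<in> S}))" by simp
  also have "\<dots> = card (Sigma {..<N} (\<lambda>j. {i. (i, j) \<in> S}))" by (rule card_image) (simp add: inj_on_def)
  also have "\<dots> = (\<Sum>j<N. card {i. (i, j) \<in> S})" using fin by simp
  finally show ?thesis .
qed

lemma diagram_column_less:
  assumes "sorted_wrt (\<ge>) p" "(i, j) \<in> diagram p" shows "j < hd p"
proof -
  have "i < length p" "j < p ! i" using assms(2) by (auto simp: diagram_def)
  moreover have "p ! i \<le> p ! 0"
    using assms(1) \<open>i < length p\<close> by (cases "i = 0") (auto simp: sorted_wrt_iff_nth_less)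
  ultimately show ?thesis by (cases p) auto
qed

lemma sum_take_eq_column_sum:
  assumes "sorted_wrt (\<ge>) p"
  shows "sum_list (take i p) = (\<Sum>j<hd p. min i (column_height p j))"
proof -
  have "sum_list (take i p) = (\<Sum>j<hd p. card {r. (r, j) \<in> {c \<in> diagram p. fst c < i}})"
    unfolding card_diagram_rows[symmetric]
    by (rule card_by_columns) (use diagram_column_less[OF assms] in auto)
  also have "\<dots> = (\<Sum>j<hd p. min i (column_height p j))"
  proof (intro sum.cong refl)
    fix j
    have "{r. (r, j) \<in> {c \<in> diagram p. fst c < i}} = {..<min i (column_height p j)}"
      using diagram_iff_column_height[OF assms] by auto
    then show "card {r. (r, j) \<in> {c \<in> diagram p. fst c < i}} = min i (column_height p j)" by simp
  qed
  finally show ?thesis .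
qed

lemma Tab_iff:
  "T \<in> Tab n l p \<longleftrightarrow> T \<in> extensional (diagram p) \<and>
     image_mset T (mset_set (diagram p)) = replicate_mset l 1 + mset_set {2..n} \<and>
     (\<forall>i i' j. (i, j) \<in> diagram p \<and> (i', j) \<in> diagram p \<and> T (i, j) = 1 \<and> T (i', j) = 1 \<longrightarrow> i = i')"
  unfolding Tab_def by (rule mem_Collect_eq)

text \<open>
  Equality of the multiset of entries with the prescribed multiset means that the squares can be
  matched with the slots.
\<close>

lemma Tab_bij:
  assumes "T \<in> Tab n l p"
  obtains b where "bij_betw b (diagram p) (slots n l)" "\<forall>c\<in>diagram p. T c = fst (b c)"
proof -
  let ?D = "diagram p" and ?S = "slots n l"
  have eq: "image_mset T (mset_set ?D) = image_mset fst (mset_set ?S)"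
    using assms by (simp add: Tab_def slots_mset)
  then have "card ?D = card ?S" by (metis size_image_mset size_mset_set)
  then obtain b0 where b0: "bij_betw b0 ?D ?S"
    using finite_same_card_bij[of ?D ?S] by auto
  then have "image_mset b0 (mset_set ?D) = mset_set ?S"
    by (metis bij_betw_def image_mset_mset_set)
  then have "image_mset T (mset_set ?D) = image_mset (fst \<circ> b0) (mset_set ?D)"
    unfolding eq by (metis multiset.map_comp)
  then obtain q where q: "q permutes ?D" "\<forall>x\<in>?D. T x = (fst \<circ> b0) (q x)"
    using image_mset_eq_implies_permutes[OF finite_diagram] by blast
  have "bij_betw (b0 \<circ> q) ?D ?S"
    using bij_betw_trans[OF permutes_imp_bij[OF q(1)] b0] .
  then show ?thesis using that q(2) by auto
qed

lemma Tab_bijI: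
  assumes b: "bij_betw b (diagram p) (slots n l)"
    and ones: "\<And>i i' j. (i, j) \<in> diagram p \<Longrightarrow> (i', j) \<in> diagram p \<Longrightarrow>
      fst (b (i, j)) = 1 \<Longrightarrow> fst (b (i', j)) = 1 \<Longrightarrow> i = i'"
  shows "restrict (fst \<circ> b) (diagram p) \<in> Tab n l p"
proof -
  let ?D = "diagram p"
  have "image_mset (restrict (fst \<circ> b) ?D) (mset_set ?D) = image_mset (fst \<circ> b) (mset_set ?D)"
    by (rule image_mset_cong) auto
  also have "\<dots> = image_mset fst (image_mset b (mset_set ?D))" by (simp add: multiset.map_comp)
  also have "image_mset b (mset_set ?D) = mset_set (slots n l)"
    using b by (metis bij_betw_def image_mset_mset_set)
  also note slots_mset
  finally have "image_mset (restrict (fst \<circ> b) ?D) (mset_set ?D) = replicate_mset l 1 + mset_set {2..n}" .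
  moreover have "\<forall>i i' j. (i, j) \<in> ?D \<and> (i', j) \<in> ?D \<and> restrict (fst \<circ> b) ?D (i, j) = 1 \<and>
      restrict (fst \<circ> b) ?D (i', j) = 1 \<longrightarrow> i = i'"
    using ones by (simp; blast)
  ultimately show ?thesis unfolding Tab_iff by blast
qed

lemma Tab_column_inj:
  assumes T: "T \<in> Tab n l p" and c: "(i, j) \<in> diagram p" "(i', j) \<in> diagram p"
    and eq: "T (i, j) = T (i', j)"
  shows "i = i'"
proof (cases "T (i, j) = 1")
  case True
  have "\<forall>i i' j. (i, j) \<in> diagram p \<and> (i', j) \<in> diagram p \<and> T (i, j) = 1 \<and> T (i', j) = 1 \<longrightarrow> i = i'"
    using T unfolding Tab_iff by blast
  then show ?thesis using True c eq by metis
next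
  case False
  obtain b where b: "bij_betw b (diagram p) (slots n l)" "\<forall>c\<in>diagram p. T c = fst (b c)"
    using Tab_bij[OF T] .
  have "b (i, j) \<in> slots n l" "b (i', j) \<in> slots n l"
    using b(1) c by (auto simp: bij_betw_def)
  moreover have "fst (b (i, j)) = fst (b (i', j))" "fst (b (i, j)) \<noteq> 1"
    using False eq b(2) c by auto
  ultimately have "b (i, j) = b (i', j)" by (auto simp: slots_def)
  then show ?thesis using b(1) c by (auto simp: bij_betw_def dest: inj_onD)
qed

text \<open>
  The differences \<open>x_u - x_v\<close> that divide the Specht polynomial, each of them exactly once: only
  \<open>1\<close> occurs in more than one column.
\<close>

definition tab_pairs :: "nat list \<Rightarrow> (nat \<times> nat \<Rightarrow> nat) \<Rightarrow> (nat \<times> nat) set" where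
  "tab_pairs p T = {(u, v). u < v \<and>
     (\<exists>i i' j. (i, j) \<in> diagram p \<and> (i', j) \<in> diagram p \<and> T (i, j) = u \<and> T (i', j) = v)}"

text \<open>
  If the Specht polynomial of \<open>T\<close> does not vanish at \<open>a\<close>, the squares of one column have different
  colours. So \<open>i\<close> colours occupy at most \<open>i\<close> squares of each column, hence no more squares than the
  first \<open>i\<close> rows contain.
\<close>

lemma orbit_type_dominated:
  assumes p: "sorted_wrt (\<ge>) p" and T: "T \<in> Tab n l p"
    and inj: "\<And>u v. (u, v) \<in> tab_pairs p T \<Longrightarrow> a u \<noteq> a v"
  shows "sum_list (take i (orbit_type n l a)) \<le> sum_list (take i p)"
proof -
  obtain cs where cs: "distinct cs" "set cs = colours n l a"
    "orbit_type n l a = map (\<lambda>c. weight n l a {c}) cs" by (rule orbit_type_colours)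
  obtain b where b: "bij_betw b (diagram p) (slots n l)" "\<forall>c\<in>diagram p. T c = fst (b c)"
    using Tab_bij[OF T] .
  define V where "V = set (take i cs)"
  have V: "finite V" "card V \<le> i"
    unfolding V_def by (auto intro: order.trans[OF card_length])
  let ?S = "{c \<in> diagram p. a (T c) \<in> V}"
  have colinj: "inj_on (\<lambda>r. a (T (r, j))) {r. (r, j) \<in> diagram p}" for j
  proof (rule inj_onI, rule ccontr)
    fix r r' assume r: "r \<in> {r. (r, j) \<in> diagram p}" "r' \<in> {r. (r, j) \<in> diagram p}"
      "a (T (r, j)) = a (T (r', j))" "r \<noteq> r'"
    then have "T (r, j) \<noteq> T (r', j)" using Tab_column_inj[OF T] by blast
    then have "(T (r, j), T (r', j)) \<in> tab_pairs p T \<or> (T (r', j), T (r, j)) \<in> tab_pairs p T"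
      using r unfolding tab_pairs_def by (auto simp: neq_iff)
    then show False using inj r(3) by metis
  qed
  have "sum_list (take i (orbit_type n l a)) = weight n l a V"
    unfolding cs(3) sum_list_take_map_distinct[OF cs(1)] V_def by (rule weight_sum[symmetric]) simp
  also have "\<dots> = card ?S"
  proof -
    have "bij_betw b ?S {s \<in> slots n l. a (fst s) \<in> V}"
      unfolding bij_betw_def
    proof
      show "inj_on b ?S" using b(1) by (auto simp: bij_betw_def intro: inj_on_subset)
      have "?S = {c \<in> diagram p. a (fst (b c)) \<in> V}" using b(2) by auto
      moreover have "slots n l = b ` diagram p" using b(1) by (simp add: bij_betw_def)
      ultimately show "b ` ?S = {s \<in> slots n l. a (fst s) \<in> V}" by auto
    qed
    then show ?thesis unfolding weight_def by (rule bij_betw_same_card[symmetric])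
  qed
  also have "\<dots> = (\<Sum>j<hd p. card {r. (r, j) \<in> ?S})"
    by (rule card_by_columns) (use diagram_column_less[OF p] in auto)
  also have "\<dots> \<le> (\<Sum>j<hd p. min i (column_height p j))"
  proof (rule sum_mono)
    fix j
    have sub: "{r. (r, j) \<in> ?S} \<subseteq> {..<column_height p j}"
      using diagram_iff_column_height[OF p] by auto
    have "card {r. (r, j) \<in> ?S} \<le> column_height p j"
      using card_mono[OF _ sub] by simp
    moreover have "card {r. (r, j) \<in> ?S} \<le> card V"
    proof (rule card_inj_on_le)
      show "inj_on (\<lambda>r. a (T (r, j))) {r. (r, j) \<in> ?S}"
        by (rule inj_on_subset[OF colinj]) auto
    qed (use V in auto)
    ultimately show "card {r. (r, j) \<in> ?S} \<le> min i (column_height p j)" using V(2) by simp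
  qed
  also have "\<dots> = sum_list (take i p)" by (rule sum_take_eq_column_sum[OF p, symmetric])
  finally show ?thesis .
qed

text \<open>
  A distribution \<open>g\<close> of the slots to columns becomes a tableau once the columns are sorted by
  decreasing height and each column is written downwards in any order.
\<close>

lemma tableau_from_columns:
  fixes g :: "nat \<times> nat \<Rightarrow> 'j"
  assumes J: "finite J" "g ` slots n l \<subseteq> J" and p: "sorted_wrt (\<ge>) p"
    and inj: "\<And>s s'. s \<in> slots n l \<Longrightarrow> s' \<in> slots n l \<Longrightarrow> g s = g s' \<Longrightarrow> fst s = fst s' \<Longrightarrow> s = s'"
    and shape: "\<And>i. card {j\<in>J. i < card {s \<in> slots n l. g s = j}} = (if i < length p then p ! i else 0)"
  shows "\<exists>T\<in>Tab n l p. \<forall>(u, v)\<in>tab_pairs p T.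
    \<exists>s\<in>slots n l. \<exists>s'\<in>slots n l. s \<noteq> s' \<and> g s = g s' \<and> fst s = u \<and> fst s' = v"
proof -
  let ?S = "slots n l"
  define h where "h = (\<lambda>j. card {s \<in> ?S. g s = j})"
  obtain xs where xs: "set xs = J" "distinct xs" using finite_distinct_list[OF J(1)] by auto
  define js where "js = rev (sort_key h xs)"
  have js: "set js = J" "distinct js" using xs by (auto simp: js_def)
  have "sorted_wrt (\<ge>) (map h js)"
    by (simp add: js_def rev_map[symmetric] sorted_wrt_rev)
  then have desc: "h (js ! k') \<le> h (js ! k)" if "k \<le> k'" "k' < length js" for k k'
    using that by (cases "k = k'") (auto simp: sorted_wrt_iff_nth_less)
  have cell: "(i, k) \<in> diagram p \<longleftrightarrow> k < length js \<and> i < h (js ! k)" for i k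
  proof -
    let ?K = "{k. k < length js \<and> i < h (js ! k)}"
    have K: "?K = {..<card ?K}"
      by (rule downward_closed_eq_lessThan) (use desc in \<open>auto intro: less_le_trans\<close>)
    have cK: "card ?K = card {j\<in>J. i < h j}"
    proof (rule bij_betw_same_card[of "nth js"])
      show "bij_betw (nth js) ?K {j\<in>J. i < h j}"
        unfolding bij_betw_def
      proof
        show "inj_on (nth js) ?K" using js(2) by (auto intro!: inj_onI simp: nth_eq_iff_index_eq)
        show "nth js ` ?K = {j\<in>J. i < h j}" unfolding js(1)[symmetric] set_conv_nth by auto
      qed
    qed
    have "k \<in> ?K \<longleftrightarrow> k \<in> {..<card ?K}" using K by (rule arg_cong)
    then have "k \<in> ?K \<longleftrightarrow> k < card {j\<in>J. i < h j}" unfolding cK lessThan_iff .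
    then show ?thesis using shape[of i] by (auto simp: h_def diagram_def split: if_splits)
  qed
  have "\<exists>\<beta>. bij_betw \<beta> {..<h j} {s \<in> ?S. g s = j}" for j
    by (rule finite_same_card_bij) (auto simp: h_def)
  then obtain \<beta> where \<beta>: "\<And>j. bij_betw (\<beta> j) {..<h j} {s \<in> ?S. g s = j}" by metis
  define b where "b = (\<lambda>(i, k). \<beta> (js ! k) i)"
  have bg: "b (i, k) \<in> ?S \<and> g (b (i, k)) = js ! k" if "(i, k) \<in> diagram p" for i k
    using that \<beta>[of "js ! k"] unfolding cell b_def bij_betw_def by auto
  have bij: "bij_betw b (diagram p) ?S"
    unfolding bij_betw_def
  proof
    show "inj_on b (diagram p)"
    proof (rule inj_onI, clarify)
      fix i k i' k' assume c: "(i, k) \<in> diagram p" "(i', k') \<in> diagram p" "b (i, k) = b (i', k')"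
      then have "js ! k = js ! k'" using bg by metis
      then have k: "k = k'" using c(1,2) js(2) unfolding cell by (simp add: nth_eq_iff_index_eq)
      then show "i = i' \<and> k = k'"
        using c \<beta>[of "js ! k"] unfolding cell b_def bij_betw_def by (auto dest: inj_onD)
    qed
    show "b ` diagram p = ?S"
    proof
      show "b ` diagram p \<subseteq> ?S" using bg by auto
      show "?S \<subseteq> b ` diagram p"
      proof
        fix s assume s: "s \<in> ?S"
        then have "g s \<in> set js" using J(2) js(1) by auto
        then obtain k where k: "k < length js" "js ! k = g s" by (auto simp: in_set_conv_nth)
        have "s \<in> \<beta> (g s) ` {..<h (g s)}" using \<beta>[of "g s"] s unfolding bij_betw_def by auto
        then obtain i where "i < h (g s)" "s = \<beta> (g s) i" by auto
        then have "(i, k) \<in> diagram p" "b (i, k) = s" using k unfolding cell b_def by auto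
        then show "s \<in> b ` diagram p" by force
      qed
    qed
  qed
  have col: "i = i'" if "(i, k) \<in> diagram p" "(i', k) \<in> diagram p"
      "fst (b (i, k)) = fst (b (i', k))" for i i' k
  proof -
    have "b (i, k) = b (i', k)" using that bg inj by metis
    then show ?thesis using bij that by (auto simp: bij_betw_def dest: inj_onD)
  qed
  let ?T = "restrict (fst \<circ> b) (diagram p)"
  show ?thesis
  proof (intro bexI[of _ ?T])
    show "?T \<in> Tab n l p" by (rule Tab_bijI[OF bij]) (use col in auto)
    show "\<forall>(u, v)\<in>tab_pairs p ?T.
      \<exists>s\<in>?S. \<exists>s'\<in>?S. s \<noteq> s' \<and> g s = g s' \<and> fst s = u \<and> fst s' = v"
    proof clarify
      fix u v assume "(u, v) \<in> tab_pairs p ?T"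
      then obtain i i' k where c: "u < v" "(i, k) \<in> diagram p" "(i', k) \<in> diagram p"
          "?T (i, k) = u" "?T (i', k) = v"
        unfolding tab_pairs_def by auto
      then have "fst (b (i, k)) = u" "fst (b (i', k)) = v" by auto
      then show "\<exists>s\<in>?S. \<exists>s'\<in>?S. s \<noteq> s' \<and> g s = g s' \<and> fst s = u \<and> fst s' = v"
        using bg[OF c(2)] bg[OF c(3)] c(1)
        by (intro bexI[of _ "b (i, k)"] bexI[of _ "b (i', k)"]) auto
    qed
  qed
qed

text \<open>
  Converse of the previous estimate: when the orbit type of \<open>a\<close> is dominated by \<open>p\<close>, there is a
  zero-one matrix with the multiplicities of the colours as row sums and the column heights of \<open>p\<close>
  as column sums. Its row of a colour tells which columns receive the slots of this colour.
\<close>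

lemma exists_tableau_separating_colours:
  assumes p: "p \<in> parts_ge n l" and n: "n \<ge> 1"
    and dom: "\<And>i. sum_list (take i (orbit_type n l a)) \<le> sum_list (take i p)"
  shows "\<exists>T\<in>Tab n l p. \<forall>(u, v)\<in>tab_pairs p T. a u \<noteq> a v"
proof -
  let ?S = "slots n l"
  have srt: "sorted_wrt (\<ge>) p" and tot: "sum_list p = n + l - 1"
    using p by (auto simp: parts_ge_def partitions_def)
  obtain cs where cs: "distinct cs" "set cs = colours n l a"
    "orbit_type n l a = map (\<lambda>c. weight n l a {c}) cs" by (rule orbit_type_colours)
  let ?nu = "orbit_type n l a"
  let ?h = "column_height p"
  have len: "length ?nu = length cs" by (simp add: cs(3))
  have "(\<Sum>j<hd p. ?h j) = sum_list p"
  proof -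
    have "?h j \<le> length p" for j unfolding column_height_def
      using card_mono[of "{..<length p}" "{r. r < length p \<and> j < p ! r}"] by auto
    then have "min (length p) (?h j) = ?h j" for j by (simp add: min_absorb2)
    then show ?thesis using sum_take_eq_column_sum[OF srt, of "length p"] by simp
  qed
  also have "\<dots> = sum_list ?nu" using tot n by (simp add: sum_list_orbit_type)
  finally have "(\<Sum>j<hd p. ?h j) = sum_list ?nu" .
  then obtain A where A: "\<forall>k<length ?nu. A k \<subseteq> {..<hd p} \<and> card (A k) = ?nu ! k"
      "\<forall>j\<in>{..<hd p}. card {k. k < length ?nu \<and> j \<in> A k} = ?h j"
    using gale_ryser[of "{..<hd p}" ?nu ?h] orbit_type_sorted[of n l a] dom
    unfolding sum_take_eq_column_sum[OF srt] by auto
  have finA: "finite (A k)" if "k < length cs" for k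
    using A(1) that len finite_subset by (metis finite_lessThan)
  have "\<exists>\<beta>. bij_betw \<beta> {s \<in> ?S. a (fst s) = cs ! k} (A k)" if "k < length cs" for k
  proof (rule finite_same_card_bij)
    have "card (A k) = weight n l a {cs ! k}" using A(1) that by (simp add: cs(3))
    then show "card {s \<in> ?S. a (fst s) = cs ! k} = card (A k)" by (simp add: weight_def)
  qed (use finA that in auto)
  then obtain \<beta> where \<beta>: "\<And>k. k < length cs \<Longrightarrow> bij_betw (\<beta> k) {s \<in> ?S. a (fst s) = cs ! k} (A k)"
    by metis
  have "\<exists>k<length cs. cs ! k = a (fst s)" if "s \<in> ?S" for s
    using that cs(2) by (auto simp: colours_def in_set_conv_nth[symmetric])
  then obtain idx where idx: "\<And>s. s \<in> ?S \<Longrightarrow> idx s < length cs \<and> cs ! idx s = a (fst s)"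
    by metis
  define g where "g = (\<lambda>s. \<beta> (idx s) s)"
  have gA: "g s \<in> A (idx s)" if "s \<in> ?S" for s
    using \<beta>[of "idx s"] idx[OF that] that unfolding g_def bij_betw_def by auto
  have ginj: "s = s'" if s: "s \<in> ?S" "s' \<in> ?S" "g s = g s'" "a (fst s) = a (fst s')" for s s'
  proof -
    have i: "idx s = idx s'"
      using idx[OF s(1)] idx[OF s(2)] s(4) cs(1) nth_eq_iff_index_eq by metis
    then have "inj_on (\<beta> (idx s)) {t \<in> ?S. a (fst t) = cs ! idx s}"
      using \<beta>[of "idx s"] idx[OF s(1)] unfolding bij_betw_def by auto
    moreover have "\<beta> (idx s) s = \<beta> (idx s) s'" using s(3) i by (simp add: g_def)
    ultimately show ?thesis using idx[OF s(1)] s by (auto dest: inj_onD)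
  qed
  have fibre: "card {s \<in> ?S. g s = j} = ?h j" if j: "j < hd p" for j
  proof -
    have "bij_betw idx {s \<in> ?S. g s = j} {k. k < length ?nu \<and> j \<in> A k}"
      unfolding bij_betw_def
    proof
      show "inj_on idx {s \<in> ?S. g s = j}"
      proof (rule inj_onI)
        fix s s' assume "s \<in> {s \<in> ?S. g s = j}" "s' \<in> {s \<in> ?S. g s = j}" "idx s = idx s'"
        then show "s = s'" using ginj[of s s'] idx[of s] idx[of s'] by auto
      qed
      show "idx ` {s \<in> ?S. g s = j} = {k. k < length ?nu \<and> j \<in> A k}"
      proof
        show "idx ` {s \<in> ?S. g s = j} \<subseteq> {k. k < length ?nu \<and> j \<in> A k}"
          using idx gA len by auto
        show "{k. k < length ?nu \<and> j \<in> A k} \<subseteq> idx ` {s \<in> ?S. g s = j}"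
        proof
          fix k assume "k \<in> {k. k < length ?nu \<and> j \<in> A k}"
          then have k: "k < length cs" "j \<in> A k" using len by auto
          then obtain s where s: "s \<in> ?S" "a (fst s) = cs ! k" "\<beta> k s = j"
          proof -
            have "\<beta> k ` {s \<in> ?S. a (fst s) = cs ! k} = A k"
              using \<beta>[OF k(1)] by (rule bij_betw_imp_surj_on)
            then have "j \<in> \<beta> k ` {s \<in> ?S. a (fst s) = cs ! k}" using k(2) by simp
            then show thesis using that by auto
          qed
          have "idx s = k" using idx[OF s(1)] s(2) k(1) cs(1) nth_eq_iff_index_eq by metis
          then show "k \<in> idx ` {s \<in> ?S. g s = j}" using s by (auto simp: g_def)
        qed
      qed
    qed
    then have "card {s \<in> ?S. g s = j} = card {k. k < length ?nu \<and> j \<in> A k}"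
      by (rule bij_betw_same_card)
    then show ?thesis using A(2) j by simp
  qed
  have "\<exists>T\<in>Tab n l p. \<forall>(u, v)\<in>tab_pairs p T.
    \<exists>s\<in>?S. \<exists>s'\<in>?S. s \<noteq> s' \<and> g s = g s' \<and> fst s = u \<and> fst s' = v"
  proof (rule tableau_from_columns[of "{..<hd p}"])
    show "g ` ?S \<subseteq> {..<hd p}"
    proof
      fix j assume "j \<in> g ` ?S"
      then obtain s where "s \<in> ?S" "j = g s" by auto
      then show "j \<in> {..<hd p}" using gA[of s] idx[of s] A(1) len by (metis subsetD)
    qed
    show "s = s'" if "s \<in> ?S" "s' \<in> ?S" "g s = g s'" "fst s = fst s'" for s s'
      using ginj that by metis
    fix i
    have "{j \<in> {..<hd p}. i < card {s \<in> ?S. g s = j}} = {j. (i, j) \<in> diagram p}"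
      using fibre diagram_iff_column_height[OF srt] diagram_column_less[OF srt] by auto
    also have "\<dots> = (if i < length p then {..<p ! i} else {})" by (auto simp: diagram_def)
    finally show "card {j \<in> {..<hd p}. i < card {s \<in> ?S. g s = j}} = (if i < length p then p ! i else 0)"
      by simp
  qed (use srt in auto)
  then obtain T where T: "T \<in> Tab n l p" "\<forall>(u, v)\<in>tab_pairs p T.
    \<exists>s\<in>?S. \<exists>s'\<in>?S. s \<noteq> s' \<and> g s = g s' \<and> fst s = u \<and> fst s' = v" by blast
  have "\<forall>(u, v)\<in>tab_pairs p T. a u \<noteq> a v" using T(2) ginj by fast
  then show ?thesis using T(1) by blast
qed

section \<open>Adding a box\<close>

lemma min_sum_Suc:
  fixes h :: "'j \<Rightarrow> nat"
  assumes "finite J"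
  shows "(\<Sum>j\<in>J. min (Suc t) (h j)) = (\<Sum>j\<in>J. min t (h j)) + card {j\<in>J. t < h j}"
proof -
  have "(\<Sum>j\<in>J. min (Suc t) (h j)) = (\<Sum>j\<in>J. min t (h j) + (if t < h j then 1 else 0))"
    by (intro sum.cong) auto
  also have "\<dots> = (\<Sum>j\<in>J. min t (h j)) + card {j\<in>J. t < h j}"
    unfolding sum.distrib using assms by (simp add: sum.If_cases Int_def)
  finally show ?thesis .
qed

text \<open>
  The combinatorial core of the computation of leading monomials. Let the orbit type of
  \<open>(a_1, \<dots>, a_n)\<close> dominate the shape with column heights \<open>h\<close>, and put a new square on the highest
  column of height at most \<open>d\<close>. Then the dominance persists when the point is prolonged by any of
  its \<open>d + 1\<close> most frequent values, continued by new values if there are too few; so by more values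
  than a polynomial of degree \<open>d\<close> has roots.
\<close>

lemma insert_box_dominance:
  fixes a :: "nat \<Rightarrow> 'c" and h :: "'j \<Rightarrow> nat"
  assumes inf: "infinite (UNIV :: 'c set)" and n: "n \<ge> 1" and J: "finite J"
    and dom: "\<And>i. (\<Sum>j\<in>J. min i (h j)) \<le> sum_list (take i (orbit_type n l a))"
    and j0: "h j0 \<le> d" "\<And>j. j \<in> J \<Longrightarrow> h j \<le> d \<Longrightarrow> h j \<le> h j0"
  shows "\<exists>K. card K = Suc d \<and> (\<forall>x\<in>K. \<forall>i. (\<Sum>j\<in>J. min i (h j)) + (if h j0 < i then 1 else 0)
    \<le> sum_list (take i (orbit_type (Suc n) l (a(Suc n := x)))))"
proof -
  obtain cs where cs: "distinct cs" "set cs = colours n l a"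
    "orbit_type n l a = map (\<lambda>c. weight n l a {c}) cs" by (rule orbit_type_colours)
  have "infinite (UNIV - set cs)" using inf by simp
  then obtain z :: "nat \<Rightarrow> 'c" where z: "inj z" "range z \<subseteq> UNIV - set cs"
    using infinite_countable_subset by blast
  \<comment> \<open>All values listed by decreasing multiplicity: the colours of the point, then values of
    multiplicity \<open>0\<close>. Treating unused values as colours makes adding a box to an existing row and
    opening a new row the same operation.\<close>
  define \<kappa> where "\<kappa> = (\<lambda>k. if k < length cs then cs ! k else z k)"
  have zcs: "z k \<notin> set cs" for k using z(2) by blast
  have inj: "inj \<kappa>"
  proof (rule injI)
    fix k k' assume "\<kappa> k = \<kappa> k'"
    then show "k = k'"
      using zcs[of k] zcs[of k'] z(1) cs(1)
      by (auto simp: \<kappa>_def nth_eq_iff_index_eq dest: injD split: if_splits) (metis nth_mem)+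
  qed
  define w where "w = (\<lambda>k. weight n l a {\<kappa> k})"
  have w0: "w k = 0" if "k \<ge> length cs" for k
    using that zcs[of k] cs(2) weight_pos_iff[of n l a "z k"] by (simp add: w_def \<kappa>_def)
  have w_mono: "w k' \<le> w k" if "k \<le> k'" for k k'
  proof (cases "k' < length cs")
    case True
    then show ?thesis using that orbit_type_sorted[of n l a] unfolding cs(3)
      by (cases "k = k'") (simp_all add: sorted_wrt_iff_nth_less w_def \<kappa>_def)
  qed (simp add: w0)
  define D where "D = (\<lambda>i. \<Sum>k<i. w k)"
  define B where "B = (\<lambda>i. \<Sum>j\<in>J. min i (h j))"
  have D: "sum_list (take i (orbit_type n l a)) = D i" for i
  proof -
    have "sum_list (take i (orbit_type n l a)) = (\<Sum>k<min i (length cs). w k)"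
      unfolding cs(3) by (simp add: sum_list_sum_nth atLeast0LessThan min.commute w_def \<kappa>_def)
    also have "\<dots> = D i" unfolding D_def by (rule sum.mono_neutral_left) (auto simp: w0)
    finally show ?thesis .
  qed
  have DB: "B i \<le> D i" for i using dom[of i] D[of i] by (simp add: B_def)
  have Dw: "weight n l a (\<kappa> ` I) = (\<Sum>k\<in>I. w k)" if "finite I" for I
    unfolding w_def using that inj
    by (subst weight_sum) (auto simp: sum.reindex inj_on_subset)
  \<comment> \<open>The set of \<open>i\<close> values witnessing the new inequality is the set of the first \<open>i\<close> values, unless
    \<open>h j0 < i \<le> k\<close> and the old inequality is tight at \<open>i\<close>. There \<open>B\<close> has constant slope, because
    no column has height in \<open>{h j0<..d}\<close>, while \<open>D\<close> is concave and lies above \<open>B\<close>; so \<open>D\<close> has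
    the same slope up to \<open>d\<close>, and the last of the \<open>i\<close> values may be exchanged for \<open>\<kappa> k\<close>.\<close>
  have main: "B i + (if h j0 < i then 1 else 0) \<le> sum_list (take i (orbit_type (Suc n) l (a(Suc n := \<kappa> k))))"
    if k: "k \<le> d" for k i
  proof -
    have "\<exists>I. finite I \<and> card I \<le> i \<and> B i + (if h j0 < i then 1 else 0) \<le> (\<Sum>t\<in>I. w t) + (if k \<in> I then 1 else 0)"
    proof (cases "i \<le> h j0 \<or> k < i \<or> B i < D i")
      case True
      then show ?thesis using DB[of i] by (intro exI[of _ "{..<i}"]) (auto simp: D_def)
    next
      case False
      then have i: "h j0 < i" "i \<le> k" "D i = B i" using DB[of i] by auto
      define s where "s = card {j\<in>J. d < h j}"
      have B_Suc: "B (Suc t) = B t + s" if "h j0 \<le> t" "t \<le> d" for t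
      proof -
        have "{j\<in>J. t < h j} = {j\<in>J. d < h j}" using that j0(2) by force
        then show ?thesis unfolding B_def min_sum_Suc[OF J] s_def by simp
      qed
      obtain i' where i': "i = Suc i'" using i(1) by (cases i) auto
      have "D i = D i' + w i'" by (simp add: i' D_def)
      moreover have "B i = B i' + s" unfolding i' using i i' k by (intro B_Suc) auto
      ultimately have ws: "w i' \<le> s" using DB[of i'] i(3) by simp
      have step: "s \<le> w t \<and> D (Suc t) = B (Suc t)" if "D t = B t" "i \<le> t" "t \<le> d" for t
      proof -
        have "B (Suc t) = B t + s" using that i by (intro B_Suc) auto
        moreover have "D (Suc t) = D t + w t" by (simp add: D_def)
        moreover have "w t \<le> s" using w_mono[of i' t] that(2) i' ws by simp
        ultimately show ?thesis using DB[of "Suc t"] that(1) by simp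
      qed
      have "D k = B k" using i(2) k
      proof (induction k rule: dec_induct)
        case base
        show ?case by (rule i(3))
      next
        case (step t)
        then show ?case using \<open>\<And>t. \<lbrakk>D t = B t; i \<le> t; t \<le> d\<rbrakk> \<Longrightarrow> s \<le> w t \<and> D (Suc t) = B (Suc t)\<close>[of t] by simp
      qed
      then have "s \<le> w k" using step[of k] i(2) k by blast
      then have "D i \<le> (\<Sum>t\<in>insert k {..<i'}. w t)"
        using ws i(2) i' by (simp add: D_def)
      then show ?thesis using i i' by (intro exI[of _ "insert k {..<i'}"]) (auto simp: card_insert_if)
    qed
    then obtain I where I: "finite I" "card I \<le> i"
      "B i + (if h j0 < i then 1 else 0) \<le> (\<Sum>t\<in>I. w t) + (if k \<in> I then 1 else 0)" by blast
    have "B i + (if h j0 < i then 1 else 0) \<le> weight (Suc n) l (a(Suc n := \<kappa> k)) (\<kappa> ` I)"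
      using I(3) inj unfolding weight_Suc[OF n] Dw[OF I(1)] by (simp add: inj_image_mem_iff)
    also have "\<dots> \<le> sum_list (take i (orbit_type (Suc n) l (a(Suc n := \<kappa> k))))"
      using I(1,2) by (intro weight_le_sum_take_orbit_type) (auto intro: order.trans[OF card_image_le])
    finally show ?thesis .
  qed
  show ?thesis
  proof (intro exI[of _ "\<kappa> ` {..d}"] conjI)
    show "card (\<kappa> ` {..d}) = Suc d" using inj by (simp add: card_image inj_on_subset)
  qed (use main in \<open>auto simp: B_def\<close>)
qed

section \<open>Columns read off a leading monomial\<close>

definition fibre_size :: "nat \<Rightarrow> nat \<Rightarrow> (nat \<times> nat \<Rightarrow> nat) \<Rightarrow> nat \<Rightarrow> nat" where
  "fibre_size n l g j = card {s \<in> slots n l. g s = j}"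

definition same_column :: "nat \<Rightarrow> nat \<Rightarrow> (nat \<times> nat \<Rightarrow> nat) \<Rightarrow> nat \<Rightarrow> nat \<Rightarrow> bool" where
  "same_column n l g u v \<longleftrightarrow>
     (\<exists>s\<in>slots n l. \<exists>s'\<in>slots n l. g s = g s' \<and> fst s = u \<and> fst s' = v)"

text \<open>
  The tableau condition on the copies of \<open>1\<close>; entries from \<open>2\<close> on have a single slot each.
\<close>

definition column_separated :: "nat \<Rightarrow> nat \<Rightarrow> (nat \<times> nat \<Rightarrow> nat) \<Rightarrow> bool" where
  "column_separated n l g \<longleftrightarrow>
     (\<forall>s\<in>slots n l. \<forall>s'\<in>slots n l. g s = g s' \<longrightarrow> fst s = fst s' \<longrightarrow> s = s')"

lemma slots_Suc:
  assumes "n \<ge> 1"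
  shows "slots (Suc n) l = insert (Suc n, 0) (slots n l)" "(Suc n, 0) \<notin> slots n l"
    "s \<in> slots n l \<Longrightarrow> 1 \<le> fst s \<and> fst s \<le> n"
  using assms by (auto simp: slots_def)

text \<open>
  The case in which the differences of all variables divide \<open>f\<close>. Every exponent bound then comes
  from the product of the differences, so the shape can be chosen smallest in the dominance order:
  the hook with first row \<open>l\<close> and first column \<open>m\<close>, which is also the orbit type of the points with
  pairwise different coordinates.
\<close>

lemma lead_monom_column_system_hook:
  fixes f :: "'k::field mpoly"
  assumes inf: "infinite (UNIV :: 'k set)" and m: "m \<ge> 1" and l: "l \<ge> 1" and N: "m + l \<le> N"
    and f: "f \<in> polys m" "f \<noteq> 0"
    and van: "\<forall>a i j. (i, j) \<in> pairs_upto m \<longrightarrow> a i = a j \<longrightarrow> eval_poly a f = 0"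
  shows "\<exists>g a. (\<forall>s\<in>slots m l. g s < N) \<and> column_separated m l g \<and>
    (\<forall>v\<in>{1..m}. card {u. 1 \<le> u \<and> u < v \<and> (v \<le> m \<or> same_column m l g u v)}
        \<le> Poly_Mapping.lookup (lead_monom f) v) \<and>
    eval_poly a f \<noteq> 0 \<and>
    (\<forall>i. (\<Sum>j<N. min i (fibre_size m l g j)) \<le> sum_list (take i (orbit_type m l a)))"
proof -
  obtain q where q: "q \<in> polys m" "f = pair_prod (pairs_upto m) * q"
  proof -
    have "\<exists>q\<in>polys m. f = pair_prod (pairs_upto m) * q"
      by (rule pair_prod_divides[OF inf order.refl f(1)]) (use van in blast)
    then show thesis using that by blast
  qed
  have pp: "pair_prod (pairs_upto m) \<noteq> (0 :: 'k mpoly)" by (rule pair_prod_nonzero) auto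
  obtain a where a: "eval_poly a f \<noteq> 0" using exists_nonzero_value[OF inf f] by blast
  have ainj: "a i \<noteq> a j" if "1 \<le> i" "i < j" "j \<le> m" for i j
    using van a that unfolding pairs_upto_def by blast
  \<comment> \<open>The hook: column \<open>0\<close> is \<open>1, \<dots>, m\<close>, and each other copy of \<open>1\<close> is a column of its own.\<close>
  define g :: "nat \<times> nat \<Rightarrow> nat" where "g = snd"
  have "(\<Sum>j<N. min i (fibre_size m l g j)) \<le> sum_list (take i (orbit_type m l a))" for i
  proof (cases "i = 0")
    case False
    let ?r = "min i m"
    have r: "1 \<le> ?r" using False m by simp
    have "min i (fibre_size m l g j) \<le> card {s \<in> slots ?r l. g s = j}" for j
    proof (cases "j = 0")
      case True
      have "{s \<in> slots r l. g s = 0} = {1..r} \<times> {0}" if "1 \<le> r" for r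
        using that l by (auto simp: slots_def g_def)
      then have "fibre_size m l g j = m" "card {s \<in> slots ?r l. g s = j} = ?r"
        using m r True by (auto simp: fibre_size_def)
      then show ?thesis by simp
    next
      case False
      then have "{s \<in> slots m l. g s = j} = {s \<in> slots ?r l. g s = j}"
        by (auto simp: slots_def g_def)
      then show ?thesis by (simp add: fibre_size_def)
    qed
    then have "(\<Sum>j<N. min i (fibre_size m l g j)) \<le> (\<Sum>j<N. card {s \<in> slots ?r l. g s = j})"
      by (intro sum_mono)
    also have "\<dots> = (\<Sum>j<N. card {v. (v, j) \<in> slots ?r l})"
    proof (intro sum.cong refl)
      fix j
      have "{s \<in> slots ?r l. g s = j} = (\<lambda>v. (v, j)) ` {v. (v, j) \<in> slots ?r l}"
        by (auto simp: g_def)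
      then show "card {s \<in> slots ?r l. g s = j} = card {v. (v, j) \<in> slots ?r l}"
        by (simp add: card_image inj_on_def)
    qed
    also have "\<dots> = card (slots ?r l)"
      by (rule card_by_columns[symmetric]) (use N in \<open>auto simp: slots_def\<close>)
    also have "\<dots> \<le> weight m l a (a ` {1..?r})"
      unfolding weight_def using r by (intro card_mono) (auto simp: slots_def)
    also have "\<dots> \<le> sum_list (take i (orbit_type m l a))"
      by (rule weight_le_sum_take_orbit_type) (auto intro: order.trans[OF card_image_le])
    finally show ?thesis .
  qed simp
  moreover have "card {u. 1 \<le> u \<and> u < v \<and> (v \<le> m \<or> same_column m l g u v)}
        \<le> Poly_Mapping.lookup (lead_monom f) v" if "v \<in> {1..m}" for v
  proof -
    have "q \<noteq> 0" using f(2) q(2) by auto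
    then have "lead_monom f = lead_monom (pair_prod (pairs_upto m) :: 'k mpoly) + lead_monom q"
      unfolding q(2) by (intro lead_monom_mult pp)
    then have "Poly_Mapping.lookup (lead_monom f) v \<ge> card {u. (u, v) \<in> pairs_upto m}"
      by (simp add: lookup_add lookup_lead_pair_prod[OF order.refl])
    moreover have "{u. (u, v) \<in> pairs_upto m} = {u. 1 \<le> u \<and> u < v \<and> (v \<le> m \<or> same_column m l g u v)}"
      using that by (auto simp: pairs_upto_def)
    ultimately show ?thesis by simp
  qed
  moreover have "\<forall>s\<in>slots m l. g s < N" using N m by (auto simp: slots_def g_def)
  moreover have "column_separated m l g" by (auto simp: column_separated_def g_def prod_eq_iff)
  ultimately show ?thesis using a by blast
qed

text \<open>
  From the exponents of the leading monomial of \<open>f\<close> one builds columns whose product of differences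
  has a leading monomial dividing that of \<open>f\<close>, together with a point at which \<open>f\<close> does not vanish
  and whose orbit type dominates the shape so obtained. The induction removes the largest variable:
  the hypotheses pass to the coefficient of its highest power, \<open>d\<close> say, and the new entry goes to
  the bottom of the highest column of height at most \<open>d\<close>, where it contributes that height to
  the exponent.
\<close>

lemma lead_monom_column_system:
  fixes f :: "'k::field mpoly"
  assumes inf: "infinite (UNIV :: 'k set)" and m: "m \<ge> 1" and l: "l \<ge> 1"
    and mn: "m \<le> n" and "n + l \<le> N"
    and "f \<in> polys n" "f \<noteq> 0"
    and "\<forall>a i j. (i, j) \<in> pairs_upto m \<longrightarrow> a i = a j \<longrightarrow> eval_poly a f = 0"
  shows "\<exists>g a. (\<forall>s\<in>slots n l. g s < N) \<and> column_separated n l g \<and>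
    (\<forall>v\<in>{1..n}. card {u. 1 \<le> u \<and> u < v \<and> (v \<le> m \<or> same_column n l g u v)}
        \<le> Poly_Mapping.lookup (lead_monom f) v) \<and>
    eval_poly a f \<noteq> 0 \<and>
    (\<forall>i. (\<Sum>j<N. min i (fibre_size n l g j)) \<le> sum_list (take i (orbit_type n l a)))"
  using mn assms(5-)
proof (induction n arbitrary: f rule: nat_induct_at_least)
  case base
  then show ?case using lead_monom_column_system_hook[OF inf m l] by blast
next
  case (Suc n f)
  note f = Suc.prems(2,3) and van = Suc.prems(4)
  have n: "n \<ge> 1" using Suc.hyps m by simp
  obtain c d where c: "\<forall>k. c k \<in> polys n" "f = (\<Sum>k\<le>d. c k * X (Suc n) ^ k)" "c d \<noteq> 0"
    "lead_monom f = lead_monom (c d) + Poly_Mapping.single (Suc n) d"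
    by (rule last_variable_lead[OF f])
  have ev: "eval_poly (a(Suc n := x)) f = (\<Sum>k\<le>d. eval_poly a (c k) * x ^ k)" for a x
    using eval_last_variable[OF _ c(2)] c(1) by blast
  have "eval_poly a (c d) = 0" if ij: "(i, j) \<in> pairs_upto m" "a i = a j" for a i j
  proof (rule ccontr)
    assume "eval_poly a (c d) \<noteq> 0"
    moreover obtain S :: "'k set" where "finite S" "card S = Suc d"
      using infinite_arbitrarily_large[OF inf] by blast
    ultimately obtain x where "eval_poly (a(Suc n := x)) f \<noteq> 0"
      using exists_nonroot[of "\<lambda>k. eval_poly a (c k)" d S] unfolding ev by auto
    moreover have "eval_poly (a(Suc n := x)) f = 0"
      by (rule van[rule_format, OF ij(1)]) (use ij Suc.hyps in \<open>auto simp: pairs_upto_def\<close>)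
    ultimately show False by simp
  qed
  then have van': "\<forall>a i j. (i, j) \<in> pairs_upto m \<longrightarrow> a i = a j \<longrightarrow> eval_poly a (c d) = 0"
    by blast
  obtain g a where g: "\<forall>s\<in>slots n l. g s < N" "column_separated n l g"
    and exps: "\<forall>v\<in>{1..n}. card {u. 1 \<le> u \<and> u < v \<and> (v \<le> m \<or> same_column n l g u v)}
        \<le> Poly_Mapping.lookup (lead_monom (c d)) v"
    and a: "eval_poly a (c d) \<noteq> 0"
    and dom: "\<forall>i. (\<Sum>j<N. min i (fibre_size n l g j)) \<le> sum_list (take i (orbit_type n l a))"
  proof -
    have "n + l \<le> N" using Suc.prems(1) by simp
    from Suc.IH[OF this c(1)[rule_format, of d] c(3) van'] show thesis
      by (elim exE conjE) (rule that)
  qed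
  let ?h = "fibre_size n l g"
  \<comment> \<open>There are fewer than \<open>N\<close> slots, so some column is still empty and a column of height at
    most \<open>d\<close> exists.\<close>
  obtain j1 where j1: "j1 < N" "?h j1 = 0"
  proof -
    have "card (g ` slots n l) < N"
      using card_image_le[of "slots n l" g] card_slots[OF n, of l] Suc.prems(1) by simp
    then have "\<not> {..<N} \<subseteq> g ` slots n l"
      using card_mono[of "g ` slots n l" "{..<N}"] by auto
    then obtain j where "j < N" "j \<notin> g ` slots n l" by auto
    then show thesis using that[of j] by (auto simp: fibre_size_def)
  qed
  obtain j0 where j0: "j0 < N" "?h j0 \<le> d" "\<And>j. j \<in> {..<N} \<Longrightarrow> ?h j \<le> d \<Longrightarrow> ?h j \<le> ?h j0"
  proof -
    let ?A = "{j. j < N \<and> ?h j \<le> d}"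
    have "finite ?A" "?A \<noteq> {}" using j1 by auto
    then have "Max (?h ` ?A) \<in> ?h ` ?A" "\<And>j. j \<in> ?A \<Longrightarrow> ?h j \<le> Max (?h ` ?A)"
      by (auto intro: Max_in)
    then show thesis using that by (smt (verit, best) image_iff lessThan_iff mem_Collect_eq)
  qed
  obtain K where K: "card K = Suc d"
    "\<And>x i. x \<in> K \<Longrightarrow> (\<Sum>j<N. min i (?h j)) + (if ?h j0 < i then 1 else 0)
      \<le> sum_list (take i (orbit_type (Suc n) l (a(Suc n := x))))"
    using insert_box_dominance[where h = ?h, OF inf n finite_lessThan dom[rule_format] j0(2,3)] by blast
  obtain x where x: "x \<in> K" "eval_poly (a(Suc n := x)) f \<noteq> 0"
    using exists_nonroot[of "\<lambda>k. eval_poly a (c k)" d K] a K(1) unfolding ev by auto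
  define g' where "g' = g((Suc n, 0) := j0)"
  note sl = slots_Suc[OF n, where l = l]
  have g'old: "g' s = g s" if "s \<in> slots n l" for s
    using sl(2) that by (auto simp: g'_def)
  have g'new: "g' (Suc n, 0) = j0" by (simp add: g'_def)
  have h': "fibre_size (Suc n) l g' j = ?h j + (if j = j0 then 1 else 0)" for j
  proof -
    have "{s \<in> slots (Suc n) l. g' s = j} =
        {s \<in> slots n l. g s = j} \<union> (if j = j0 then {(Suc n, 0)} else {})"
      unfolding sl(1) using g'old g'new by auto
    then show ?thesis unfolding fibre_size_def using sl(2) by simp
  qed
  have "(\<Sum>j<N. min i (fibre_size (Suc n) l g' j)) \<le>
      sum_list (take i (orbit_type (Suc n) l (a(Suc n := x))))" for i
  proof -
    have "(\<Sum>j<N. min i (fibre_size (Suc n) l g' j)) =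
        (\<Sum>j<N. min i (?h j) + (if j = j0 then if ?h j0 < i then 1 else 0 else 0))"
      unfolding h' by (intro sum.cong) auto
    also have "\<dots> = (\<Sum>j<N. min i (?h j)) + (if ?h j0 < i then 1 else 0)"
      unfolding sum.distrib using j0(1) by simp
    also note K(2)[OF x(1), of i]
    finally show ?thesis .
  qed
  moreover have "\<forall>s\<in>slots (Suc n) l. g' s < N"
    unfolding sl(1) using g(1) g'old g'new j0(1) by auto
  moreover have "column_separated (Suc n) l g'"
    unfolding column_separated_def
  proof (intro ballI impI)
    fix s s' assume s: "s \<in> slots (Suc n) l" "s' \<in> slots (Suc n) l" "g' s = g' s'" "fst s = fst s'"
    show "s = s'"
    proof (cases "fst s = Suc n")
      case True
      then show ?thesis using s sl(3)[of s] sl(3)[of s'] unfolding sl(1) by auto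
    next
      case False
      then have "s \<in> slots n l" "s' \<in> slots n l" using s unfolding sl(1) by auto
      then show ?thesis using s g'old g(2) unfolding column_separated_def by metis
    qed
  qed
  moreover have "card {u. 1 \<le> u \<and> u < v \<and> (v \<le> m \<or> same_column (Suc n) l g' u v)}
        \<le> Poly_Mapping.lookup (lead_monom f) v" if v: "v \<in> {1..Suc n}" for v
  proof (cases "v = Suc n")
    case False
    then have v': "v \<in> {1..n}" using v by auto
    have "same_column n l g u v" if same: "same_column (Suc n) l g' u v" and uv: "u < v" for u
    proof -
      obtain s s' where s: "s \<in> slots (Suc n) l" "s' \<in> slots (Suc n) l" "g' s = g' s'" "fst s = u" "fst s' = v"
        using same unfolding same_column_def by auto
      then have "s \<in> slots n l" "s' \<in> slots n l" using v' uv unfolding sl(1) by auto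
      then show ?thesis using s g'old unfolding same_column_def by metis
    qed
    then have "{u. 1 \<le> u \<and> u < v \<and> (v \<le> m \<or> same_column (Suc n) l g' u v)} \<subseteq>
      {u. 1 \<le> u \<and> u < v \<and> (v \<le> m \<or> same_column n l g u v)}" by auto
    then have "card {u. 1 \<le> u \<and> u < v \<and> (v \<le> m \<or> same_column (Suc n) l g' u v)} \<le>
      card {u. 1 \<le> u \<and> u < v \<and> (v \<le> m \<or> same_column n l g u v)}"
      by (intro card_mono) auto
    also have "\<dots> \<le> Poly_Mapping.lookup (lead_monom (c d)) v" using exps v' by blast
    also have "\<dots> \<le> Poly_Mapping.lookup (lead_monom f) v" by (simp add: c(4) lookup_add)
    finally show ?thesis .
  next
    case True
    have "{u. 1 \<le> u \<and> u < v \<and> (v \<le> m \<or> same_column (Suc n) l g' u v)} \<subseteq>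
      fst ` {s \<in> slots n l. g s = j0}"
    proof
      fix u assume "u \<in> {u. 1 \<le> u \<and> u < v \<and> (v \<le> m \<or> same_column (Suc n) l g' u v)}"
      then have u: "u < Suc n" "same_column (Suc n) l g' u (Suc n)" using True Suc.hyps by auto
      then obtain s s' where s: "s \<in> slots (Suc n) l" "s' \<in> slots (Suc n) l" "g' s = g' s'" "fst s = u"
          "fst s' = Suc n"
        unfolding same_column_def by auto
      then have "s \<in> slots n l" "s' = (Suc n, 0)"
        using u(1) sl(3)[of s'] unfolding sl(1) by auto
      then show "u \<in> fst ` {s \<in> slots n l. g s = j0}" using s g'old g'new by auto
    qed
    then have "card {u. 1 \<le> u \<and> u < v \<and> (v \<le> m \<or> same_column (Suc n) l g' u v)} \<le>
      card (fst ` {s \<in> slots n l. g s = j0})" by (intro card_mono) auto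
    also have "\<dots> \<le> ?h j0" unfolding fibre_size_def by (rule card_image_le) simp
    also have "\<dots> \<le> d" by (rule j0(2))
    also have "\<dots> \<le> Poly_Mapping.lookup (lead_monom f) v" by (simp add: c(4) lookup_add True)
    finally show ?thesis .
  qed
  ultimately show ?case using x(2) by blast
qed

section \<open>Specht polynomials and their least common multiples\<close>

lemma column_eq:
  assumes "sorted_wrt (\<ge>) p"
  shows "column p T j = map (\<lambda>i. T (i, j)) [0..<column_height p j]"
proof -
  let ?h = "column_height p j"
  have h: "?h \<le> length p"
    unfolding column_height_def using card_mono[of "{..<length p}" "{r. r < length p \<and> j < p ! r}"] by auto
  have iff: "j < p ! i \<longleftrightarrow> i < ?h" if "i < length p" for i
    using diagram_iff_column_height[OF assms, of i j] that by (simp add: diagram_def)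
  have "concat (map (\<lambda>i. if P i then [f i] else []) xs) = map f (filter P xs)"
    for P and f :: "nat \<Rightarrow> nat" and xs :: "nat list"
    by (induction xs) auto
  then have "column p T j = map (\<lambda>i. T (i, j)) (filter (\<lambda>i. j < p ! i) [0..<length p])"
    unfolding column_def .
  also have "filter (\<lambda>i. j < p ! i) [0..<length p] = filter (\<lambda>i. i < ?h) [0..<length p]"
    using iff by (intro filter_cong) auto
  also have "[0..<length p] = [0..<?h] @ [?h..<length p]"
    using upt_add_eq_append[of 0 ?h "length p - ?h"] h by simp
  also have "filter (\<lambda>i. i < ?h) \<dots> = [0..<?h]" by (simp add: filter_empty_conv)
  finally show ?thesis .
qed

lemma prod_up_to_sign:
  fixes F :: "'a \<Rightarrow> 'b::comm_ring_1" and G :: "'c \<Rightarrow> 'b"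
  assumes "finite Z" "inj_on \<phi> Z" "\<And>z. z \<in> Z \<Longrightarrow> F z = G (\<phi> z) \<or> F z = - G (\<phi> z)"
  shows "prod F Z = prod G (\<phi> ` Z) \<or> prod F Z = - prod G (\<phi> ` Z)"
  using assms
proof (induction Z)
  case (insert z Z)
  then have "prod F Z = prod G (\<phi> ` Z) \<or> prod F Z = - prod G (\<phi> ` Z)" by auto
  moreover have "\<phi> z \<notin> \<phi> ` Z" using insert by auto
  moreover have "F z = G (\<phi> z) \<or> F z = - G (\<phi> z)" using insert by auto
  ultimately show ?case using insert.hyps by auto
qed simp

lemma Tab_entry_range:
  assumes "T \<in> Tab n l p" "c \<in> diagram p" "n \<ge> 1"
  shows "1 \<le> T c \<and> T c \<le> n"
proof -
  obtain b where b: "bij_betw b (diagram p) (slots n l)" "\<forall>c\<in>diagram p. T c = fst (b c)"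
    using Tab_bij[OF assms(1)] .
  have "b c \<in> slots n l" using b(1) assms(2) by (auto simp: bij_betw_def)
  then show ?thesis using b(2) assms(2,3) by (auto simp: slots_def)
qed

lemma Tab_entry_unique:
  assumes "T \<in> Tab n l p" "c \<in> diagram p" "c' \<in> diagram p" "T c = T c'" "T c \<noteq> 1"
  shows "c = c'"
proof -
  obtain b where b: "bij_betw b (diagram p) (slots n l)" "\<forall>c\<in>diagram p. T c = fst (b c)"
    using Tab_bij[OF assms(1)] .
  have "b c \<in> slots n l" "b c' \<in> slots n l" using b(1) assms(2,3) by (auto simp: bij_betw_def)
  moreover have "fst (b c) = fst (b c')" "fst (b c) \<noteq> 1" using assms b(2) by auto
  ultimately have "b c = b c'" by (auto simp: slots_def)
  then show ?thesis using b(1) assms(2,3) by (auto simp: bij_betw_def dest: inj_onD)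
qed

lemma tab_pairs_subset:
  assumes "T \<in> Tab n l p" "n \<ge> 1"
  shows "tab_pairs p T \<subseteq> pairs_upto n"
  unfolding tab_pairs_def pairs_upto_def using Tab_entry_range[OF assms(1) _ assms(2)] by fastforce

text \<open>
  Entries of a column need not increase downwards, hence the sign.
\<close>

lemma specht_eq_pair_prod:
  assumes p: "sorted_wrt (\<ge>) p" and T: "T \<in> Tab n l p" and n: "n \<ge> 1"
  shows "specht p T = (pair_prod (tab_pairs p T) :: 'k::field mpoly) \<or>
    specht p T = - (pair_prod (tab_pairs p T) :: 'k mpoly)"
proof -
  let ?h = "column_height p"
  define P where "P = (\<lambda>j. {(i, i'). i < i' \<and> i' < ?h j})"
  have finP: "finite (P j)" for j
    by (rule finite_subset[of _ "{..<?h j} \<times> {..<?h j}"]) (auto simp: P_def)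
  define Z where "Z = Sigma {..<hd p} P"
  define F :: "nat \<times> nat \<times> nat \<Rightarrow> 'k mpoly" where "F = (\<lambda>(j, i, i'). X (T (i, j)) - X (T (i', j)))"
  define \<phi> where "\<phi> = (\<lambda>(j, i, i'). (min (T (i, j)) (T (i', j)), max (T (i, j)) (T (i', j))))"
  define G :: "nat \<times> nat \<Rightarrow> 'k mpoly" where "G = (\<lambda>(u, v). X u - X v)"
  note cell = diagram_iff_column_height[OF p]
  have Zcell: "(i, j) \<in> diagram p" "(i', j) \<in> diagram p" "i < i'" "T (i, j) \<noteq> T (i', j)"
    if "(j, i, i') \<in> Z" for i i' j
  proof -
    show c: "(i, j) \<in> diagram p" "(i', j) \<in> diagram p" "i < i'"
      using that unfolding cell by (auto simp: Z_def P_def)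
    show "T (i, j) \<noteq> T (i', j)" using Tab_column_inj[OF T c(1,2)] c(3) by auto
  qed
  have "specht p T = (\<Prod>j<hd p. \<Prod>z\<in>P j. F (j, z))"
    unfolding specht_def
  proof (intro prod.cong refl)
    fix j
    show "diff_prod (column p T j) = (\<Prod>z\<in>P j. F (j, z))"
      unfolding diff_prod_def column_eq[OF p] P_def F_def
      by (intro prod.cong) auto
  qed
  also have "\<dots> = prod F Z" unfolding Z_def using finP by (subst prod.Sigma) auto
  finally have sp: "specht p T = prod F Z" .
  have inj: "inj_on \<phi> Z"
  proof (rule inj_onI)
    fix z z' assume z: "z \<in> Z" "z' \<in> Z" "\<phi> z = \<phi> z'"
    obtain j i i' k r r' where e: "z = (j, i, i')" "z' = (k, r, r')" by (metis prod_cases3)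
    note c = Zcell[OF z(1)[unfolded e(1)]] and c' = Zcell[OF z(2)[unfolded e(2)]]
    have mm: "min (T (i, j)) (T (i', j)) = min (T (r, k)) (T (r', k))"
      "max (T (i, j)) (T (i', j)) = max (T (r, k)) (T (r', k))"
      using z(3) by (simp_all add: \<phi>_def e)
    then have sets: "T (i, j) = T (r, k) \<and> T (i', j) = T (r', k) \<or> T (i, j) = T (r', k) \<and> T (i', j) = T (r, k)"
      by (auto simp: min_def max_def split: if_splits)
    have "T (i, j) \<noteq> 1 \<or> T (i', j) \<noteq> 1" using c(4) by auto
    then have jk: "j = k"
      using sets Tab_entry_unique[OF T] c(1,2) c'(1,2) by (metis prod.inject)
    have "i = r \<and> i' = r' \<or> i = r' \<and> i' = r"
      using sets Tab_column_inj[OF T] c(1,2) c'(1,2) unfolding jk by metis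
    then show "z = z'" using jk e c(3) c'(3) by auto
  qed
  have img: "\<phi> ` Z = tab_pairs p T"
  proof
    show "\<phi> ` Z \<subseteq> tab_pairs p T"
    proof
      fix e assume "e \<in> \<phi> ` Z"
      then obtain j i i' where z: "(j, i, i') \<in> Z" "e = \<phi> (j, i, i')" by (metis imageE prod_cases3)
      show "e \<in> tab_pairs p T"
        using Zcell[OF z(1)] unfolding z(2) \<phi>_def tab_pairs_def
        by (cases "T (i, j) < T (i', j)") (auto simp: min_def max_def)
    qed
    show "tab_pairs p T \<subseteq> \<phi> ` Z"
    proof
      fix e assume "e \<in> tab_pairs p T"
      then obtain i i' j where e: "e = (T (i, j), T (i', j))" "T (i, j) < T (i', j)"
          "(i, j) \<in> diagram p" "(i', j) \<in> diagram p"
        unfolding tab_pairs_def by auto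
      have "j < hd p" by (rule diagram_column_less[OF p e(3)])
      then have "i < i' \<Longrightarrow> (j, i, i') \<in> Z" "i' < i \<Longrightarrow> (j, i', i) \<in> Z"
        using e(3,4) unfolding cell by (auto simp: Z_def P_def)
      moreover have "\<phi> (j, i, i') = e" "\<phi> (j, i', i) = e" using e(1,2) by (auto simp: \<phi>_def)
      moreover have "i \<noteq> i'" using e(2) by auto
      ultimately show "e \<in> \<phi> ` Z" by (metis image_eqI nat_neq_iff)
    qed
  qed
  have "prod F Z = prod G (\<phi> ` Z) \<or> prod F Z = - prod G (\<phi> ` Z)"
  proof (rule prod_up_to_sign[OF _ inj])
    show "finite Z" using finP by (simp add: Z_def)
    fix z assume "z \<in> Z"
    show "F z = G (\<phi> z) \<or> F z = - G (\<phi> z)"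
      by (cases z) (auto simp: F_def G_def \<phi>_def min_def max_def)
  qed
  then show ?thesis unfolding sp img G_def pair_prod_def .
qed

lemma f_lcm_eq:
  assumes inf: "infinite (UNIV :: 'k::field set)"
    and p: "p \<in> parts_ge n l" and T: "T \<in> Tab n l p" and n: "n \<ge> 1" and mn: "m \<le> n"
  shows "\<exists>v\<in>polys n. \<exists>v'\<in>polys n. v * v' = 1 \<and>
    f_lcm n m p T = v * (pair_prod (tab_pairs p T \<union> pairs_upto m) :: 'k mpoly)"
proof -
  have srt: "sorted_wrt (\<ge>) p" using p by (auto simp: parts_ge_def partitions_def)
  have "pairs_upto m \<subseteq> pairs_upto n" using mn by (auto simp: pairs_upto_def)
  from lcm_pair_prods[OF inf tab_pairs_subset[OF T n] this specht_eq_pair_prod[OF srt T n]]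
  show ?thesis unfolding f_lcm_def Delta_eq .
qed

section \<open>The dominance order\<close>

lemma parts_geD:
  assumes "p \<in> parts_ge n l"
  shows "sorted_wrt (\<ge>) p" "sum_list p = n + l - 1" "\<forall>k\<in>set p. k > 0" "l \<le> hd p"
  using assms by (auto simp: parts_ge_def partitions_def)

lemma dominates_iff:
  assumes "p \<in> parts_ge n l" "q \<in> parts_ge n l"
  shows "p \<unrhd> q \<longleftrightarrow> (\<forall>i. sum_list (take i q) \<le> sum_list (take i p))"
proof
  have le: "sum_list (take i r) \<le> sum_list r" for i and r :: "nat list"
    by (metis append_take_drop_id le_add1 sum_list_append)
  assume dom: "p \<unrhd> q"
  show "\<forall>i. sum_list (take i q) \<le> sum_list (take i p)"
  proof
    fix i
    have tot: "sum_list q = sum_list p" using parts_geD(2)[OF assms(1)] parts_geD(2)[OF assms(2)] by simp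
    consider "i = 0" | "1 \<le> i" "i \<le> min (length p) (length q)" | "i \<ge> length p" | "i \<ge> length q" "i < length p"
      by linarith
    then show "sum_list (take i q) \<le> sum_list (take i p)"
    proof cases
      case 3
      then show ?thesis using le[of i q] tot by simp
    next
      case 4
      show ?thesis
      proof (cases "length q = 0")
        case False
        then have "sum_list (take (length q) q) \<le> sum_list (take (length q) p)"
          using dom[unfolded dominates_def, rule_format, of "length q"] 4 by (simp add: Suc_le_eq)
        also have "\<dots> \<le> sum_list (take i p)"
          using 4(1) le[of "length q" "take i p"] by (simp add: min_absorb1)
        finally show ?thesis using 4(1) by simp
      qed simp
    qed (use dom in \<open>auto simp: dominates_def\<close>)
  qed
qed (auto simp: dominates_def)

lemma finite_parts_ge: "finite (parts_ge n l)"
proof (rule finite_subset)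
  let ?N = "n + l - 1"
  show "parts_ge n l \<subseteq> {xs. set xs \<subseteq> {..?N} \<and> length xs \<le> ?N}"
  proof
    fix p assume p: "p \<in> parts_ge n l"
    have "length p \<le> sum_list p" using parts_geD(3)[OF p]
      by (induction p) (auto simp: Suc_le_eq add_strict_increasing2 add_mono)
    moreover have "k \<le> sum_list p" if "k \<in> set p" for k using that by (rule member_le_sum_list) simp_all
    ultimately show "p \<in> {xs. set xs \<subseteq> {..?N} \<and> length xs \<le> ?N}"
      using parts_geD(2)[OF p] by auto
  qed
  show "finite {xs. set xs \<subseteq> {..?N} \<and> length xs \<le> ?N}" by (rule finite_lists_length_le) simp
qed

lemma finite_Tab: "finite (Tab n l p)"
proof (rule finite_subset)
  show "Tab n l p \<subseteq> PiE (diagram p) (\<lambda>_. insert 1 {..n})"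
  proof
    fix T assume T: "T \<in> Tab n l p"
    obtain b where b: "bij_betw b (diagram p) (slots n l)" "\<forall>c\<in>diagram p. T c = fst (b c)"
      using Tab_bij[OF T] .
    have "T c \<in> insert 1 {..n}" if "c \<in> diagram p" for c
    proof -
      have "b c \<in> slots n l" using b(1) that by (auto simp: bij_betw_def)
      then show ?thesis using b(2) that by (auto simp: slots_def)
    qed
    moreover have "T \<in> extensional (diagram p)" using T unfolding Tab_iff by blast
    ultimately show "T \<in> PiE (diagram p) (\<lambda>_. insert 1 {..n})" by (auto simp: PiE_def)
  qed
  show "finite (PiE (diagram p) (\<lambda>_. insert 1 {..n}))" by (rule finite_PiE) auto
qed

lemma finite_G_set: "finite (G_set n l m p :: 'k::field mpoly set)"
proof -
  have "G_set n l m p = (f_lcm n m p :: _ \<Rightarrow> 'k mpoly) ` Tab n l p" by (auto simp: G_set_def)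
  then show ?thesis using finite_Tab by simp
qed

section \<open>The vanishing ideal\<close>

text \<open>
  Over an infinite field, being a multiple of the Vandermonde product is also a vanishing condition,
  so the whole ideal \<open>J\<close> is the vanishing ideal of a set of points. This makes it evident that \<open>J\<close>
  is radical.
\<close>

definition vanishing_polys :: "nat \<Rightarrow> nat \<Rightarrow> nat \<Rightarrow> nat list set \<Rightarrow> 'k::field mpoly set" where
  "vanishing_polys n l m F = {f \<in> polys n. (\<forall>a. orbit_type n l a \<in> F \<longrightarrow> eval_poly a f = 0) \<and>
     (\<forall>a i j. (i, j) \<in> pairs_upto m \<longrightarrow> a i = a j \<longrightarrow> eval_poly a f = 0)}"

lemma J_ideal_eq_vanishing_polys:
  assumes inf: "infinite (UNIV :: 'k::field set)" and mn: "m \<le> n"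
  shows "J_ideal n l m F = (vanishing_polys n l m F :: 'k mpoly set)"
proof -
  have sub: "pairs_upto m \<subseteq> pairs_upto n" using mn by (auto simp: pairs_upto_def)
  have D: "Delta m \<in> (polys n :: 'k mpoly set)" unfolding Delta_eq by (rule pair_prod_in_polys[OF sub])
  have "f \<in> PIdl\<^bsub>poly_ring n\<^esub> (Delta m) \<longleftrightarrow>
    (\<forall>a i j. (i, j) \<in> pairs_upto m \<longrightarrow> a i = a j \<longrightarrow> eval_poly a f = 0)" (is "_ \<longleftrightarrow> ?V")
    if f: "f \<in> polys n" for f :: "'k mpoly"
  proof
    assume "f \<in> PIdl\<^bsub>poly_ring n\<^esub> (Delta m)"
    then obtain q where q: "f = q * pair_prod (pairs_upto m)"
      by (auto simp: cgenideal_def Delta_eq)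
    show ?V
    proof (intro allI impI)
      fix a :: "nat \<Rightarrow> 'k" and i j assume "(i, j) \<in> pairs_upto m" "a i = a j"
      then have "eval_poly a (pair_prod (pairs_upto m)) = 0"
        using eval_pair_prod_eq_0_iff[OF finite_pairs_upto] by blast
      then show "eval_poly a f = 0" by (simp add: q)
    qed
  next
    assume V: ?V
    have "\<exists>q\<in>polys n. f = pair_prod (pairs_upto m) * q"
      by (rule pair_prod_divides[OF inf sub f]) (use V in blast)
    then show "f \<in> PIdl\<^bsub>poly_ring n\<^esub> (Delta m)"
      by (auto simp: cgenideal_def Delta_eq mult.commute)
  qed
  moreover have "PIdl\<^bsub>poly_ring n\<^esub> (Delta m) \<subseteq> (polys n :: 'k mpoly set)"
    using D by (auto simp: cgenideal_def)
  ultimately show ?thesis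
    unfolding J_ideal_def J_van_def vanishing_polys_def by blast
qed

lemma ideal_vanishing_polys: "ideal (vanishing_polys n l m F :: 'k::field mpoly set) (poly_ring n)"
  unfolding ideal_poly_ring_iff vanishing_polys_def by (auto simp: polys_add polys_mult)

lemma f_lcm_in_vanishing_polys:
  assumes inf: "infinite (UNIV :: 'k::field set)" and n: "n \<ge> 1" and l: "l \<ge> 1" and mn: "m \<le> n"
    and lam: "lam \<in> parts_ge n l" and mu: "mu \<in> parts_ge n l" "mu \<unlhd> lam" and T: "T \<in> Tab n l mu"
  shows "f_lcm n m mu T \<in> (vanishing_polys n l m {nu \<in> parts_ge n l. \<not> nu \<unlhd> lam} :: 'k mpoly set)"
proof -
  let ?E = "tab_pairs mu T \<union> pairs_upto m"
  obtain v where v: "v \<in> polys n" "f_lcm n m mu T = v * (pair_prod ?E :: 'k mpoly)"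
    using f_lcm_eq[OF inf mu(1) T n mn] by blast
  have E: "?E \<subseteq> pairs_upto n" using tab_pairs_subset[OF T n] mn by (auto simp: pairs_upto_def)
  then have finE: "finite ?E" using finite_pairs_upto by (rule finite_subset)
  have van: "eval_poly a (f_lcm n m mu T) = 0" if "(i, j) \<in> ?E" "a i = a j" for a :: "nat \<Rightarrow> 'k" and i j
  proof -
    have "eval_poly a (pair_prod ?E) = 0" using eval_pair_prod_eq_0_iff[OF finE] that by blast
    then show ?thesis by (simp add: v(2))
  qed
  have "eval_poly a (f_lcm n m mu T) = 0" if bad: "\<not> orbit_type n l a \<unlhd> lam" for a :: "nat \<Rightarrow> 'k"
  proof (rule ccontr)
    assume nz: "eval_poly a (f_lcm n m mu T) \<noteq> 0"
    have "sum_list (take i (orbit_type n l a)) \<le> sum_list (take i mu)" for i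
      by (rule orbit_type_dominated[OF parts_geD(1)[OF mu(1)] T]) (use nz van in blast)
    moreover have "sum_list (take i mu) \<le> sum_list (take i lam)" for i
      using mu lam dominates_iff by blast
    ultimately have "orbit_type n l a \<unlhd> lam"
      unfolding dominates_iff[OF lam orbit_type_in_parts_ge[OF n l]] using order.trans by blast
    with bad show False ..
  qed
  moreover have "f_lcm n m mu T \<in> (polys n :: 'k mpoly set)"
    unfolding v(2) using v(1) pair_prod_in_polys[OF E] by blast
  ultimately show ?thesis using van unfolding vanishing_polys_def by blast
qed

section \<open>Leading monomials in the vanishing ideal\<close>

lemma sum_card_levels:
  fixes h :: "'j \<Rightarrow> nat"
  assumes "finite J"
  shows "(\<Sum>r<t. card {j\<in>J. r < h j}) = (\<Sum>j\<in>J. min t (h j))"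
  by (induction t) (simp_all add: min_sum_Suc[OF assms])

lemma card_eq_sum_fibres:
  assumes "finite S" "finite J" "g ` S \<subseteq> J"
  shows "card S = (\<Sum>j\<in>J. card {s \<in> S. g s = j})"
  using sum.group[OF assms, of "\<lambda>_. 1::nat"] by simp

text \<open>
  The shape of the tableau is conjugate to the column heights; its partial sums count the squares
  of the columns up to a given row.
\<close>

lemma tableau_from_column_system:
  assumes n: "n \<ge> 1" and l: "l \<ge> 1"
    and g: "\<forall>s\<in>slots n l. g s < N" "column_separated n l g"
  shows "\<exists>p\<in>parts_ge n l. (\<forall>i. sum_list (take i p) = (\<Sum>j<N. min i (fibre_size n l g j))) \<and>
    (\<exists>T\<in>Tab n l p. \<forall>(u, v)\<in>tab_pairs p T. same_column n l g u v)"
proof -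
  let ?h = "fibre_size n l g"
  \<comment> \<open>The conjugate of the partition formed by the column heights.\<close>
  define H where "H = Max (?h ` {..<N})"
  define p where "p = map (\<lambda>i. card {j\<in>{..<N}. i < ?h j}) [0..<H]"
  have one: "(1, 0) \<in> slots n l" using l by (auto simp: slots_def)
  then have N: "{..<N} \<noteq> {}" using g(1) by fastforce
  have hH: "?h j \<le> H" if "j < N" for j using that by (auto simp: H_def)
  have Hex: "\<exists>j<N. ?h j = H"
    using Max_in[of "?h ` {..<N}"] N unfolding H_def by (auto simp: image_iff)
  have take: "sum_list (take i p) = (\<Sum>j<N. min i (?h j))" for i
  proof -
    have "sum_list (take i p) = (\<Sum>r<min i H. card {j\<in>{..<N}. r < ?h j})"
      by (simp add: p_def take_map sum_list_sum_nth atLeast0LessThan min.commute)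
    also have "\<dots> = (\<Sum>j<N. min (min i H) (?h j))" by (rule sum_card_levels) simp
    also have "\<dots> = (\<Sum>j<N. min i (?h j))"
      using hH by (intro sum.cong refl) (fastforce simp: min_def)
    finally show ?thesis .
  qed
  have tot: "(\<Sum>j<N. ?h j) = n + l - 1"
  proof -
    have "g ` slots n l \<subseteq> {..<N}" using g(1) by auto
    from card_eq_sum_fibres[OF finite_slots finite_lessThan this] show ?thesis
      by (simp add: fibre_size_def card_slots[OF n])
  qed
  have srt: "sorted_wrt (\<ge>) p"
    unfolding p_def sorted_wrt_iff_nth_less by (auto intro!: card_mono)
  have ones: "l \<le> card {j\<in>{..<N}. 0 < ?h j}"
  proof -
    have "inj_on (\<lambda>i. g (1, i)) {..<l}"
      using g(2) unfolding column_separated_def by (intro inj_onI) (fastforce simp: slots_def)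
    moreover have "(\<lambda>i. g (1, i)) ` {..<l} \<subseteq> {j\<in>{..<N}. 0 < ?h j}"
      using g(1) by (auto simp: fibre_size_def card_gt_0_iff slots_def)
    ultimately show ?thesis using card_inj_on_le[of "\<lambda>i. g (1, i)" "{..<l}"] by fastforce
  qed
  have H: "H > 0"
  proof (rule ccontr)
    assume "\<not> H > 0"
    then have "{j\<in>{..<N}. 0 < ?h j} = {}" using hH by fastforce
    then have "card {j\<in>{..<N}. 0 < ?h j} = 0" by (simp only: card.empty)
    then show False using ones l by linarith
  qed
  have "p \<in> parts_ge n l"
    unfolding parts_ge_def partitions_def
  proof (intro CollectI conjI ballI)
    show "sum_list p = n + l - 1"
    proof -
      have "sum_list p = sum_list (take H p)" by (simp add: p_def)
      also have "\<dots> = (\<Sum>j<N. ?h j)"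
        unfolding take using hH by (intro sum.cong refl) (simp add: min_absorb2)
      finally show ?thesis using tot by simp
    qed
    fix k assume "k \<in> set p"
    then obtain i where i: "i < H" "k = card {j\<in>{..<N}. i < ?h j}" by (auto simp: p_def)
    then have "{j\<in>{..<N}. i < ?h j} \<noteq> {}" using Hex by auto
    then show "k > 0" using i(2) by (simp add: card_gt_0_iff)
  next
    show "l \<le> hd p" using ones H by (simp add: p_def hd_map)
  qed (rule srt)
  moreover have "\<exists>T\<in>Tab n l p. \<forall>(u, v)\<in>tab_pairs p T.
    \<exists>s\<in>slots n l. \<exists>s'\<in>slots n l. s \<noteq> s' \<and> g s = g s' \<and> fst s = u \<and> fst s' = v"
  proof (rule tableau_from_columns[of "{..<N}"])
    show "g ` slots n l \<subseteq> {..<N}" using g(1) by auto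
    show "s = s'" if "s \<in> slots n l" "s' \<in> slots n l" "g s = g s'" "fst s = fst s'" for s s'
      using g(2) that unfolding column_separated_def by blast
    fix i
    have "{j\<in>{..<N}. i < ?h j} = {}" if "\<not> i < H" using hH that by fastforce
    then show "card {j \<in> {..<N}. i < card {s \<in> slots n l. g s = j}} = (if i < length p then p ! i else 0)"
      unfolding fibre_size_def[symmetric] by (cases "i < H") (simp_all add: p_def)
  qed (use srt in auto)
  then have "\<exists>T\<in>Tab n l p. \<forall>(u, v)\<in>tab_pairs p T. same_column n l g u v"
    unfolding same_column_def by fast
  ultimately show ?thesis using take by blast
qed

text \<open>
  The point supplied with the columns is not a zero of \<open>f\<close>, so its orbit type
  is dominated by \<open>lam\<close>; since it dominates the shape of the columns, that shape is one of the
  admissible ones.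
\<close>

lemma lead_monom_divisible:
  fixes f :: "'k::field mpoly"
  assumes inf: "infinite (UNIV :: 'k set)" and n: "n \<ge> 1" and l: "l \<ge> 1" and m: "1 \<le> m" and mn: "m \<le> n"
    and lam: "lam \<in> parts_ge n l"
    and f: "f \<in> vanishing_polys n l m {nu \<in> parts_ge n l. \<not> nu \<unlhd> lam}" "f \<noteq> 0"
  shows "\<exists>h\<in>\<Union>mu\<in>{mu \<in> parts_ge n l. mu \<unlhd> lam}. G_set n l m mu. (h :: 'k mpoly) \<noteq> 0 \<and>
    (\<forall>v. Poly_Mapping.lookup (lead_monom h) v \<le> Poly_Mapping.lookup (lead_monom f) v)"
proof -
  have fp: "f \<in> polys n" and van: "\<forall>a i j. (i, j) \<in> pairs_upto m \<longrightarrow> a i = a j \<longrightarrow> eval_poly a f = 0"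
    and orb: "\<And>a. orbit_type n l a \<in> parts_ge n l \<Longrightarrow> \<not> orbit_type n l a \<unlhd> lam \<Longrightarrow> eval_poly a f = 0"
    using f(1) unfolding vanishing_polys_def by blast+
  obtain g a where g: "\<forall>s\<in>slots n l. g s < n + l" "column_separated n l g"
    and exps: "\<forall>v\<in>{1..n}. card {u. 1 \<le> u \<and> u < v \<and> (v \<le> m \<or> same_column n l g u v)}
        \<le> Poly_Mapping.lookup (lead_monom f) v"
    and a: "eval_poly a f \<noteq> 0"
    and dom: "\<forall>i. (\<Sum>j<n + l. min i (fibre_size n l g j)) \<le> sum_list (take i (orbit_type n l a))"
    using lead_monom_column_system[OF inf m l mn order.refl fp f(2) van] by (elim exE conjE) (rule that)
  obtain mu T where mu: "mu \<in> parts_ge n l"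
      "\<forall>i. sum_list (take i mu) = (\<Sum>j<n + l. min i (fibre_size n l g j))"
    and T: "T \<in> Tab n l mu" "\<forall>(u, v)\<in>tab_pairs mu T. same_column n l g u v"
    using tableau_from_column_system[OF n l g] by blast
  have o: "orbit_type n l a \<in> parts_ge n l" by (rule orbit_type_in_parts_ge[OF n l])
  have "orbit_type n l a \<unlhd> lam" using orb[OF o] a by blast
  moreover have "mu \<unlhd> orbit_type n l a" using dom mu by (simp add: dominates_iff[OF o mu(1)])
  ultimately have mulam: "mu \<unlhd> lam"
    unfolding dominates_iff[OF o mu(1)] dominates_iff[OF lam o] dominates_iff[OF lam mu(1)]
    using order.trans by blast
  let ?E = "tab_pairs mu T \<union> pairs_upto m"
  have E: "?E \<subseteq> pairs_upto n" using tab_pairs_subset[OF T(1) n] mn by (auto simp: pairs_upto_def)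
  obtain w w' where w: "w * w' = 1" "f_lcm n m mu T = w * (pair_prod ?E :: 'k mpoly)"
    using f_lcm_eq[OF inf mu(1) T(1) n mn] by blast
  have nz: "w \<noteq> 0" "pair_prod ?E \<noteq> (0 :: 'k mpoly)" using w(1) pair_prod_nonzero[OF E] by auto
  have "lead_monom (f_lcm n m mu T :: 'k mpoly) = lead_monom (pair_prod ?E :: 'k mpoly)"
    unfolding w(2) lead_monom_mult[OF nz] lead_monom_unit[OF w(1)] by simp
  then have look: "Poly_Mapping.lookup (lead_monom (f_lcm n m mu T :: 'k mpoly)) v = card {u. (u, v) \<in> ?E}" for v
    using lookup_lead_pair_prod[OF E, where 'k = 'k] by simp
  have "card {u. (u, v) \<in> ?E} \<le> Poly_Mapping.lookup (lead_monom f) v" for v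
  proof (cases "v \<in> {1..n}")
    case True
    have "{u. (u, v) \<in> ?E} \<subseteq> {u. 1 \<le> u \<and> u < v \<and> (v \<le> m \<or> same_column n l g u v)}"
      using T(2) E by (auto simp: pairs_upto_def)
    then have "card {u. (u, v) \<in> ?E} \<le> card {u. 1 \<le> u \<and> u < v \<and> (v \<le> m \<or> same_column n l g u v)}"
      by (intro card_mono) auto
    also have "\<dots> \<le> Poly_Mapping.lookup (lead_monom f) v" using exps True by blast
    finally show ?thesis .
  next
    case False
    then have "{u. (u, v) \<in> ?E} = {}" using E by (auto simp: pairs_upto_def)
    then show ?thesis by simp
  qed
  then have "\<forall>v. Poly_Mapping.lookup (lead_monom (f_lcm n m mu T :: 'k mpoly)) v \<le>
      Poly_Mapping.lookup (lead_monom f) v"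
    unfolding look by blast
  moreover have "f_lcm n m mu T \<noteq> (0 :: 'k mpoly)" unfolding w(2) using nz by simp
  moreover have "(f_lcm n m mu T :: 'k mpoly) \<in> (\<Union>mu\<in>{mu \<in> parts_ge n l. mu \<unlhd> lam}. G_set n l m mu)"
    using T(1) mu(1) mulam unfolding G_set_def by blast
  ultimately show ?thesis by blast
qed

section \<open>Division\<close>

text \<open>
  Exponents are read from \<open>x_n\<close> down to \<open>x_1\<close>, which turns the order into the lexicographic order on
  lists of fixed length.
\<close>

lemma wf_lex_less: "wf {(s, t). Poly_Mapping.keys s \<subseteq> {1..n} \<and> Poly_Mapping.keys t \<subseteq> {1..n} \<and> lex_less s t}"
proof (rule wf_subset)
  let ?L = "rev [1..<Suc n]"
  let ?v = "\<lambda>t. map (Poly_Mapping.lookup t) ?L"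
  show "wf (inv_image (lexn less_than n) ?v)" by (intro wf_inv_image wf_lexn wf_less_than)
  show "{(s, t). Poly_Mapping.keys s \<subseteq> {1..n} \<and> Poly_Mapping.keys t \<subseteq> {1..n} \<and> lex_less s t} \<subseteq>
    inv_image (lexn less_than n) ?v"
  proof clarify
    fix s t :: monom
    assume keys: "Poly_Mapping.keys s \<subseteq> {1..n}" "Poly_Mapping.keys t \<subseteq> {1..n}" and "lex_less s t"
    then obtain i where i: "Poly_Mapping.lookup s i < Poly_Mapping.lookup t i"
      "\<forall>j>i. Poly_Mapping.lookup s j = Poly_Mapping.lookup t j" unfolding lex_less_def by blast
    have "i \<in> Poly_Mapping.keys t" using i(1) by (simp add: in_keys_iff)
    then have i1n: "1 \<le> i" "i \<le> n" using keys(2) by auto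
    have L: "?L = rev [Suc i..<Suc n] @ i # rev [1..<i]"
    proof -
      have "[1..<Suc n] = [1..<i] @ [i..<Suc n]"
        using upt_add_eq_append[of 1 i "Suc n - i"] i1n by simp
      also have "[i..<Suc n] = i # [Suc i..<Suc n]" using i1n by (intro upt_conv_Cons) simp
      finally show ?thesis by simp
    qed
    have "map (Poly_Mapping.lookup s) (rev [Suc i..<Suc n]) = map (Poly_Mapping.lookup t) (rev [Suc i..<Suc n])"
      using i(2) by (intro map_cong) auto
    then have "?v s = map (Poly_Mapping.lookup t) (rev [Suc i..<Suc n]) @
        Poly_Mapping.lookup s i # map (Poly_Mapping.lookup s) (rev [1..<i])"
      "?v t = map (Poly_Mapping.lookup t) (rev [Suc i..<Suc n]) @
        Poly_Mapping.lookup t i # map (Poly_Mapping.lookup t) (rev [1..<i])"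
      unfolding L by simp_all
    moreover have "length (?v s) = n" "length (?v t) = n" by simp_all
    moreover have "(Poly_Mapping.lookup s i, Poly_Mapping.lookup t i) \<in> less_than" using i(1) by simp
    ultimately show "(s, t) \<in> inv_image (lexn less_than n) ?v"
      unfolding in_inv_image lexn_conv mem_Collect_eq case_prod_conv by blast
  qed
qed

lemma lookup_single_mult:
  fixes h :: "'k::field mpoly"
  shows "Poly_Mapping.lookup (Poly_Mapping.single t c * h) (t + s) = c * Poly_Mapping.lookup h s"
proof (cases "c = 0")
  case False
  then have "Poly_Mapping.lookup (Poly_Mapping.single t c * h) (t + s) =
    (\<Sum>u\<in>Poly_Mapping.keys h. if u = s then c * Poly_Mapping.lookup h s else 0)"
    unfolding lookup_mult_keys by (auto intro!: sum.cong)
  also have "\<dots> = c * Poly_Mapping.lookup h s" by (simp add: in_keys_iff)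
  finally show ?thesis .
qed simp

lemma lead_monom_keys: "f \<noteq> 0 \<Longrightarrow> lead_monom f \<in> Poly_Mapping.keys f"
  using is_lead_lead_monom is_lead_def by blast

lemma keys_lead_monom_subset: "f \<in> polys n \<Longrightarrow> f \<noteq> 0 \<Longrightarrow> Poly_Mapping.keys (lead_monom f) \<subseteq> {1..n}"
  using lead_monom_keys polys_iff by blast

lemma monom_diff_add:
  fixes s t :: monom
  assumes "\<And>v. Poly_Mapping.lookup s v \<le> Poly_Mapping.lookup t v"
  shows "(t - s) + s = t" "Poly_Mapping.keys (t - s) \<subseteq> Poly_Mapping.keys t"
proof -
  show "(t - s) + s = t" using assms by (intro poly_mapping_eqI) (simp add: lookup_add lookup_minus)
  show "Poly_Mapping.keys (t - s) \<subseteq> Poly_Mapping.keys t" by (auto simp: in_keys_iff lookup_minus)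
qed

text \<open>
  Cancelling the leading term of \<open>f\<close> by a multiple of an element of \<open>G\<close> stays in \<open>I\<close> and lowers the
  leading monomial.
\<close>

lemma ideal_subset_by_division:
  fixes I Q :: "'k::field mpoly set"
  assumes I: "ideal I (poly_ring n)" and Q: "ideal Q (poly_ring n)" and G: "G \<subseteq> I" "G \<subseteq> Q"
    and lead: "\<And>f. f \<in> I \<Longrightarrow> f \<noteq> 0 \<Longrightarrow> \<exists>h\<in>G. h \<noteq> 0 \<and>
      (\<forall>v. Poly_Mapping.lookup (lead_monom h) v \<le> Poly_Mapping.lookup (lead_monom f) v)"
  shows "I \<subseteq> Q"
proof -
  let ?r = "{(s, t). Poly_Mapping.keys s \<subseteq> {1..n} \<and> Poly_Mapping.keys t \<subseteq> {1..n} \<and> lex_less s t}"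
  have keys: "Poly_Mapping.keys (lead_monom f) \<subseteq> {1..n}" if "f \<in> I" "f \<noteq> 0" for f
    using idealD(1)[OF I] that by (intro keys_lead_monom_subset) auto
  have "f \<in> Q" if "f \<in> I" "f \<noteq> 0" "lead_monom f = t" for f t
    using that
  proof (induction t arbitrary: f rule: wf_induct[OF wf_lex_less[of n]])
    case (1 t)
    note IH = 1(1) and f = 1(2-4)
    obtain h where h: "h \<in> G" "h \<noteq> 0"
      "\<And>v. Poly_Mapping.lookup (lead_monom h) v \<le> Poly_Mapping.lookup (lead_monom f) v"
      using lead[OF f(1,2)] by blast
    define u where "u = lead_monom f - lead_monom h"
    have u: "u + lead_monom h = lead_monom f" "Poly_Mapping.keys u \<subseteq> {1..n}"
      using monom_diff_add[OF h(3)] keys[OF f(1,2)] unfolding u_def by auto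
    define c where "c = Poly_Mapping.lookup f (lead_monom f) / Poly_Mapping.lookup h (lead_monom h)"
    have hl: "Poly_Mapping.lookup h (lead_monom h) \<noteq> 0" and fl: "Poly_Mapping.lookup f (lead_monom f) \<noteq> 0"
      using lead_monom_keys h(2) f(2) by (auto simp: in_keys_iff)
    then have c: "c \<noteq> 0" by (simp add: c_def)
    define r where "r = Poly_Mapping.single u c * h"
    have up: "Poly_Mapping.single u c \<in> polys n" using u(2) by (rule polys_single)
    have r: "r \<in> I" "r \<in> Q" unfolding r_def using idealD(4)[OF I _ up] idealD(4)[OF Q _ up] G h(1) by blast+
    have rl: "is_lead r (lead_monom f)"
      unfolding r_def u(1)[symmetric] by (intro is_lead_mult is_lead_single is_lead_lead_monom c h(2))
    have "f - r \<in> Q"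
    proof (cases "f - r = 0")
      case True
      then show ?thesis using idealD(2)[OF Q] by simp
    next
      case False
      have frI: "f - r \<in> I" using idealD(6)[OF I f(1) r(1)] .
      have "Poly_Mapping.lookup r (lead_monom f) = Poly_Mapping.lookup f (lead_monom f)"
        using lookup_single_mult[of u c h "lead_monom h"] hl by (simp add: r_def u(1) c_def)
      then have "Poly_Mapping.lookup (f - r) (lead_monom f) = 0" by (simp add: lookup_minus)
      then have "lead_monom (f - r) \<noteq> lead_monom f"
        using lead_monom_keys[OF False] by (auto simp: in_keys_iff)
      moreover have "lead_monom (f - r) \<in> Poly_Mapping.keys f \<union> Poly_Mapping.keys r"
        using lead_monom_keys[OF False] by (auto simp: in_keys_iff lookup_minus)
      ultimately have "lex_less (lead_monom (f - r)) (lead_monom f)"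
        using rl is_lead_lead_monom[OF f(2)] unfolding is_lead_def by blast
      then have "(lead_monom (f - r), t) \<in> ?r"
        using keys[OF frI False] keys[OF f(1,2)] f(3) by simp
      then show ?thesis using IH frI False by blast
    qed
    then have "(f - r) + r \<in> Q" using idealD(3)[OF Q _ r(2)] by blast
    then show ?case by simp
  qed
  then show ?thesis using idealD(2)[OF Q] by blast
qed

section \<open>Radical membership by case distinction\<close>

lemma power_diff_in_ideal:
  fixes I :: "'k::field mpoly set"
  assumes I: "ideal I (poly_ring n)" and "x - y \<in> I" "x \<in> polys n" "y \<in> polys n"
  shows "x ^ q - y ^ q \<in> I"
proof -
  have "x ^ q - y ^ q = (\<Sum>i<q. y ^ (q - Suc i) * x ^ i) * (x - y)"
    unfolding power_diff_sumr2 by (simp add: mult.commute)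
  moreover have "(\<Sum>i<q. y ^ (q - Suc i) * x ^ i) \<in> polys n"
    using assms(3,4) by (auto intro!: polys_sum polys_mult polys_power)
  ultimately show ?thesis using idealD(4)[OF I assms(2)] by simp
qed

text \<open>
  Radical membership by case distinction: for each \<open>e\<close> one may either add \<open>x e\<close> to the ideal or
  multiply \<open>f\<close> by \<open>x e\<close>. Indeed, let \<open>u = x e\<close>; if \<open>f^k = i + s u\<close> with \<open>i \<in> I\<close> and \<open>(f u)^q \<in> I\<close>, then
  \<open>f^{k q}\<close> is congruent to \<open>s^q u^q\<close> modulo \<open>I\<close>, and hence \<open>f^{k q + q} \<in> I\<close>. With the
  differences of the variables as \<open>x e\<close>, this replaces the Nullstellensatz: the cases are the ways
  in which coordinates of a point can coincide, over any field.
\<close>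

lemma radical_by_splitting:
  fixes I :: "'k::field mpoly set" and x :: "'i \<Rightarrow> 'k mpoly"
  assumes "finite U" "x ` U \<subseteq> polys n" "ideal I (poly_ring n)" "f \<in> polys n"
    and "\<And>E I'. E \<subseteq> U \<Longrightarrow> ideal I' (poly_ring n) \<Longrightarrow> I \<subseteq> I' \<Longrightarrow> x ` E \<subseteq> I' \<Longrightarrow>
      f * (\<Prod>e\<in>U - E. x e) \<in> I'"
  shows "\<exists>k\<ge>1. f ^ k \<in> I"
  using assms
proof (induction U arbitrary: I f rule: finite_induct)
  case empty
  then have "f \<in> I" using empty(4)[of "{}" I] by simp
  then show ?case by (intro exI[of _ 1]) simp
next
  case (insert e0 U)
  note I = insert.prems(2) and f = insert.prems(3) and hyp = insert.prems(4)
  define u where "u = x e0"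
  have u: "u \<in> polys n" and U: "x ` U \<subseteq> polys n" using insert.prems(1) by (auto simp: u_def)
  have "\<exists>q\<ge>1. (f * u) ^ q \<in> I"
  proof (rule insert.IH[OF U I])
    show "f * u \<in> polys n" using f u by blast
    fix E I' assume E: "E \<subseteq> U" "ideal I' (poly_ring n)" "I \<subseteq> I'" "x ` E \<subseteq> I'"
    have "insert e0 U - E = insert e0 (U - E)" using insert.hyps(2) E(1) by auto
    then have "f * (\<Prod>e\<in>insert e0 U - E. x e) = f * u * (\<Prod>e\<in>U - E. x e)"
      using insert.hyps by (simp add: mult.assoc u_def)
    moreover have "f * (\<Prod>e\<in>insert e0 U - E. x e) \<in> I'" by (rule hyp) (use E in auto)
    ultimately show "f * u * (\<Prod>e\<in>U - E. x e) \<in> I'" by metis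
  qed
  then obtain q where q: "q \<ge> 1" "(f * u) ^ q \<in> I" by blast
  \<comment> \<open>The ideal generated by \<open>I\<close> and \<open>u\<close>.\<close>
  define I1 where "I1 = {i + s * u | i s. i \<in> I \<and> s \<in> polys n}"
  note D = idealD[OF I]
  have I1: "ideal I1 (poly_ring n)"
    unfolding ideal_poly_ring_iff
  proof (intro conjI ballI)
    show "I1 \<subseteq> polys n" unfolding I1_def using D(1) u by (auto intro!: polys_add polys_mult)
    have "0 = 0 + 0 * u" by simp
    then show "0 \<in> I1" unfolding I1_def using D(2) polys_0 by blast
    fix z assume "z \<in> I1"
    then obtain i s where z: "z = i + s * u" "i \<in> I" "s \<in> polys n" unfolding I1_def by blast
    show "z + y \<in> I1" if "y \<in> I1" for y
    proof -
      obtain i' s' where y: "y = i' + s' * u" "i' \<in> I" "s' \<in> polys n" using \<open>y \<in> I1\<close> unfolding I1_def by blast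
      have "z + y = (i + i') + (s + s') * u" using z(1) y(1) by (simp add: algebra_simps)
      then show ?thesis unfolding I1_def using D(3)[OF z(2) y(2)] polys_add[OF z(3) y(3)] by blast
    qed
    show "y * z \<in> I1" if "y \<in> polys n" for y
    proof -
      have "y * z = y * i + (y * s) * u" using z(1) by (simp add: algebra_simps)
      then show ?thesis unfolding I1_def using D(4)[OF z(2) that] polys_mult[OF that z(3)] by blast
    qed
  qed
  have II1: "I \<subseteq> I1"
  proof
    fix i assume "i \<in> I"
    moreover have "i = i + 0 * u" by simp
    ultimately show "i \<in> I1" unfolding I1_def using polys_0 by blast
  qed
  have uI1: "u \<in> I1"
  proof -
    have "u = 0 + 1 * u" by simp
    then show ?thesis unfolding I1_def using D(2) polys_1 by blast
  qed
  have "\<exists>k\<ge>1. f ^ k \<in> I1"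
  proof (rule insert.IH[OF U I1 f])
    fix E I' assume E: "E \<subseteq> U" "ideal I' (poly_ring n)" "I1 \<subseteq> I'" "x ` E \<subseteq> I'"
    have "insert e0 U - insert e0 E = U - E" using insert.hyps(2) by auto
    moreover have "f * (\<Prod>e\<in>insert e0 U - insert e0 E. x e) \<in> I'"
      by (rule hyp) (use E II1 uI1 in \<open>auto simp: u_def\<close>)
    ultimately show "f * (\<Prod>e\<in>U - E. x e) \<in> I'" by metis
  qed
  then obtain k i s where k: "k \<ge> 1" "f ^ k = i + s * u" "i \<in> I" "s \<in> polys n" unfolding I1_def by blast
  have "(f ^ k) ^ q - (s * u) ^ q \<in> I"
  proof (rule power_diff_in_ideal[OF I])
    show "f ^ k - s * u \<in> I" using k(2,3) by simp
    show "f ^ k \<in> polys n" using f by (rule polys_power)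
    show "s * u \<in> polys n" using k(4) u by (rule polys_mult)
  qed
  then have "f ^ q * ((f ^ k) ^ q - (s * u) ^ q) \<in> I" by (rule D(4)) (use f in blast)
  moreover have "s ^ q * (f * u) ^ q \<in> I" by (rule D(4)[OF q(2)]) (use k(4) in blast)
  ultimately have "f ^ q * ((f ^ k) ^ q - (s * u) ^ q) + s ^ q * (f * u) ^ q \<in> I" by (rule D(3))
  moreover have "f ^ q * ((f ^ k) ^ q - (s * u) ^ q) + s ^ q * (f * u) ^ q = f ^ (q + k * q)"
    by (simp add: algebra_simps power_mult_distrib power_add power_mult)
  ultimately show ?case using q(1) by (intro exI[of _ "q + k * q"]) auto
qed

section \<open>The radical of the ideal of a partition\<close>

lemma G_set_subset_vanishing_polys:
  assumes inf: "infinite (UNIV :: 'k::field set)" and n: "n \<ge> 1" and l: "l \<ge> 1" and mn: "m \<le> n"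
    and lam: "lam \<in> parts_ge n l"
  shows "(\<Union>mu\<in>{mu \<in> parts_ge n l. mu \<unlhd> lam}. G_set n l m mu) \<subseteq>
    (vanishing_polys n l m {nu \<in> parts_ge n l. \<not> nu \<unlhd> lam} :: 'k mpoly set)"
proof
  fix h :: "'k mpoly"
  assume "h \<in> (\<Union>mu\<in>{mu \<in> parts_ge n l. mu \<unlhd> lam}. G_set n l m mu)"
  then obtain mu T where "mu \<in> parts_ge n l" "mu \<unlhd> lam" "T \<in> Tab n l mu" "h = f_lcm n m mu T"
    unfolding G_set_def by blast
  then show "h \<in> vanishing_polys n l m {nu \<in> parts_ge n l. \<not> nu \<unlhd> lam}"
    using f_lcm_in_vanishing_polys[OF inf n l mn lam] by blast
qed

lemma vanishing_polys_subset_ideal: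
  fixes Q :: "'k::field mpoly set"
  assumes inf: "infinite (UNIV :: 'k set)" and n: "n \<ge> 1" and l: "l \<ge> 1" and m: "1 \<le> m" and mn: "m \<le> n"
    and lam: "lam \<in> parts_ge n l"
    and Q: "ideal Q (poly_ring n)" "(\<Union>mu\<in>{mu \<in> parts_ge n l. mu \<unlhd> lam}. G_set n l m mu) \<subseteq> Q"
  shows "vanishing_polys n l m {nu \<in> parts_ge n l. \<not> nu \<unlhd> lam} \<subseteq> Q"
proof (rule ideal_subset_by_division[OF ideal_vanishing_polys Q(1) _ Q(2)])
  show "(\<Union>mu\<in>{mu \<in> parts_ge n l. mu \<unlhd> lam}. G_set n l m mu) \<subseteq>
    (vanishing_polys n l m {nu \<in> parts_ge n l. \<not> nu \<unlhd> lam} :: 'k mpoly set)"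
    by (rule G_set_subset_vanishing_polys[OF inf n l mn lam])
  fix f :: "'k mpoly"
  assume "f \<in> vanishing_polys n l m {nu \<in> parts_ge n l. \<not> nu \<unlhd> lam}" "f \<noteq> 0"
  then show "\<exists>h\<in>\<Union>mu\<in>{mu \<in> parts_ge n l. mu \<unlhd> lam}. G_set n l m mu. (h :: 'k mpoly) \<noteq> 0 \<and>
      (\<forall>v. Poly_Mapping.lookup (lead_monom h) v \<le> Poly_Mapping.lookup (lead_monom f) v)"
    by (rule lead_monom_divisible[OF inf n l m mn lam])
qed

lemma pair_prod_split:
  assumes "E \<subseteq> E'" "E' \<subseteq> pairs_upto n"
  shows "pair_prod E' = pair_prod (E' - E) * pair_prod E"
  unfolding pair_prod_def using assms finite_subset[OF assms(2)] by (intro prod.subset_diff) auto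

text \<open>
  One case of the distinction: the differences indexed by \<open>E\<close> are zero modulo \<open>I'\<close>, the others are
  factors of the multiplier. If a further difference lies in \<open>I'\<close>, or one of those that divide
  \<open>f_{m,T}\<close> does, the claim is clear. Otherwise congruence of variables modulo \<open>I'\<close> colours the
  indices so that each column of \<open>T\<close> has different colours. Then the orbit type of this colouring is
  dominated by \<open>mu\<close>, hence by \<open>lam\<close>, and there is a tableau \<open>T'\<close> of shape \<open>lam\<close> whose columns have
  different colours; all differences that divide \<open>f_{m,T'}\<close> are factors of the multiplier.
\<close>

lemma specht_times_complement_in_ideal:
  fixes I' :: "'k::field mpoly set"
  assumes inf: "infinite (UNIV :: 'k set)" and n: "n \<ge> 1" and l: "l \<ge> 1" and mn: "m \<le> n"
    and lam: "lam \<in> parts_ge n l" and mu: "mu \<in> parts_ge n l" "mu \<unlhd> lam" and T: "T \<in> Tab n l mu"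
    and E: "E \<subseteq> pairs_upto n" and I': "ideal I' (poly_ring n)" "I_ideal n l m lam \<subseteq> I'"
      "\<And>u v. (u, v) \<in> E \<Longrightarrow> X u - X v \<in> I'"
  shows "f_lcm n m mu T * pair_prod (pairs_upto n - E) \<in> I'"
proof -
  note D = idealD[OF I'(1)]
  let ?P = "pair_prod (pairs_upto n - E) :: 'k mpoly"
  have P: "?P \<in> polys n" by (rule pair_prod_in_polys) auto
  let ?ET = "tab_pairs mu T \<union> pairs_upto m"
  have ET: "?ET \<subseteq> pairs_upto n" using tab_pairs_subset[OF T n] mn by (auto simp: pairs_upto_def)
  obtain w where w: "w \<in> polys n" "f_lcm n m mu T = w * (pair_prod ?ET :: 'k mpoly)"
    using f_lcm_eq[OF inf mu(1) T n mn] by blast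
  have fT: "f_lcm n m mu T \<in> (polys n :: 'k mpoly set)"
    unfolding w(2) by (rule polys_mult[OF w(1) pair_prod_in_polys[OF ET]])
  have factor: "pair_prod A \<in> I'" if "(u, v) \<in> A" "X u - X v \<in> I'" "A \<subseteq> pairs_upto n" for u v A
  proof -
    have "pair_prod A = pair_prod (A - {(u, v)}) * (X u - X v :: 'k mpoly)"
      using pair_prod_split[of "{(u, v)}" A n] that by (simp add: pair_prod_def)
    moreover have "pair_prod (A - {(u, v)}) \<in> polys n"
      using that(3) by (intro pair_prod_in_polys) auto
    ultimately show ?thesis using D(4)[OF that(2)] by simp
  qed
  show ?thesis
  proof (cases "\<exists>(u, v)\<in>pairs_upto n - E. X u - X v \<in> I'")
    case True
    then have "?P \<in> I'" using factor[of _ _ "pairs_upto n - E"] by blast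
    then show ?thesis using fT by (rule D(4))
  next
    case False
    \<comment> \<open>The residue class of \<open>x_i\<close> modulo \<open>I'\<close>, recorded as the set of indices congruent to \<open>i\<close>: a
      point with coordinates in a set without any arithmetic, which suffices for orbit types.\<close>
    define a where "a = (\<lambda>i. {j \<in> {1..n}. X i - X j \<in> I'})"
    have a_eq: "X i - X j \<in> I'" if "a i = a j" "i \<in> {1..n}" "j \<in> {1..n}" for i j
    proof -
      have "j \<in> a j" unfolding a_def using D(2) that(3) by simp
      then show ?thesis using that(1) unfolding a_def by blast
    qed
    show ?thesis
    proof (cases "\<exists>(u, v)\<in>?ET. a u = a v")
      case True
      then obtain u v where uv: "(u, v) \<in> ?ET" "a u = a v" by blast
      then have "X u - X v \<in> I'" using ET by (intro a_eq) (auto simp: pairs_upto_def)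
      then have "pair_prod ?ET \<in> I'" using factor[OF uv(1) _ ET] by blast
      then have "f_lcm n m mu T \<in> I'" unfolding w(2) using D(4) w(1) by blast
      then show ?thesis using D(4)[OF _ P] by (metis mult.commute)
    next
      case sep: False
      have "sum_list (take i (orbit_type n l a)) \<le> sum_list (take i mu)" for i
        by (rule orbit_type_dominated[OF parts_geD(1)[OF mu(1)] T]) (use sep in blast)
      moreover have "sum_list (take i mu) \<le> sum_list (take i lam)" for i
        using mu lam dominates_iff by blast
      ultimately have "sum_list (take i (orbit_type n l a)) \<le> sum_list (take i lam)" for i
        using order.trans by blast
      then obtain T' where T': "T' \<in> Tab n l lam" "\<forall>(u, v)\<in>tab_pairs lam T'. a u \<noteq> a v"
        using exists_tableau_separating_colours[OF lam n] by blast
      let ?E' = "tab_pairs lam T' \<union> pairs_upto m"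
      have E': "?E' \<subseteq> pairs_upto n" using tab_pairs_subset[OF T'(1) n] mn by (auto simp: pairs_upto_def)
      obtain v v' where v: "v' \<in> polys n" "v * v' = 1" "f_lcm n m lam T' = v * (pair_prod ?E' :: 'k mpoly)"
        using f_lcm_eq[OF inf lam T'(1) n mn] by blast
      have "f_lcm n m lam T' \<in> (G_set n l m lam :: 'k mpoly set)" using T'(1) unfolding G_set_def by blast
      moreover have "G_set n l m lam \<subseteq> (polys n :: 'k mpoly set)"
      proof
        fix h :: "'k mpoly" assume "h \<in> G_set n l m lam"
        then obtain T'' where "T'' \<in> Tab n l lam" "h = f_lcm n m lam T''" unfolding G_set_def by blast
        then show "h \<in> polys n"
          using f_lcm_in_vanishing_polys[OF inf n l mn lam lam] unfolding vanishing_polys_def dominates_def by blast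
      qed
      ultimately have "f_lcm n m lam T' \<in> I'"
        using ideal_Idl(2) I'(2) unfolding I_ideal_def by blast
      then have "v' * (v * pair_prod ?E') \<in> I'" using D(4) v(1) unfolding v(3) by blast
      then have pE': "pair_prod ?E' \<in> I'" using v(2) by (simp add: mult.assoc[symmetric] mult.commute[of v'])
      have "e \<notin> E" if "e \<in> ?E'" for e
      proof
        assume "e \<in> E"
        obtain i j where e: "e = (i, j)" by (cases e)
        have "X i - X j \<in> I'" using I'(3) \<open>e \<in> E\<close> e by blast
        moreover have "a i \<noteq> a j" using that T'(2) sep e by blast
        ultimately have "False" if "X i - X j \<in> I' \<Longrightarrow> a i = a j" using that by blast
        moreover have "a i = a j" if ij: "X i - X j \<in> I'"
        proof -
          have "X i - X k \<in> I' \<longleftrightarrow> X j - X k \<in> I'" for k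
          proof
            assume "X i - X k \<in> I'"
            then have "(X i - X k) - (X i - X j) \<in> I'" using ij by (rule D(6))
            then show "X j - X k \<in> I'" by (simp add: algebra_simps)
          next
            assume "X j - X k \<in> I'"
            then have "(X j - X k) + (X i - X j) \<in> I'" using ij by (rule D(3))
            then show "X i - X k \<in> I'" by (simp add: algebra_simps)
          qed
          then show ?thesis by (simp add: a_def)
        qed
        ultimately show False by blast
      qed
      then have "?E' \<subseteq> pairs_upto n - E" using E' by blast
      then have "?P = pair_prod (pairs_upto n - E - ?E') * pair_prod ?E'"
        by (rule pair_prod_split) auto
      moreover have "pair_prod (pairs_upto n - E - ?E') \<in> (polys n :: 'k mpoly set)"
        by (rule pair_prod_in_polys) auto
      ultimately have "?P \<in> I'" using D(4)[OF pE'] by simp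
      then show ?thesis using fT by (rule D(4))
    qed
  qed
qed

lemma dominates_refl: "p \<unrhd> p"
  by (simp add: dominates_def)

text \<open>
  One inclusion holds because a vanishing ideal is radical. For the other one, the case distinction
  reduces the claim to products of elements of the vanishing ideal with differences, and these need
  only be considered for the generators found by division.
\<close>

lemma radical_I_ideal:
  assumes inf: "infinite (UNIV :: 'k::field set)" and n: "n \<ge> 1" and l: "l \<ge> 1" and m: "1 \<le> m" and mn: "m \<le> n"
    and lam: "lam \<in> parts_ge n l"
  shows "radical (poly_ring n) (I_ideal n l m lam) =
    (vanishing_polys n l m {nu \<in> parts_ge n l. \<not> nu \<unlhd> lam} :: 'k mpoly set)"
    (is "radical ?R ?I = ?V")
proof
  have GV: "G_set n l m lam \<subseteq> ?V"
    using G_set_subset_vanishing_polys[OF inf n l mn lam] lam dominates_refl[of lam] by blast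
  then have IV: "?I \<subseteq> ?V" unfolding I_ideal_def by (rule Idl_minimal[OF ideal_vanishing_polys])
  have Gp: "G_set n l m lam \<subseteq> (polys n :: 'k mpoly set)" using GV unfolding vanishing_polys_def by blast
  have I: "ideal ?I ?R" unfolding I_ideal_def by (rule ideal_Idl(1)[OF Gp])
  show "radical ?R ?I \<subseteq> ?V"
  proof
    fix f assume "f \<in> radical ?R ?I"
    then obtain k :: nat where k: "f \<in> polys n" "f ^ k \<in> ?V"
      using IV unfolding radical_def nat_pow_poly_ring by blast
    then show "f \<in> ?V" unfolding vanishing_polys_def by (simp; blast)
  qed
  show "?V \<subseteq> radical ?R ?I"
  proof
    fix f assume f: "f \<in> ?V"
    then have fp: "f \<in> polys n" unfolding vanishing_polys_def by blast
    have "\<exists>k\<ge>1. f ^ k \<in> ?I"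
    proof (rule radical_by_splitting[OF finite_pairs_upto[of n] _ I fp])
      show "(\<lambda>e. X (fst e) - X (snd e)) ` pairs_upto n \<subseteq> (polys n :: 'k mpoly set)"
        by (auto simp: pairs_upto_def intro!: polys_diff polys_X)
      fix E and I' :: "'k mpoly set"
      assume E: "E \<subseteq> pairs_upto n" and I': "ideal I' ?R" "?I \<subseteq> I'" "(\<lambda>e. X (fst e) - X (snd e)) ` E \<subseteq> I'"
      note D = idealD[OF I'(1)]
      let ?P = "pair_prod (pairs_upto n - E) :: 'k mpoly"
      \<comment> \<open>A colon ideal, so that membership need only be checked for generators.\<close>
      let ?Q = "{h \<in> polys n. h * ?P \<in> I'}"
      have "ideal ?Q ?R"
        unfolding ideal_poly_ring_iff using D(2,3,4) by (auto simp: distrib_right mult.assoc)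
      moreover have "(\<Union>mu\<in>{mu \<in> parts_ge n l. mu \<unlhd> lam}. G_set n l m mu) \<subseteq> ?Q"
      proof
        fix h :: "'k mpoly"
        assume h: "h \<in> (\<Union>mu\<in>{mu \<in> parts_ge n l. mu \<unlhd> lam}. G_set n l m mu)"
        then obtain mu T where mu: "mu \<in> parts_ge n l" "mu \<unlhd> lam" "T \<in> Tab n l mu" "h = f_lcm n m mu T"
          unfolding G_set_def by blast
        have "X u - X v \<in> I'" if "(u, v) \<in> E" for u v using I'(3) that by fastforce
        then have "h * ?P \<in> I'" unfolding mu(4)
          using specht_times_complement_in_ideal[OF inf n l mn lam mu(1-3) E I'(1,2)] by blast
        moreover have "h \<in> ?V" using G_set_subset_vanishing_polys[OF inf n l mn lam] h by blast
        ultimately show "h \<in> ?Q" unfolding vanishing_polys_def by blast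
      qed
      ultimately have "f \<in> ?Q" using vanishing_polys_subset_ideal[OF inf n l m mn lam] f by blast
      then show "f * (\<Prod>e\<in>pairs_upto n - E. X (fst e) - X (snd e)) \<in> I'"
        unfolding pair_prod_def case_prod_unfold by blast
    qed
    then show "f \<in> radical ?R ?I" using fp unfolding radical_def nat_pow_poly_ring by blast
  qed
qed

section \<open>Sums of ideals and initial ideals\<close>

lemma ideal_sum_ideal:
  fixes I :: "'i \<Rightarrow> 'k::field mpoly set"
  assumes "finite A" "\<forall>i\<in>A. ideal (I i) (poly_ring n)"
  shows "ideal (ideal_sum A I) (poly_ring n)" "i \<in> A \<Longrightarrow> I i \<subseteq> ideal_sum A I"
    "ideal V (poly_ring n) \<Longrightarrow> (\<And>i. i \<in> A \<Longrightarrow> I i \<subseteq> V) \<Longrightarrow> ideal_sum A I \<subseteq> V"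
proof -
  note D = idealD[OF assms(2)[rule_format]]
  have sumI: "(\<Sum>i\<in>A. g i) \<in> ideal_sum A I" if "\<forall>i\<in>A. g i \<in> I i" for g
    using that unfolding ideal_sum_def by blast
  show "ideal (ideal_sum A I) (poly_ring n)"
    unfolding ideal_poly_ring_iff
  proof (intro conjI ballI subsetI)
    fix f assume "f \<in> ideal_sum A I"
    then obtain g where g: "f = (\<Sum>i\<in>A. g i)" "\<forall>i\<in>A. g i \<in> I i" unfolding ideal_sum_def by blast
    show "f \<in> polys n" unfolding g(1) using g(2) D(1) by (intro polys_sum) blast
    show "f + f' \<in> ideal_sum A I" if "f' \<in> ideal_sum A I" for f'
    proof -
      obtain g' where g': "f' = (\<Sum>i\<in>A. g' i)" "\<forall>i\<in>A. g' i \<in> I i"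
        using \<open>f' \<in> ideal_sum A I\<close> unfolding ideal_sum_def by blast
      have "f + f' = (\<Sum>i\<in>A. g i + g' i)" by (simp add: g(1) g'(1) sum.distrib)
      then show ?thesis using sumI[of "\<lambda>i. g i + g' i"] g(2) g'(2) D(3) by simp
    qed
    show "h * f \<in> ideal_sum A I" if "h \<in> polys n" for h
      using sumI[of "\<lambda>i. h * g i"] g(2) D(4) that by (simp add: g(1) sum_distrib_left)
  next
    show "0 \<in> ideal_sum A I" using sumI[of "\<lambda>_. 0"] D(2) by simp
  qed
  show "I i \<subseteq> ideal_sum A I" if i: "i \<in> A"
  proof
    fix f assume "f \<in> I i"
    then have "\<forall>j\<in>A. (if j = i then f else 0) \<in> I j" using D(2) by simp
    from sumI[OF this] show "f \<in> ideal_sum A I" using assms(1) i by simp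
  qed
  show "ideal_sum A I \<subseteq> V" if V: "ideal V (poly_ring n)" "\<And>i. i \<in> A \<Longrightarrow> I i \<subseteq> V"
  proof
    fix f assume "f \<in> ideal_sum A I"
    then obtain g where g: "f = (\<Sum>i\<in>A. g i)" "\<forall>i\<in>A. g i \<in> I i" unfolding ideal_sum_def by blast
    have "(\<Sum>i\<in>B. g i) \<in> V" if "B \<subseteq> A" for B
      using finite_subset[OF that assms(1)] that
    proof (induction B)
      case (insert j B)
      then have "g j \<in> V" using g(2) V(2) by blast
      then show ?case using insert idealD(3)[OF V(1)] by simp
    qed (use idealD(2)[OF V(1)] in simp)
    then show "f \<in> V" using g(1) by blast
  qed
qed

lemma initial_ideal_mono:
  assumes "G \<subseteq> I" "I \<subseteq> polys n"
  shows "initial_ideal n G \<subseteq> (initial_ideal n I :: 'k::field mpoly set)"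
proof -
  let ?in = "\<lambda>f :: 'k mpoly. Poly_Mapping.single (lead_monom f) (1 :: 'k)"
  have "?in ` (I - {0}) \<subseteq> polys n"
  proof (rule image_subsetI)
    fix f assume "f \<in> I - {0}"
    then show "?in f \<in> polys n"
      using assms(2) by (intro polys_single keys_lead_monom_subset) auto
  qed
  from ideal_Idl[OF this] show ?thesis
    unfolding initial_ideal_def using assms(1) by (intro Idl_minimal) blast+
qed

lemma initial_ideal_eqI:
  fixes G I :: "'k::field mpoly set"
  assumes G: "G \<subseteq> I" and I: "I \<subseteq> polys n"
    and lead: "\<And>f. f \<in> I \<Longrightarrow> f \<noteq> 0 \<Longrightarrow> \<exists>h\<in>G. h \<noteq> 0 \<and>
      (\<forall>v. Poly_Mapping.lookup (lead_monom h) v \<le> Poly_Mapping.lookup (lead_monom f) v)"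
  shows "initial_ideal n G = initial_ideal n I"
proof
  let ?in = "\<lambda>f :: 'k mpoly. Poly_Mapping.single (lead_monom f) (1 :: 'k)"
  show "initial_ideal n G \<subseteq> initial_ideal n I" by (rule initial_ideal_mono[OF G I])
  have keys: "Poly_Mapping.keys (lead_monom f) \<subseteq> {1..n}" if "f \<in> I" "f \<noteq> 0" for f
    using that I by (intro keys_lead_monom_subset) auto
  have "?in ` (G - {0}) \<subseteq> polys n" using keys G by (intro image_subsetI polys_single) blast
  note J = ideal_Idl[OF this]
  have "?in ` (I - {0}) \<subseteq> Idl\<^bsub>poly_ring n\<^esub> (?in ` (G - {0}))"
  proof
    fix x assume "x \<in> ?in ` (I - {0})"
    then obtain f where f: "f \<in> I" "f \<noteq> 0" "x = ?in f" by blast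
    obtain h where h: "h \<in> G" "h \<noteq> 0"
      "\<And>v. Poly_Mapping.lookup (lead_monom h) v \<le> Poly_Mapping.lookup (lead_monom f) v"
      using lead[OF f(1,2)] by blast
    note u = monom_diff_add[OF h(3)]
    have "?in h \<in> Idl\<^bsub>poly_ring n\<^esub> (?in ` (G - {0}))" using J(2) h(1,2) by blast
    moreover have "Poly_Mapping.single (lead_monom f - lead_monom h) (1 :: 'k) \<in> polys n"
      using u(2) keys[OF f(1,2)] by (intro polys_single) blast
    ultimately have "Poly_Mapping.single (lead_monom f - lead_monom h) 1 * ?in h \<in>
      Idl\<^bsub>poly_ring n\<^esub> (?in ` (G - {0}))" by (rule idealD(4)[OF J(1)])
    then show "x \<in> Idl\<^bsub>poly_ring n\<^esub> (?in ` (G - {0}))" by (simp add: mult_single u(1) f(3))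
  qed
  then show "initial_ideal n I \<subseteq> initial_ideal n G"
    unfolding initial_ideal_def by (rule Idl_minimal[OF J(1)])
qed

theorem corollary4p5:
  fixes n l m :: nat and lam :: "nat list" and F :: "nat list set"
  assumes "infinite (UNIV :: 'k::field set)"
    and "n \<ge> 1" and "l \<ge> 1"
    and "1 \<le> m" and "m \<le> n"
    and "lam \<in> parts_ge n l"
    and "F = {nu \<in> parts_ge n l. \<not> nu \<unlhd> lam}"
  shows "upper_filter n l F \<and>
    radical (poly_ring n) (I_ideal n l m lam) = (J_ideal n l m F :: 'k mpoly set) \<and>
    is_groebner_basis n (\<Union>mu \<in> {mu \<in> parts_ge n l. mu \<unlhd> lam}. G_set n l m mu)
      (radical (poly_ring n) (I_ideal n l m lam) :: 'k mpoly set) \<and>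
    radical (poly_ring n) (I_ideal n l m lam :: 'k mpoly set) =
      ideal_sum {mu \<in> parts_ge n l. mu \<unlhd> lam} (I_ideal n l m)"
proof -
  note inf = assms(1) and n = assms(2) and l = assms(3) and m = assms(4) and mn = assms(5)
    and lam = assms(6) and F = assms(7)
  let ?V = "vanishing_polys n l m F :: 'k mpoly set"
  let ?A = "{mu \<in> parts_ge n l. mu \<unlhd> lam}"
  let ?G = "\<Union>mu\<in>?A. G_set n l m mu :: 'k mpoly set"
  have rad: "radical (poly_ring n) (I_ideal n l m lam) = ?V"
    unfolding F by (rule radical_I_ideal[OF inf n l m mn lam])
  have GV: "?G \<subseteq> ?V" unfolding F by (rule G_set_subset_vanishing_polys[OF inf n l mn lam])
  have V: "ideal ?V (poly_ring n)" by (rule ideal_vanishing_polys)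
  have finA: "finite ?A" using finite_parts_ge by simp
  have "upper_filter n l F"
    unfolding upper_filter_def
  proof (intro conjI ballI impI)
    fix p q assume pq: "p \<in> F" "q \<in> parts_ge n l" "q \<unrhd> p"
    have p: "p \<in> parts_ge n l" "\<not> p \<unlhd> lam" using pq(1) F by auto
    have "\<not> q \<unlhd> lam"
    proof
      assume "q \<unlhd> lam"
      with pq(3) have "p \<unlhd> lam"
        unfolding dominates_iff[OF lam pq(2)] dominates_iff[OF pq(2) p(1)] dominates_iff[OF lam p(1)]
        using order.trans by blast
      with p(2) show False ..
    qed
    then show "q \<in> F" using pq(2) F by simp
  qed (use F in blast)
  moreover have "radical (poly_ring n) (I_ideal n l m lam) = (J_ideal n l m F :: 'k mpoly set)"
    unfolding rad J_ideal_eq_vanishing_polys[OF inf mn] ..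
  moreover have "is_groebner_basis n ?G (radical (poly_ring n) (I_ideal n l m lam))"
    unfolding is_groebner_basis_def rad
  proof (intro conjI V GV)
    show "finite ?G" using finA finite_G_set by blast
    show "initial_ideal n ?G = initial_ideal n ?V"
    proof (rule initial_ideal_eqI[OF GV idealD(1)[OF V]])
      fix f assume "f \<in> ?V" "f \<noteq> 0"
      from lead_monom_divisible[OF inf n l m mn lam this[unfolded F]]
      show "\<exists>h\<in>?G. h \<noteq> 0 \<and> (\<forall>v. Poly_Mapping.lookup (lead_monom h) v \<le> Poly_Mapping.lookup (lead_monom f) v)" .
    qed
  qed
  moreover have "?V = ideal_sum ?A (I_ideal n l m)"
  proof
    have sub: "G_set n l m mu \<subseteq> ?V" if "mu \<in> ?A" for mu using GV that by blast
    have Gp: "G_set n l m mu \<subseteq> (polys n :: 'k mpoly set)" if "mu \<in> ?A" for mu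
      using sub[OF that] idealD(1)[OF V] by (rule order.trans)
    have Imu: "ideal (I_ideal n l m mu :: 'k mpoly set) (poly_ring n)" if "mu \<in> ?A" for mu
      unfolding I_ideal_def by (rule ideal_Idl(1)[OF Gp[OF that]])
    then have "\<forall>mu\<in>?A. ideal (I_ideal n l m mu :: 'k mpoly set) (poly_ring n)" by blast
    note S = ideal_sum_ideal[OF finA this]
    have "?G \<subseteq> ideal_sum ?A (I_ideal n l m)"
    proof
      fix h assume "h \<in> ?G"
      then obtain mu where mu: "mu \<in> ?A" "h \<in> G_set n l m mu" by blast
      then have "h \<in> I_ideal n l m mu" unfolding I_ideal_def using ideal_Idl(2)[OF Gp[OF mu(1)]] by blast
      then show "h \<in> ideal_sum ?A (I_ideal n l m)" using S(2)[OF mu(1)] by blast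
    qed
    then show "?V \<subseteq> ideal_sum ?A (I_ideal n l m)"
      unfolding F using S(1) by (intro vanishing_polys_subset_ideal[OF inf n l m mn lam]) auto
    show "ideal_sum ?A (I_ideal n l m) \<subseteq> ?V"
    proof (rule S(3)[OF V])
      fix mu assume "mu \<in> ?A"
      then show "I_ideal n l m mu \<subseteq> ?V" unfolding I_ideal_def by (intro Idl_minimal[OF V] sub)
    qed
  qed
  ultimately show ?thesis unfolding rad by blast
qed

end
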